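(* Let $N\ge1$, $0<\alpha<1$, $\lambda\in\mathbb{C}\setminus\{0\}$ and suppose $s>3+\frac{N}{2}+\alpha$. There exists $u_0\in C^\infty_c(\mathbb{R}^N)$ such that there is no $T>0$ for which there exists a solution $u\in C([0,T],H^s(\mathbb{R}^N))$ of $$iu_t=\Delta u+\lambda|u|^\alpha u,\qquad u(0,\cdot)=u_0.$$
   Context: All functions are complex-valued. $C^\infty_c(\mathbb{R}^N)$ is the space of smooth compactly supported functions. $H^s(\mathbb{R}^N)$ is the usual $L^2$-based Sobolev space with norm $\|u\|_{H^s}=\|\mathcal{F}^{-1}[(1+|\xi|^2)^{s/2}\widehat u]\|_{L^2}$. Since $s>3+\frac N2$, for $u\in C([0,T],H^s(\mathbb{R}^N))$ the functions $\Delta u$ and $|u|^\alpha u$ belong to $C([0,T]\times\mathbb{R}^N)\cap C([0,T],L^2(\mathbb{R}^N))$, so the equation makes sense for such $u$; a solution is a $u\in C([0,T],H^s(\mathbb{R}^N))$ satisfying the equation on $[0,T]\times\mathbb{R}^N$ (so that $u_t\in C([0,T]\times\mathbb{R}^N)\cap C([0,T],L^2(\mathbb{R}^N))$) together with the initial condition. *)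

theory Defs
  imports "HOL-Analysis.Analysis"
begin

definition partial_derivative :: "'n \<Rightarrow> (real^'n \<Rightarrow> complex) \<Rightarrow> real^'n \<Rightarrow> complex" where
  "partial_derivative i f x = frechet_derivative f (at x) (axis i 1)"

definition laplacian :: "(real^'n \<Rightarrow> complex) \<Rightarrow> real^'n \<Rightarrow> complex" where
  "laplacian f x = (\<Sum>i\<in>UNIV. partial_derivative i (partial_derivative i f) x)"

primrec C_diff :: "nat \<Rightarrow> (real^'n \<Rightarrow> complex) \<Rightarrow> bool" where
  "C_diff 0 f \<longleftrightarrow> continuous_on UNIV f"
| "C_diff (Suc k) f \<longleftrightarrow> f differentiable_on UNIV \<and> (\<forall>i. C_diff k (partial_derivative i f))"

definition test_function :: "(real^'n \<Rightarrow> complex) \<Rightarrow> bool" where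
  "test_function f \<longleftrightarrow> (\<forall>k. C_diff k f) \<and> compact (closure {x. f x \<noteq> 0})"

definition square_integrable :: "(real^'n \<Rightarrow> complex) \<Rightarrow> bool" where
  "square_integrable f \<longleftrightarrow>
     f \<in> borel_measurable lebesgue \<and> integrable lebesgue (\<lambda>x. (cmod (f x))\<^sup>2)"

definition L2_norm :: "(real^'n \<Rightarrow> complex) \<Rightarrow> real" where
  "L2_norm f = sqrt (integral\<^sup>L lebesgue (\<lambda>x. (cmod (f x))\<^sup>2))"

definition fourier_integral :: "(real^'n \<Rightarrow> complex) \<Rightarrow> real^'n \<Rightarrow> complex" where
  "fourier_integral f \<xi> = integral\<^sup>L lebesgue (\<lambda>x. cis (- (x \<bullet> \<xi>)) * f x)"

(* The Fourier-Plancherel transform of a square-integrable f: the L^2 limit, as R tends to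
   infinity, of the Fourier integrals of f restricted to the ball of radius R. These restrictions
   are both integrable and square-integrable, so by Plancherel the limit exists; it is
   unique up to a null set, and SOME selects a representative. *)
definition fourier :: "(real^'n \<Rightarrow> complex) \<Rightarrow> real^'n \<Rightarrow> complex" where
  "fourier f = (SOME g. square_integrable g \<and>
     ((\<lambda>R::real. L2_norm (\<lambda>\<xi>. fourier_integral (\<lambda>x. indicator (cball 0 R) x * f x) \<xi> - g \<xi>))
        \<longlongrightarrow> 0) at_top)"

(* The inverse transform is (2 pi)^(-N) times the integral of exp(i x.xi) g(xi), extended to L^2
   in the same way: up to the constant it is the forward transform evaluated at -x. *)
definition inverse_fourier :: "(real^'n \<Rightarrow> complex) \<Rightarrow> real^'n \<Rightarrow> complex" where
  "inverse_fourier g x = fourier g (- x) / of_real ((2 * pi) ^ CARD('n))"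

definition bessel_multiplier :: "real \<Rightarrow> (real^'n \<Rightarrow> complex) \<Rightarrow> real^'n \<Rightarrow> complex" where
  "bessel_multiplier s f \<xi> = of_real ((1 + (norm \<xi>)\<^sup>2) powr (s / 2)) * fourier f \<xi>"

(* For s >= 0 only (the case used here): then every tempered distribution in H^s is an L^2
   function, so H^s can be carved out of L^2. *)
definition sobolev :: "real \<Rightarrow> (real^'n \<Rightarrow> complex) \<Rightarrow> bool" where
  "sobolev s f \<longleftrightarrow> square_integrable f \<and> square_integrable (bessel_multiplier s f)"

definition sobolev_norm :: "real \<Rightarrow> (real^'n \<Rightarrow> complex) \<Rightarrow> real" where
  "sobolev_norm s f = L2_norm (inverse_fourier (bessel_multiplier s f))"

(* Elements of C([0,T], H^s) for s > N/2. An element of H^s is a class of functions modulo null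
   sets; for s > N/2 the class contains exactly one continuous function, and u t denotes it. *)
definition sobolev_path :: "real \<Rightarrow> real \<Rightarrow> (real \<Rightarrow> real^'n \<Rightarrow> complex) \<Rightarrow> bool" where
  "sobolev_path s T u \<longleftrightarrow>
     (\<forall>t\<in>{0..T}. sobolev s (u t) \<and> continuous_on UNIV (u t)) \<and>
     (\<forall>t\<in>{0..T}. ((\<lambda>r. sobolev_norm s (\<lambda>x. u r x - u t x)) \<longlongrightarrow> 0) (at t within {0..T}))"

(* Pointwise on [0,T] x R^N, with one-sided time derivatives at t = 0 and t = T. For
   s > 2 + N/2 each u t is of class C^2, so laplacian (u t) is the classical Laplacian. *)
definition nls_solution ::
  "real \<Rightarrow> complex \<Rightarrow> real \<Rightarrow> (real^'n \<Rightarrow> complex) \<Rightarrow> real \<Rightarrow> (real \<Rightarrow> real^'n \<Rightarrow> complex) \<Rightarrow> bool"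
  where
  "nls_solution \<alpha> lam s u0 T u \<longleftrightarrow>
     sobolev_path s T u \<and>
     (\<forall>t\<in>{0..T}. \<forall>x. \<exists>ut.
        ((\<lambda>r. u r x) has_vector_derivative ut) (at t within {0..T}) \<and>
        \<i> * ut = laplacian (u t) x + lam * of_real (cmod (u t x) powr \<alpha>) * u t x) \<and>
     (\<forall>x. u 0 x = u0 x)"

end

(*
  The datum is u0(x) = x_i * exp (-1 / (1 - |x|^2)) on the unit ball: odd, with a simple zero at the
  origin. The nonlinearity maps odd functions to odd functions, so an energy estimate for the even
  part u(t, x) + u(t, -x) keeps a solution odd for a short time; in particular the zero at the
  origin does not move. Integrating the equation in time,
    lam * int_0^t |u|^alpha u = i (u(t) - u0) - int_0^t Laplacian u,
  and taking second differences D f = f(2h) - 2 f(h) + f(0) along the i-th axis, the right-hand side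
  is O(h^(1+b)) for some b > alpha, because (1 + |xi|)^(3+b) times the Fourier transform of u is
  integrable, uniformly in time, for 3 + b < s - N/2. The left-hand side is at least of
  order t * h^(1+alpha), since |u|^alpha u behaves like |x|^alpha x near its simple zero.
*)

theory Submission
  imports Defs "HOL-Probability.Characteristic_Functions"
begin

section \<open>The space of square-integrable functions\<close>

text \<open>The Sobolev hypotheses speak of a chosen Fourier-Plancherel transform, fixed only up to
  null sets, while the equation and the second differences are pointwise. The bridge is a formula
  \<open>u t = FT 1 (G t)\<close> valid at every point. It rests on Plancherel, on inversion for
  continuous L2 functions, and on Cauchy-Schwarz, which turns the weighted L2 bound into a weighted
  L1 bound at the price of N/2 derivatives. Of the rest, the Laplacian takes two, and its second
  difference needs 1 + b more.

  The zero has to stay at one point because the lower bound is integrated over time at fixed points.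
  There u(2h) equals 2 u(h) up to O(h^(1+b)), and the homogeneity of |z|^alpha z leaves the positive
  factor 2^(1+alpha) - 2. Only the real part of the second difference of |u|^alpha u is bounded
  below and \<open>lam\<close> enters through its modulus, so its phase is harmless.

  The equation gives the time derivative pointwise only. The energy identity is therefore integrated
  in time for each x, and then in x by Fubini.\<close>

text \<open>\<open>square_integrable\<close> asks for Lebesgue measurability only, while Fubini and
  the affine substitutions are applied to Borel functions on \<open>lborel\<close>. Representatives
  of this kind connect the two settings.\<close>

lemma ex_borel_AE_eq:
  fixes f :: "'a::euclidean_space \<Rightarrow> complex"
  assumes "f \<in> borel_measurable lebesgue"
  obtains g where "g \<in> borel_measurable borel" "AE x in lborel. f x = g x"
proof -
  have "(\<lambda>x. Re (f x)) \<in> borel_measurable lebesgue" "(\<lambda>x. Im (f x)) \<in> borel_measurable lebesgue"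
    using assms by auto
  from this[THEN completion_ex_borel_measurable_real]
  obtain a b where ab: "a \<in> borel_measurable lborel" "b \<in> borel_measurable lborel"
    "AE x in lborel. Re (f x) = a x" "AE x in lborel. Im (f x) = b x" by auto
  show thesis
  proof
    show "(\<lambda>x. Complex (a x) (b x)) \<in> borel_measurable borel"
      using ab by (auto simp: borel_measurable_complex_iff)
    show "AE x in lborel. f x = Complex (a x) (b x)"
      using ab(3,4) by eventually_elim (simp add: complex_eq_iff)
  qed
qed

lemma square_integrable_measurable:
  "square_integrable f \<Longrightarrow> f \<in> borel_measurable lebesgue"
  by (simp add: square_integrable_def)

lemma L2_norm_nonneg [simp]: "0 \<le> L2_norm f"
  by (simp add: L2_norm_def integral_nonneg_AE)

lemma L2_norm_sq: "(L2_norm f)\<^sup>2 = integral\<^sup>L lebesgue (\<lambda>x. (cmod (f x))\<^sup>2)"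
  by (simp add: L2_norm_def integral_nonneg_AE)

lemma square_integrable_iff_nn:
  "square_integrable f \<longleftrightarrow> f \<in> borel_measurable lebesgue \<and> (\<integral>\<^sup>+x. ennreal ((cmod (f x))\<^sup>2) \<partial>lebesgue) < \<infinity>"
  unfolding square_integrable_def integrable_iff_bounded by auto

lemma nn_integral_square:
  "square_integrable f \<Longrightarrow> (\<integral>\<^sup>+x. ennreal ((cmod (f x))\<^sup>2) \<partial>lebesgue) = ennreal ((L2_norm f)\<^sup>2)"
  unfolding L2_norm_sq square_integrable_def by (intro nn_integral_eq_integral) auto

lemma square_integrable_le:
  assumes "f \<in> borel_measurable lebesgue" "(\<integral>\<^sup>+x. ennreal ((cmod (f x))\<^sup>2) \<partial>lebesgue) \<le> ennreal (C\<^sup>2)" "C \<ge> 0"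
  shows "square_integrable f" "L2_norm f \<le> C"
proof -
  show *: "square_integrable f"
    using assms(1,2) unfolding square_integrable_iff_nn by (auto intro: le_less_trans)
  have "ennreal ((L2_norm f)\<^sup>2) \<le> ennreal (C\<^sup>2)"
    using nn_integral_square[OF *] assms(2) by simp
  then have "(L2_norm f)\<^sup>2 \<le> C\<^sup>2" by (simp add: ennreal_le_iff)
  then show "L2_norm f \<le> C" using assms(3) by (simp add: power2_le_iff_abs_le)
qed

lemma square_integrable_cong_AE:
  assumes "AE x in lebesgue. f x = g x" "square_integrable f" "g \<in> borel_measurable lebesgue"
  shows "square_integrable g" "L2_norm g = L2_norm f"
proof -
  have e: "(\<integral>\<^sup>+x. ennreal ((cmod (g x))\<^sup>2) \<partial>lebesgue) = (\<integral>\<^sup>+x. ennreal ((cmod (f x))\<^sup>2) \<partial>lebesgue)"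
    by (rule nn_integral_cong_AE) (use assms(1) in eventually_elim, simp)
  then show g: "square_integrable g"
    using assms unfolding square_integrable_iff_nn by auto
  have "(L2_norm g)\<^sup>2 = (L2_norm f)\<^sup>2"
    using e nn_integral_square[OF g] nn_integral_square[OF assms(2)] by simp
  then show "L2_norm g = L2_norm f"
    by (simp add: power2_eq_iff_nonneg)
qed

lemma L2_norm_cong_AE:
  assumes "AE x in lebesgue. f x = g x" "f \<in> borel_measurable lebesgue" "g \<in> borel_measurable lebesgue"
  shows "L2_norm g = L2_norm f"
  unfolding L2_norm_def
  by (intro arg_cong[where f=sqrt] integral_cong_AE)
     (use assms in \<open>auto elim!: eventually_mono\<close>)

lemma square_integrable_dominated:
  assumes "f \<in> borel_measurable lebesgue" "square_integrable g" "AE x in lebesgue. cmod (f x) \<le> C * cmod (g x)" "C \<ge> 0"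
  shows "square_integrable f" "L2_norm f \<le> C * L2_norm g"
proof -
  have "(\<integral>\<^sup>+x. ennreal ((cmod (f x))\<^sup>2) \<partial>lebesgue) \<le> (\<integral>\<^sup>+x. ennreal (C\<^sup>2) * ennreal ((cmod (g x))\<^sup>2) \<partial>lebesgue)"
    by (rule nn_integral_mono_AE)
       (use assms(3) in \<open>eventually_elim, auto simp flip: ennreal_mult power_mult_distrib intro!: ennreal_leI power_mono\<close>)
  also have "\<dots> = ennreal (C\<^sup>2) * ennreal ((L2_norm g)\<^sup>2)"
    by (subst nn_integral_cmult) (use assms(2) in \<open>auto simp: nn_integral_square square_integrable_def\<close>)
  also have "\<dots> = ennreal ((C * L2_norm g)\<^sup>2)"
    by (simp add: power_mult_distrib flip: ennreal_mult)
  finally show "square_integrable f" "L2_norm f \<le> C * L2_norm g"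
    using square_integrable_le[OF assms(1), of "C * L2_norm g"] assms(4) by auto
qed

lemma square_integrable_mult_left:
  assumes "square_integrable f"
  shows "square_integrable (\<lambda>x. c * f x)" "L2_norm (\<lambda>x. c * f x) = cmod c * L2_norm f"
proof -
  show "square_integrable (\<lambda>x. c * f x)"
    by (rule square_integrable_dominated(1)[OF _ assms, of _ "cmod c"])
       (use assms in \<open>auto simp: norm_mult square_integrable_def\<close>)
  show "L2_norm (\<lambda>x. c * f x) = cmod c * L2_norm f"
    unfolding L2_norm_def by (simp add: norm_mult power_mult_distrib real_sqrt_mult)
qed

lemma square_integrable_product:
  assumes "square_integrable f" "square_integrable g"
  shows "integrable lebesgue (\<lambda>x. f x * g x)"
    and "(\<integral>x. cmod (f x) * cmod (g x) \<partial>lebesgue) \<le> L2_norm f * L2_norm g"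
    and "cmod (\<integral>x. f x * g x \<partial>lebesgue) \<le> L2_norm f * L2_norm g"
proof -
  note [measurable] = assms[THEN square_integrable_measurable]
  have "(\<integral>\<^sup>+x. ennreal (cmod (f x)) * ennreal (cmod (g x)) \<partial>lebesgue)\<^sup>2 \<le>
     (\<integral>\<^sup>+x. (ennreal (cmod (f x)))\<^sup>2 \<partial>lebesgue) * (\<integral>\<^sup>+x. (ennreal (cmod (g x)))\<^sup>2 \<partial>lebesgue)"
    by (rule Cauchy_Schwarz_nn_integral) auto
  also have "\<dots> = ennreal ((L2_norm f)\<^sup>2) * ennreal ((L2_norm g)\<^sup>2)"
    using assms[THEN nn_integral_square] by (simp add: ennreal_power)
  also have "\<dots> = (ennreal (L2_norm f * L2_norm g))\<^sup>2"
    by (simp add: power_mult_distrib ennreal_power flip: ennreal_mult)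
  finally have le: "(\<integral>\<^sup>+x. ennreal (cmod (f x)) * ennreal (cmod (g x)) \<partial>lebesgue) \<le> ennreal (L2_norm f * L2_norm g)"
    by (cases "\<integral>\<^sup>+x. ennreal (cmod (f x)) * ennreal (cmod (g x)) \<partial>lebesgue")
       (auto simp: ennreal_power top_power_ennreal power2_le_iff_abs_le top_unique)
  then have le': "(\<integral>\<^sup>+x. ennreal (cmod (f x) * cmod (g x)) \<partial>lebesgue) \<le> ennreal (L2_norm f * L2_norm g)"
    by (simp add: ennreal_mult)
  show i: "integrable lebesgue (\<lambda>x. f x * g x)"
    unfolding integrable_iff_bounded norm_mult using le' by (auto intro: le_less_trans)
  have i': "integrable lebesgue (\<lambda>x. cmod (f x) * cmod (g x))"
    using integrable_norm[OF i] by (simp add: norm_mult)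
  then show l: "(\<integral>x. cmod (f x) * cmod (g x) \<partial>lebesgue) \<le> L2_norm f * L2_norm g"
    using le' nn_integral_eq_integral[OF i'] by simp
  have "cmod (\<integral>x. f x * g x \<partial>lebesgue) \<le> (\<integral>x. cmod (f x * g x) \<partial>lebesgue)"
    by (rule integral_norm_bound)
  then show "cmod (\<integral>x. f x * g x \<partial>lebesgue) \<le> L2_norm f * L2_norm g"
    using l by (simp add: norm_mult)
qed

lemma square_integrable_add:
  assumes "square_integrable f" "square_integrable g"
  shows "square_integrable (\<lambda>x. f x + g x)" "L2_norm (\<lambda>x. f x + g x) \<le> L2_norm f + L2_norm g"
proof -
  note [measurable] = assms[THEN square_integrable_measurable]
  have i: "integrable lebesgue (\<lambda>x. (cmod (f x))\<^sup>2)" "integrable lebesgue (\<lambda>x. (cmod (g x))\<^sup>2)"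
    using assms by (auto simp: square_integrable_def)
  have i2: "integrable lebesgue (\<lambda>x. cmod (f x) * cmod (g x))"
    using integrable_norm[OF square_integrable_product(1)[OF assms]] by (simp add: norm_mult)
  let ?b = "\<lambda>x. (cmod (f x))\<^sup>2 + 2 * (cmod (f x) * cmod (g x)) + (cmod (g x))\<^sup>2"
  have ib: "integrable lebesgue ?b" using i i2 by auto
  have "(\<integral>\<^sup>+x. ennreal ((cmod (f x + g x))\<^sup>2) \<partial>lebesgue) \<le> (\<integral>\<^sup>+x. ennreal (?b x) \<partial>lebesgue)"
  proof (rule nn_integral_mono, rule ennreal_leI)
    fix x
    have "(cmod (f x + g x))\<^sup>2 \<le> (cmod (f x) + cmod (g x))\<^sup>2"
      by (rule power_mono[OF norm_triangle_ineq]) auto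
    then show "(cmod (f x + g x))\<^sup>2 \<le> ?b x" by (simp add: power2_sum)
  qed
  also have "\<dots> = ennreal (integral\<^sup>L lebesgue ?b)"
    by (rule nn_integral_eq_integral[OF ib]) auto
  also have "integral\<^sup>L lebesgue ?b = (L2_norm f)\<^sup>2 + 2 * (\<integral>x. cmod (f x) * cmod (g x) \<partial>lebesgue) + (L2_norm g)\<^sup>2"
    using i i2 by (simp add: L2_norm_sq)
  also have "ennreal \<dots> \<le> ennreal ((L2_norm f + L2_norm g)\<^sup>2)"
    using square_integrable_product(2)[OF assms] by (intro ennreal_leI) (simp add: power2_sum)
  finally show "square_integrable (\<lambda>x. f x + g x)" "L2_norm (\<lambda>x. f x + g x) \<le> L2_norm f + L2_norm g"
    using square_integrable_le[of "\<lambda>x. f x + g x" "L2_norm f + L2_norm g"] by auto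
qed

lemma square_integrable_diff:
  assumes "square_integrable f" "square_integrable g"
  shows "square_integrable (\<lambda>x. f x - g x)" "L2_norm (\<lambda>x. f x - g x) \<le> L2_norm f + L2_norm g"
  using square_integrable_add[OF assms(1) square_integrable_mult_left(1)[OF assms(2), of "-1"]]
    square_integrable_mult_left(2)[OF assms(2), of "-1"] by auto

lemma L2_norm_minus_commute: "L2_norm (\<lambda>x. f x - g x) = L2_norm (\<lambda>x. g x - f x)"
  unfolding L2_norm_def by (simp add: norm_minus_commute)

lemma L2_norm_triangle:
  assumes "square_integrable f" "square_integrable g" "square_integrable h"
  shows "L2_norm (\<lambda>x. f x - h x) \<le> L2_norm (\<lambda>x. f x - g x) + L2_norm (\<lambda>x. g x - h x)"
  using square_integrable_add(2)[OF square_integrable_diff(1)[OF assms(1,2)] square_integrable_diff(1)[OF assms(2,3)]]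
  by simp

lemma L2_norm_diff_ge:
  assumes "square_integrable f" "square_integrable g"
  shows "\<bar>L2_norm f - L2_norm g\<bar> \<le> L2_norm (\<lambda>x. f x - g x)"
  using square_integrable_add(2)[OF square_integrable_diff(1)[OF assms] assms(2)]
    square_integrable_add(2)[OF square_integrable_diff(1)[OF assms(2,1)] assms(1)]
    L2_norm_minus_commute[of f g]
  by auto

lemma L2_norm_zero_AE:
  assumes "square_integrable f" "L2_norm f = 0"
  shows "AE x in lebesgue. f x = 0"
proof -
  have "(\<integral>\<^sup>+x. ennreal ((cmod (f x))\<^sup>2) \<partial>lebesgue) = 0"
    using nn_integral_square[OF assms(1)] assms(2) by simp
  then have "AE x in lebesgue. ennreal ((cmod (f x))\<^sup>2) = 0"
    using square_integrable_measurable[OF assms(1)] by (subst (asm) nn_integral_0_iff_AE) auto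
  then show ?thesis by eventually_elim auto
qed

lemma L2_Fatou:
  assumes "\<And>n. square_integrable (f n)" "\<And>n. L2_norm (f n) \<le> C" "g \<in> borel_measurable lebesgue"
    "AE x in lebesgue. (\<lambda>n. f n x) \<longlonglongrightarrow> g x"
  shows "square_integrable g" "L2_norm g \<le> C"
proof -
  note [measurable] = assms(1)[THEN square_integrable_measurable]
  have C: "C \<ge> 0" using assms(2)[of 0] L2_norm_nonneg[of "f 0"] by linarith
  have "(\<integral>\<^sup>+x. ennreal ((cmod (g x))\<^sup>2) \<partial>lebesgue) = (\<integral>\<^sup>+x. liminf (\<lambda>n. ennreal ((cmod (f n x))\<^sup>2)) \<partial>lebesgue)"
  proof (rule nn_integral_cong_AE, use assms(4) in eventually_elim)
    fix x assume "(\<lambda>n. f n x) \<longlonglongrightarrow> g x"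
    then have "(\<lambda>n. ennreal ((cmod (f n x))\<^sup>2)) \<longlonglongrightarrow> ennreal ((cmod (g x))\<^sup>2)"
      by (intro tendsto_ennrealI tendsto_intros)
    then show "ennreal ((cmod (g x))\<^sup>2) = liminf (\<lambda>n. ennreal ((cmod (f n x))\<^sup>2))"
      by (intro lim_imp_Liminf[symmetric]) simp_all
  qed
  also have "\<dots> \<le> liminf (\<lambda>n. \<integral>\<^sup>+x. ennreal ((cmod (f n x))\<^sup>2) \<partial>lebesgue)"
    by (rule nn_integral_liminf) auto
  also have "\<dots> \<le> liminf (\<lambda>n. ennreal (C\<^sup>2))"
    using assms(2) L2_norm_nonneg
    by (intro Liminf_mono) (auto simp: nn_integral_square[OF assms(1)] intro!: always_eventually ennreal_leI power_mono)
  finally have "(\<integral>\<^sup>+x. ennreal ((cmod (g x))\<^sup>2) \<partial>lebesgue) \<le> ennreal (C\<^sup>2)"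
    by (simp add: Liminf_const)
  then show "square_integrable g" "L2_norm g \<le> C"
    using square_integrable_le[OF assms(3) _ C] by auto
qed

lemma L2_dominated_tendsto:
  fixes g :: "real^'n \<Rightarrow> complex"
  assumes "\<And>n. f n \<in> borel_measurable lebesgue" "square_integrable h" "g \<in> borel_measurable lebesgue"
    "\<And>n. AE x in lebesgue. cmod (f n x - g x) \<le> cmod (h x)"
    "AE x in lebesgue. (\<lambda>n. f n x) \<longlonglongrightarrow> g x"
  shows "(\<lambda>n. L2_norm (\<lambda>x. f n x - g x)) \<longlonglongrightarrow> 0"
proof -
  have "(\<lambda>n. integral\<^sup>L lebesgue (\<lambda>x. (cmod (f n x - g x))\<^sup>2)) \<longlonglongrightarrow> integral\<^sup>L lebesgue (\<lambda>x::real^'n. 0::real)"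
  proof (rule integral_dominated_convergence[where w="\<lambda>x. (cmod (h x))\<^sup>2" and M=lebesgue
       and s="\<lambda>n x. (cmod (f n x - g x))\<^sup>2" and f="\<lambda>x. 0"])
    show "integrable lebesgue (\<lambda>x. (cmod (h x))\<^sup>2)" using assms(2) by (simp add: square_integrable_def)
    show "AE x in lebesgue. (\<lambda>n. (cmod (f n x - g x))\<^sup>2) \<longlonglongrightarrow> 0"
    proof (use assms(5) in eventually_elim)
      fix x assume "(\<lambda>n. f n x) \<longlonglongrightarrow> g x"
      then have "(\<lambda>n. (cmod (f n x - g x))\<^sup>2) \<longlonglongrightarrow> (cmod (g x - g x))\<^sup>2" by (intro tendsto_intros)
      then show "(\<lambda>n. (cmod (f n x - g x))\<^sup>2) \<longlonglongrightarrow> 0" by simp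
    qed
    show "AE x in lebesgue. norm ((cmod (f n x - g x))\<^sup>2) \<le> (cmod (h x))\<^sup>2" for n
      using assms(4)[of n] by eventually_elim (auto intro!: power_mono)
  qed (use assms in auto)
  from tendsto_real_sqrt[OF this] show ?thesis unfolding L2_norm_def by simp
qed

text \<open>Riesz-Fischer for the seminorm \<open>L2_norm\<close>: a fast subsequence converges
  almost everywhere, and Fatou turns its pointwise limit into the limit of the whole
  sequence.\<close>

lemma L2_complete:
  assumes f: "\<And>n. square_integrable (f n)"
    and Cauchy: "\<And>e. e > 0 \<Longrightarrow> \<exists>N. \<forall>m\<ge>N. \<forall>n\<ge>N. L2_norm (\<lambda>x. f m x - f n x) < e"
  obtains g where "square_integrable g" "(\<lambda>n. L2_norm (\<lambda>x. f n x - g x)) \<longlonglongrightarrow> 0"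
proof -
  note [measurable] = f[THEN square_integrable_measurable]
  obtain N where N: "\<And>k m n. m \<ge> N k \<Longrightarrow> n \<ge> N k \<Longrightarrow> L2_norm (\<lambda>x. f m x - f n x) < (1/2)^k"
    using Cauchy[of "(1/2)^_"] by (metis zero_less_power half_gt_zero zero_less_one)
  \<comment> \<open>The maximum over all earlier thresholds makes the chosen indices
    monotone.\<close>
  define r where "r k = Max (N ` {..k})" for k
  have rN: "N k \<le> r k" for k unfolding r_def by (rule Max_ge) auto
  have rmono: "r k \<le> r l" if "k \<le> l" for k l unfolding r_def by (rule Max_mono) (use that in auto)
  define d where "d k x = f (r (Suc k)) x - f (r k) x" for k x
  have d[measurable]: "d k \<in> borel_measurable lebesgue" for k unfolding d_def by simp
  have dsq: "square_integrable (d k)" for k unfolding d_def by (intro square_integrable_diff f)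
  have dn: "L2_norm (d k) \<le> (1/2)^k" for k unfolding d_def
    using N[of k "r (Suc k)" "r k"] rN[of k] rmono[of k "Suc k"] by (meson le_SucI le_trans less_imp_le order_refl)
  \<comment> \<open>The weight 2^k is affordable because the squared norms of \<open>d k\<close> are
    at most 4^(-k). It is what later yields summability of the increments themselves rather than of
    their squares.\<close>
  have "(\<integral>\<^sup>+x. (\<Sum>k. ennreal (2^k * (cmod (d k x))\<^sup>2)) \<partial>lebesgue) = (\<Sum>k. \<integral>\<^sup>+x. ennreal (2^k * (cmod (d k x))\<^sup>2) \<partial>lebesgue)"
    by (rule nn_integral_suminf) measurable
  also have "\<dots> = (\<Sum>k. ennreal (2^k * (L2_norm (d k))\<^sup>2))"
    by (intro suminf_cong) (simp add: ennreal_mult nn_integral_cmult nn_integral_square[OF dsq])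
  also have "\<dots> \<le> (\<Sum>k. ennreal ((1/2)^k))"
  proof (rule suminf_le, rule ennreal_leI)
    fix k
    have "2^k * (L2_norm (d k))\<^sup>2 \<le> 2^k * ((1/2)^k)\<^sup>2"
      using dn[of k] by (intro mult_left_mono power_mono) auto
    also have "\<dots> = (1/2::real)^k"
      by (simp add: power2_eq_square flip: power_mult_distrib)
    finally show "2^k * (L2_norm (d k))\<^sup>2 \<le> (1/2)^k" .
  qed auto
  also have "\<dots> < \<infinity>" by (subst suminf_ennreal2) auto
  finally have "AE x in lebesgue. (\<Sum>k. ennreal (2^k * (cmod (d k x))\<^sup>2)) \<noteq> \<infinity>"
    by (intro nn_integral_PInf_AE) auto
  then have conv: "AE x in lebesgue. convergent (\<lambda>k. f (r k) x)"
  proof eventually_elim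
    fix x assume fin: "(\<Sum>k. ennreal (2^k * (cmod (d k x))\<^sup>2)) \<noteq> \<infinity>"
    have sm: "summable (\<lambda>k. 2^k * (cmod (d k x))\<^sup>2)"
      by (rule summable_suminf_not_top) (use fin in auto)
    have "summable (\<lambda>k. 2^k * (cmod (d k x))\<^sup>2 + (1/2)^k)"
      by (intro summable_add sm summable_geometric) auto
    then have "summable (\<lambda>k. d k x)"
    proof (rule summable_comparison_test')
      fix k
      \<comment> \<open>Arithmetic-geometric mean inequality with weight \<open>q\<close>, where
        \<open>q\<close> is the square root of 2^k.\<close>
      have "2 * cmod (d k x) \<le> 2^k * (cmod (d k x))\<^sup>2 + (1/2)^k"
      proof -
        define q where "q = sqrt ((2::real)^k)"
        have q: "q > 0" "q^2 = 2^k" by (auto simp: q_def)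
        have "0 \<le> (q * cmod (d k x) - 1/q)^2" by simp
        also have "\<dots> = q^2 * (cmod (d k x))^2 - 2 * cmod (d k x) + 1/q^2"
          using q(1) by (simp add: power2_diff power_mult_distrib power_divide)
        finally show ?thesis using q(2) by (simp add: power_one_over)
      qed
      then show "norm (d k x) \<le> 2^k * (cmod (d k x))\<^sup>2 + (1/2)^k"
        using norm_ge_zero[of "d k x"] by linarith
    qed
    then have "convergent (\<lambda>n. \<Sum>k<n. d k x)" by (simp add: summable_iff_convergent)
    moreover have "(\<Sum>k<n. d k x) = f (r n) x - f (r 0) x" for n
      by (induction n) (auto simp: d_def)
    ultimately have "convergent (\<lambda>n. f (r n) x - f (r 0) x)" by simp
    then show "convergent (\<lambda>k. f (r k) x)"
      using convergent_diff_const_right_iff[of "\<lambda>n. f (r n) x" "f (r 0) x"] by simp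
  qed
  define g where "g x = lim (\<lambda>k. f (r k) x)" for x
  have g[measurable]: "g \<in> borel_measurable lebesgue" unfolding g_def by measurable
  have lim: "AE x in lebesgue. (\<lambda>k. f (r k) x) \<longlonglongrightarrow> g x"
    using conv by eventually_elim (simp add: g_def convergent_LIMSEQ_iff)
  have fg: "square_integrable (\<lambda>x. f m x - g x) \<and> L2_norm (\<lambda>x. f m x - g x) \<le> (1/2)^k" if "m \<ge> N k" for m k
  proof -
    have "AE x in lebesgue. (\<lambda>n. f m x - f (r (n+k)) x) \<longlonglongrightarrow> f m x - g x"
      using lim by eventually_elim (intro tendsto_intros, rule LIMSEQ_ignore_initial_segment)
    moreover have "L2_norm (\<lambda>x. f m x - f (r (n+k)) x) \<le> (1/2)^k" for n
      using N[OF that, of "r (n+k)"] rN[of k] rmono[of k "n+k"] by (simp add: less_imp_le)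
    ultimately show ?thesis
      by (intro conjI L2_Fatou[of "\<lambda>n x. f m x - f (r (n+k)) x" "(1/2)^k" "\<lambda>x. f m x - g x"])
         (auto intro!: square_integrable_diff f)
  qed
  show thesis
  proof
    have "square_integrable (\<lambda>x. f (N 0) x - (f (N 0) x - g x))"
      by (intro square_integrable_diff(1)[OF f] conjunct1[OF fg[of 0]]) simp
    then show "square_integrable g" by simp
    show "(\<lambda>n. L2_norm (\<lambda>x. f n x - g x)) \<longlonglongrightarrow> 0"
    proof (rule LIMSEQ_I)
      fix e :: real assume "e > 0"
      then obtain k where "(1/2)^k < e" using real_arch_pow_inv[of e "1/2"] by auto
      then show "\<exists>no. \<forall>n\<ge>no. norm (L2_norm (\<lambda>x. f n x - g x) - 0) < e"
        using fg[of k] by (intro exI[of _ "N k"]) (auto intro: le_less_trans)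
    qed
  qed
qed

section \<open>Gaussian integrals and the Fourier integral\<close>

lemma borel_measurable_cis [measurable]: "cis \<in> borel_measurable borel"
  by (intro borel_measurable_continuous_onI continuous_intros)

lemma nn_integral_lborel_affine:
  fixes f :: "'a::euclidean_space \<Rightarrow> ennreal"
  assumes [measurable]: "f \<in> borel_measurable borel" and "c \<noteq> 0"
  shows "(\<integral>\<^sup>+x. f x \<partial>lborel) = ennreal (\<bar>c\<bar> ^ DIM('a)) * (\<integral>\<^sup>+x. f (t + c *\<^sub>R x) \<partial>lborel)"
  by (subst lborel_affine[OF assms(2), of t])
     (simp add: nn_integral_density nn_integral_distr nn_integral_cmult ennreal_power)

lemma integral_lborel_affine:
  fixes f :: "'a::euclidean_space \<Rightarrow> 'b::{banach, second_countable_topology}"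
  assumes [measurable]: "f \<in> borel_measurable borel" and "c \<noteq> 0"
  shows "(\<integral>x. f x \<partial>lborel) = (\<bar>c\<bar> ^ DIM('a)) *\<^sub>R (\<integral>x. f (t + c *\<^sub>R x) \<partial>lborel)"
  by (subst lborel_affine[OF assms(2), of t])
     (simp add: integral_density integral_distr ennreal_power)

lemma integrable_lborel_affine:
  fixes f :: "'a::euclidean_space \<Rightarrow> 'b::{banach, second_countable_topology}"
  assumes "integrable lborel f" "c \<noteq> 0"
  shows "integrable lborel (\<lambda>x. f (t + c *\<^sub>R x))"
proof -
  have [measurable]: "f \<in> borel_measurable borel" using assms(1) by auto
  have "(\<integral>\<^sup>+x. norm (f x) \<partial>lborel) = ennreal (\<bar>c\<bar> ^ DIM('a)) * (\<integral>\<^sup>+x. norm (f (t + c *\<^sub>R x)) \<partial>lborel)"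
    by (rule nn_integral_lborel_affine) (use assms(2) in auto)
  then show ?thesis
    using assms unfolding integrable_iff_bounded by (auto simp: ennreal_mult_less_top)
qed

lemma nn_integral_lborel_uminus:
  fixes f :: "'a::euclidean_space \<Rightarrow> ennreal"
  assumes "f \<in> borel_measurable borel"
  shows "(\<integral>\<^sup>+x. f (- x) \<partial>lborel) = (\<integral>\<^sup>+x. f x \<partial>lborel)"
  using nn_integral_lborel_affine[OF assms, of "-1" 0] by simp

lemma integral_lborel_uminus:
  fixes f :: "'a::euclidean_space \<Rightarrow> 'b::{banach, second_countable_topology}"
  assumes "f \<in> borel_measurable borel"
  shows "(\<integral>x. f (- x) \<partial>lborel) = (\<integral>x. f x \<partial>lborel)"
  using integral_lborel_affine[OF assms, of "-1" 0] by simp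

text \<open>\<open>lborel\<close> is the image of the product of one-dimensional Lebesgue measures
  under the coordinate map \<open>?T\<close>, so product integrands factor.\<close>

lemma integral_lborel_prod_Basis:
  fixes g :: "'a::euclidean_space \<Rightarrow> real \<Rightarrow> complex"
  assumes g: "\<And>b. b \<in> Basis \<Longrightarrow> integrable lborel (g b)"
  shows "integrable lborel (\<lambda>x::'a. \<Prod>b\<in>Basis. g b (x \<bullet> b))"
    and "(\<integral>x. (\<Prod>b\<in>Basis. g b ((x::'a) \<bullet> b)) \<partial>lborel) = (\<Prod>b\<in>Basis. integral\<^sup>L lborel (g b))"
proof -
  interpret product_sigma_finite "\<lambda>_::'a. lborel :: real measure" by standard
  have [measurable]: "(\<lambda>x::'a. g b (x \<bullet> b)) \<in> borel_measurable borel" if "b \<in> Basis" for b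
    using borel_measurable_integrable[OF g[OF that]] by measurable
  let ?T = "\<lambda>f::'a \<Rightarrow> real. \<Sum>b\<in>Basis. f b *\<^sub>R b"
  have T[measurable]: "?T \<in> (\<Pi>\<^sub>M b\<in>Basis. lborel) \<rightarrow>\<^sub>M borel" by measurable
  have m: "(\<lambda>x::'a. \<Prod>b\<in>Basis. g b (x \<bullet> b)) \<in> borel_measurable borel" by measurable
  have eq: "(\<Prod>b\<in>Basis. g b (?T f \<bullet> b)) = (\<Prod>b\<in>Basis. g b (f b))" for f
    by (intro prod.cong refl) (simp add: inner_sum_left inner_Basis if_distrib[of "\<lambda>x. _ * x"] cong: if_cong)
  show "integrable lborel (\<lambda>x::'a. \<Prod>b\<in>Basis. g b (x \<bullet> b))"
    by (subst lborel_eq, subst integrable_distr_eq[OF T m], unfold eq)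
       (rule product_integrable_prod[OF finite_Basis g])
  show "(\<integral>x. (\<Prod>b\<in>Basis. g b ((x::'a) \<bullet> b)) \<partial>lborel) = (\<Prod>b\<in>Basis. integral\<^sup>L lborel (g b))"
    by (subst lborel_eq, subst integral_distr[OF T m], unfold eq)
       (rule product_integral_prod[OF finite_Basis g])
qed

definition gauss :: "'a::euclidean_space \<Rightarrow> real" where
  "gauss x = exp (- (norm x)\<^sup>2 / 2)"

lemma gauss_pos [simp]: "0 < gauss x" and gauss_nonneg [simp]: "0 \<le> gauss x" and gauss_le_1 [simp]: "gauss x \<le> 1"
  and gauss_0 [simp]: "gauss 0 = 1"
  by (auto simp: gauss_def)

lemma gauss_measurable [measurable]: "gauss \<in> borel_measurable borel"
  unfolding gauss_def[abs_def] by measurable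

lemma gauss_prod: "gauss x = (\<Prod>b\<in>Basis. exp (- (x \<bullet> b)\<^sup>2 / 2))"
proof -
  have "(norm x)\<^sup>2 = (\<Sum>b\<in>Basis. (x \<bullet> b)\<^sup>2)"
    unfolding power2_norm_eq_inner by (subst euclidean_inner) (simp add: power2_eq_square)
  then show ?thesis
    by (simp add: gauss_def exp_sum[symmetric] sum_negf sum_divide_distrib)
qed

text \<open>Up to the factor sqrt(2 pi) this is the characteristic function of the standard normal
  distribution.\<close>

lemma gauss_fourier_real:
  fixes t :: real
  shows "integrable lborel (\<lambda>x. cis (t * x) * of_real (exp (- x\<^sup>2 / 2)))"
    and "(\<integral>x. cis (t * x) * of_real (exp (- x\<^sup>2 / 2)) \<partial>lborel) = of_real (sqrt (2 * pi) * exp (- t\<^sup>2 / 2))"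
proof -
  have e: "exp (- x\<^sup>2 / 2) = sqrt (2 * pi) * std_normal_density x" for x :: real
    by (simp add: std_normal_density_def)
  have i: "integrable lborel (\<lambda>x::real. exp (- x\<^sup>2 / 2))" unfolding e by (intro integrable_mult_right) auto
  show "integrable lborel (\<lambda>x. cis (t * x) * of_real (exp (- x\<^sup>2 / 2)))"
    by (rule Bochner_Integration.integrable_bound[OF i]) (auto simp: norm_mult)
  have "(\<integral>x. cis (t * x) * of_real (exp (- x\<^sup>2 / 2)) \<partial>lborel) =
      of_real (sqrt (2 * pi)) * (\<integral>x. std_normal_density x *\<^sub>R cis (t * x) \<partial>lborel)"
    unfolding e by (subst integral_mult_right_zero[symmetric])
       (simp add: scaleR_conv_of_real mult_ac)
  also have "(\<integral>x. std_normal_density x *\<^sub>R cis (t * x) \<partial>lborel) = char std_normal_distribution t"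
    unfolding char_def by (subst integral_density) (auto simp: cis_conv_exp)
  finally show "(\<integral>x. cis (t * x) * of_real (exp (- x\<^sup>2 / 2)) \<partial>lborel) = of_real (sqrt (2 * pi) * exp (- t\<^sup>2 / 2))"
    unfolding char_std_normal_distribution by simp
qed

text \<open>The number (2 pi)^(N/2), which is the integral of \<open>gauss\<close>. As
  \<open>FT\<close> carries no normalisation, this factor multiplies L2 norms in Plancherel's
  theorem, and its square appears in the inversion formula.\<close>

definition gauss_const :: "'a::euclidean_space itself \<Rightarrow> real" where
  "gauss_const _ = sqrt (2 * pi) ^ DIM('a)"

lemma gauss_const_pos [simp]: "0 < gauss_const TYPE('a::euclidean_space)"
  by (simp add: gauss_const_def)

lemma gauss_fourier:
  fixes x :: "'a::euclidean_space"
  shows "integrable lborel (\<lambda>\<xi>. cis (x \<bullet> \<xi>) * of_real (gauss \<xi>))"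
    and "(\<integral>\<xi>. cis (x \<bullet> \<xi>) * of_real (gauss \<xi>) \<partial>lborel) = of_real (gauss_const TYPE('a) * gauss x)"
proof -
  let ?g = "\<lambda>b y. cis ((x \<bullet> b) * y) * of_real (exp (- y\<^sup>2 / 2)) :: complex"
  have cis_sum: "cis (\<Sum>b\<in>B. h b) = (\<Prod>b\<in>B. cis (h b))" if "finite B" for h and B :: "'a set"
    using that by (induction B) (auto simp: cis_mult[symmetric])
  have e: "cis (x \<bullet> \<xi>) * of_real (gauss \<xi>) = (\<Prod>b\<in>Basis. ?g b (\<xi> \<bullet> b))" for \<xi>
    unfolding gauss_prod by (subst euclidean_inner) (simp add: cis_sum prod.distrib)
  show "integrable lborel (\<lambda>\<xi>. cis (x \<bullet> \<xi>) * of_real (gauss \<xi>))"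
    unfolding e by (rule integral_lborel_prod_Basis(1)) (rule gauss_fourier_real)
  show "(\<integral>\<xi>. cis (x \<bullet> \<xi>) * of_real (gauss \<xi>) \<partial>lborel) = of_real (gauss_const TYPE('a) * gauss x)"
    unfolding e by (subst integral_lborel_prod_Basis(2), rule gauss_fourier_real)
      (simp add: gauss_fourier_real[simplified] gauss_prod gauss_const_def prod.distrib)
qed

lemma gauss_integral:
  shows "integrable lborel (gauss :: 'a::euclidean_space \<Rightarrow> real)"
    and "(\<integral>x. gauss (x::'a) \<partial>lborel) = gauss_const TYPE('a)"
    and "(\<integral>\<^sup>+x. ennreal (gauss (x::'a)) \<partial>lborel) = ennreal (gauss_const TYPE('a))"
proof -
  have i: "integrable lborel (\<lambda>x::'a. complex_of_real (gauss x))" using gauss_fourier(1)[of "0::'a"] by simp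
  show i': "integrable lborel (gauss :: 'a \<Rightarrow> real)"
    using integrable_Re[OF i] by simp
  have "complex_of_real (\<integral>x. gauss (x::'a) \<partial>lborel) = of_real (gauss_const TYPE('a))"
    using gauss_fourier(2)[of "0::'a"] by simp
  then show e: "(\<integral>x. gauss (x::'a) \<partial>lborel) = gauss_const TYPE('a)" by (simp only: of_real_eq_iff)
  then show "(\<integral>\<^sup>+x. ennreal (gauss (x::'a)) \<partial>lborel) = ennreal (gauss_const TYPE('a))"
    by (subst nn_integral_eq_integral[OF i']) auto
qed

lemma gauss_scaled_fourier:
  fixes x :: "'a::euclidean_space"
  assumes "d > 0"
  shows "integrable lborel (\<lambda>\<xi>. cis (x \<bullet> \<xi>) * of_real (gauss (d *\<^sub>R \<xi>)))"
    and "(\<integral>\<xi>. cis (x \<bullet> \<xi>) * of_real (gauss (d *\<^sub>R \<xi>)) \<partial>lborel)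
      = of_real (gauss_const TYPE('a) / d ^ DIM('a) * gauss ((1/d) *\<^sub>R x))"
proof -
  have e: "cis (x \<bullet> \<xi>) * of_real (gauss (d *\<^sub>R \<xi>)) = cis (((1/d) *\<^sub>R x) \<bullet> (0 + d *\<^sub>R \<xi>)) * of_real (gauss (0 + d *\<^sub>R \<xi>))" for \<xi>
    using assms by simp
  show "integrable lborel (\<lambda>\<xi>. cis (x \<bullet> \<xi>) * of_real (gauss (d *\<^sub>R \<xi>)))"
    unfolding e by (rule integrable_lborel_affine[OF gauss_fourier(1)]) (use assms in auto)
  have "of_real (gauss_const TYPE('a) * gauss ((1/d) *\<^sub>R x)) = (\<integral>\<xi>. cis (((1/d) *\<^sub>R x) \<bullet> \<xi>) * of_real (gauss \<xi>) \<partial>lborel)"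
    by (simp only: gauss_fourier(2))
  also have "\<dots> = \<bar>d\<bar> ^ DIM('a) *\<^sub>R (\<integral>\<xi>. cis (x \<bullet> \<xi>) * of_real (gauss (d *\<^sub>R \<xi>)) \<partial>lborel)"
    unfolding e by (rule integral_lborel_affine) (use assms borel_measurable_integrable[OF gauss_fourier(1)] in auto)
  finally show "(\<integral>\<xi>. cis (x \<bullet> \<xi>) * of_real (gauss (d *\<^sub>R \<xi>)) \<partial>lborel)
      = of_real (gauss_const TYPE('a) / d ^ DIM('a) * gauss ((1/d) *\<^sub>R x))"
    using assms by (simp add: field_simps scaleR_conv_of_real)
qed

text \<open>The sign \<open>s\<close> is \<open>-1\<close> for the direct transform and \<open>1\<close> for the unnormalised inverse one.\<close>

definition FT :: "real \<Rightarrow> ('a::euclidean_space \<Rightarrow> complex) \<Rightarrow> 'a \<Rightarrow> complex" where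
  "FT s f \<xi> = (\<integral>x. cis (s * (x \<bullet> \<xi>)) * f x \<partial>lborel)"

lemma integrable_cis_mult:
  assumes "integrable M f" "h \<in> borel_measurable M"
  shows "integrable M (\<lambda>x. cis (h x) * f x)"
  by (rule Bochner_Integration.integrable_bound[OF assms(1)])
     (use assms borel_measurable_integrable[OF assms(1)] in \<open>auto simp: norm_mult\<close>)

lemma FT_integrable:
  "integrable lborel f \<Longrightarrow> integrable lborel (\<lambda>x. cis (s * (x \<bullet> \<xi>)) * f x)"
  by (rule integrable_cis_mult) auto

lemma FT_diff:
  assumes "integrable lborel f" "integrable lborel g"
  shows "FT s (\<lambda>x. f x - g x) \<xi> = FT s f \<xi> - FT s g \<xi>"
  unfolding FT_def using FT_integrable[OF assms(1)] FT_integrable[OF assms(2)]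
  by (simp add: right_diff_distrib)

lemma FT_bound:
  assumes "integrable lborel f"
  shows "cmod (FT s f \<xi>) \<le> (\<integral>x. cmod (f x) \<partial>lborel)"
proof -
  have "cmod (FT s f \<xi>) \<le> (\<integral>x. cmod (cis (s * (x \<bullet> \<xi>)) * f x) \<partial>lborel)"
    unfolding FT_def by (rule integral_norm_bound)
  then show ?thesis by (simp add: norm_mult)
qed

lemma FT_continuous:
  fixes f :: "'a::euclidean_space \<Rightarrow> complex"
  assumes "integrable lborel f"
  shows "continuous_on UNIV (FT s f)"
proof (rule continuous_on_sequentiallyI)
  fix X :: "nat \<Rightarrow> 'a" and a assume X: "X \<longlonglongrightarrow> a"
  have [measurable]: "f \<in> borel_measurable borel" using assms by auto
  show "(\<lambda>n. FT s f (X n)) \<longlonglongrightarrow> FT s f a"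
    unfolding FT_def
  proof (rule integral_dominated_convergence[where w="\<lambda>x. cmod (f x)"])
    show "AE x in lborel. (\<lambda>i. cis (s * (x \<bullet> X i)) * f x) \<longlonglongrightarrow> cis (s * (x \<bullet> a)) * f x"
    proof (rule AE_I2)
      fix x
      have "(\<lambda>i. s * (x \<bullet> X i)) \<longlonglongrightarrow> s * (x \<bullet> a)" by (intro tendsto_intros X)
      then have "(\<lambda>i. cis (s * (x \<bullet> X i))) \<longlonglongrightarrow> cis (s * (x \<bullet> a))"
        unfolding cis_conv_exp by (intro tendsto_intros X)
      then show "(\<lambda>i. cis (s * (x \<bullet> X i)) * f x) \<longlonglongrightarrow> cis (s * (x \<bullet> a)) * f x"
        by (intro tendsto_intros X)
    qed
  qed (use assms in \<open>auto simp: norm_mult\<close>)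
qed

lemma FT_measurable [measurable]:
  "integrable lborel f \<Longrightarrow> FT s f \<in> borel_measurable borel"
  by (intro borel_measurable_continuous_onI FT_continuous)

lemma FT_cnj: "cnj (FT s f \<xi>) = FT (- s) (\<lambda>x. cnj (f x)) \<xi>"
  unfolding FT_def by (simp add: cis_cnj flip: Bochner_Integration.integral_cnj)

text \<open>Fubini for a kernel that is symmetric in its two variables. Plancherel and inversion
  both rest on shifting a transform from one factor to the other in this way.\<close>

lemma FT_duality:
  assumes f: "integrable lborel f" and g: "integrable lborel g"
  shows "(\<integral>\<xi>. FT s f \<xi> * g \<xi> \<partial>lborel) = (\<integral>x. f x * FT s g x \<partial>lborel)"
proof -
  have [measurable]: "f \<in> borel_measurable borel" "g \<in> borel_measurable borel"
    using f g by auto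
  have "integrable (lborel \<Otimes>\<^sub>M lborel) (\<lambda>(x, \<xi>). f x * g \<xi>)"
    by (rule lborel_pair.Fubini_integrable)
       (use f g in \<open>auto simp: norm_mult\<close>)
  then have i: "integrable (lborel \<Otimes>\<^sub>M lborel) (\<lambda>(x, \<xi>). cis (s * (x \<bullet> \<xi>)) * (f x * g \<xi>))"
    unfolding split_beta by (rule integrable_cis_mult) measurable
  have "(\<integral>\<xi>. FT s f \<xi> * g \<xi> \<partial>lborel) = (\<integral>\<xi>. (\<integral>x. cis (s * (x \<bullet> \<xi>)) * (f x * g \<xi>) \<partial>lborel) \<partial>lborel)"
    unfolding FT_def by (simp flip: integral_mult_left_zero add: mult.assoc)
  also have "\<dots> = (\<integral>x. (\<integral>\<xi>. cis (s * (x \<bullet> \<xi>)) * (f x * g \<xi>) \<partial>lborel) \<partial>lborel)"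
    by (rule lborel_pair.Fubini_integral[OF i])
  also have "\<dots> = (\<integral>x. f x * FT s g x \<partial>lborel)"
    unfolding FT_def by (simp flip: integral_mult_right_zero add: mult.left_commute inner_commute)
  finally show ?thesis .
qed

lemma integrable_gauss_mult:
  fixes f :: "'a::euclidean_space \<Rightarrow> complex"
  assumes "f \<in> borel_measurable borel" "\<And>\<xi>. cmod (f \<xi>) \<le> C" "d \<noteq> 0"
  shows "integrable lborel (\<lambda>\<xi>. f \<xi> * of_real (gauss (d *\<^sub>R \<xi>)))"
proof (rule Bochner_Integration.integrable_bound)
  show "integrable lborel (\<lambda>\<xi>::'a. C * gauss (0 + d *\<^sub>R \<xi>))"
    by (intro integrable_mult_right integrable_lborel_affine gauss_integral assms)
  show "AE \<xi> in lborel. norm (f \<xi> * of_real (gauss (d *\<^sub>R \<xi>))) \<le> norm (C * gauss (0 + d *\<^sub>R \<xi>))"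
    using assms(2) by (auto simp: norm_mult intro!: mult_right_mono order_trans[OF _ abs_ge_self])
qed (use assms in auto)

lemma FT_gauss_modulated:
  fixes x y :: "'a::euclidean_space"
  assumes "s = 1 \<or> s = -1" "d > 0"
  shows "FT (- s) (\<lambda>\<xi>. cis (s * (x \<bullet> \<xi>)) * of_real (gauss (d *\<^sub>R \<xi>))) y
    = of_real (gauss_const TYPE('a) / d ^ DIM('a) * gauss ((1/d) *\<^sub>R (y - x)))"
proof -
  have "FT (- s) (\<lambda>\<xi>. cis (s * (x \<bullet> \<xi>)) * of_real (gauss (d *\<^sub>R \<xi>))) y =
     (\<integral>\<xi>. cis ((s *\<^sub>R (x - y)) \<bullet> \<xi>) * of_real (gauss (d *\<^sub>R \<xi>)) \<partial>lborel)"
    unfolding FT_def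
    by (simp add: cis_mult inner_commute algebra_simps flip: mult.assoc)
  also have "\<dots> = of_real (gauss_const TYPE('a) / d ^ DIM('a) * gauss ((1/d) *\<^sub>R (s *\<^sub>R (x - y))))"
    by (rule gauss_scaled_fourier(2)[OF assms(2)])
  also have "gauss ((1/d) *\<^sub>R (s *\<^sub>R (x - y))) = gauss ((1/d) *\<^sub>R (y - x))"
    using assms(1) by (auto simp: gauss_def norm_minus_commute)
  finally show ?thesis .
qed

text \<open>Gauss-Weierstrass summation: damping the transform by a Gaussian averages
  \<open>f\<close> against a Gaussian of width \<open>d\<close>. Duality moves the transform from
  \<open>f\<close> to the damped exponential, whose transform is explicit.\<close>

lemma FT_regularized_inversion:
  fixes x :: "'a::euclidean_space"
  assumes f: "integrable lborel f" and s: "s = 1 \<or> s = -1" and d: "d > 0"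
  shows "FT s (\<lambda>\<xi>. FT (- s) f \<xi> * of_real (gauss (d *\<^sub>R \<xi>))) x
    = of_real (gauss_const TYPE('a)) * (\<integral>z. f (x + d *\<^sub>R z) * of_real (gauss z) \<partial>lborel)"
proof -
  have [measurable]: "f \<in> borel_measurable borel" using f by auto
  have i: "integrable lborel (\<lambda>\<xi>. cis (s * (x \<bullet> \<xi>)) * of_real (gauss (d *\<^sub>R \<xi>)))"
    by (rule integrable_gauss_mult[where C=1]) (use d in auto)
  have "FT s (\<lambda>\<xi>. FT (- s) f \<xi> * of_real (gauss (d *\<^sub>R \<xi>))) x
     = (\<integral>\<xi>. FT (- s) f \<xi> * (cis (s * (x \<bullet> \<xi>)) * of_real (gauss (d *\<^sub>R \<xi>))) \<partial>lborel)"
    unfolding FT_def[of s] by (intro Bochner_Integration.integral_cong) (auto simp: inner_commute mult_ac)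
  also have "\<dots> = (\<integral>y. f y * of_real (gauss_const TYPE('a) / d ^ DIM('a) * gauss ((1/d) *\<^sub>R (y - x))) \<partial>lborel)"
    unfolding FT_duality[OF f i] FT_gauss_modulated[OF s d] ..
  \<comment> \<open>Substitution y = x + d z; its Jacobian cancels the power of \<open>d\<close> in
    the constant.\<close>
  also have "\<dots> = \<bar>d\<bar> ^ DIM('a) *\<^sub>R (\<integral>z. f (x + d *\<^sub>R z) * of_real (gauss_const TYPE('a) / d ^ DIM('a) * gauss ((1/d) *\<^sub>R (x + d *\<^sub>R z - x))) \<partial>lborel)"
    by (rule integral_lborel_affine) (use d in auto)
  also have "\<dots> = of_real (gauss_const TYPE('a)) * (\<integral>z. f (x + d *\<^sub>R z) * of_real (gauss z) \<partial>lborel)"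
  proof -
    have e: "f (x + d *\<^sub>R z) * of_real (gauss_const TYPE('a) / d ^ DIM('a) * gauss ((1/d) *\<^sub>R (x + d *\<^sub>R z - x)))
      = of_real (gauss_const TYPE('a) / d ^ DIM('a)) * (f (x + d *\<^sub>R z) * of_real (gauss z))" for z
      using d by simp
    show ?thesis
      unfolding e integral_mult_right_zero using d by (simp add: scaleR_conv_of_real)
  qed
  finally show ?thesis .
qed

section \<open>The Plancherel theorem\<close>

lemma borel_measurable_cnj_fun [measurable]: "cnj \<in> borel_measurable borel"
  by (intro borel_measurable_continuous_onI continuous_intros)

text \<open>The squared modulus is the transform of \<open>f\<close> times its conjugate, which is
  the opposite transform of the conjugate of \<open>f\<close>. Duality followed by regularised
  inversion removes all transforms from the right-hand side. Letting \<open>d\<close> tend to 0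
  gives Plancherel.\<close>

lemma FT_energy_identity:
  fixes f :: "'a::euclidean_space \<Rightarrow> complex"
  assumes f: "integrable lborel f" and s: "s = 1 \<or> s = -1" and d: "d > 0"
  shows "(\<integral>\<xi>. of_real ((cmod (FT s f \<xi>))\<^sup>2 * gauss (d *\<^sub>R \<xi>)) \<partial>lborel)
    = of_real (gauss_const TYPE('a)) * (\<integral>x. f x * (\<integral>z. cnj (f (x + d *\<^sub>R z)) * of_real (gauss z) \<partial>lborel) \<partial>lborel)"
proof -
  have [measurable]: "f \<in> borel_measurable borel" using f by auto
  have fc: "integrable lborel (\<lambda>x. cnj (f x))" using f by simp
  have i: "integrable lborel (\<lambda>\<xi>. FT (- s) (\<lambda>x. cnj (f x)) \<xi> * of_real (gauss (d *\<^sub>R \<xi>)))"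
    using FT_bound[OF fc] d FT_measurable[OF fc] by (intro integrable_gauss_mult) auto
  have "(\<integral>\<xi>. of_real ((cmod (FT s f \<xi>))\<^sup>2 * gauss (d *\<^sub>R \<xi>)) \<partial>lborel)
    = (\<integral>\<xi>. FT s f \<xi> * (FT (- s) (\<lambda>x. cnj (f x)) \<xi> * of_real (gauss (d *\<^sub>R \<xi>))) \<partial>lborel)"
    unfolding FT_cnj[symmetric] by (simp flip: complex_norm_square mult.assoc)
  also have "\<dots> = (\<integral>x. f x * FT s (\<lambda>\<xi>. FT (- s) (\<lambda>x. cnj (f x)) \<xi> * of_real (gauss (d *\<^sub>R \<xi>))) x \<partial>lborel)"
    by (rule FT_duality[OF f i])
  also have "\<dots> = (\<integral>x. of_real (gauss_const TYPE('a)) * (f x * (\<integral>z. cnj (f (x + d *\<^sub>R z)) * of_real (gauss z) \<partial>lborel)) \<partial>lborel)"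
    unfolding FT_regularized_inversion[OF fc s d] by (simp add: mult_ac)
  finally show ?thesis by (simp only: integral_mult_right_zero)
qed

lemma FT_gauss_energy_integrable:
  fixes f :: "'a::euclidean_space \<Rightarrow> complex"
  assumes f: "integrable lborel f" and d: "d > 0"
  shows "integrable lborel (\<lambda>\<xi>. (cmod (FT s f \<xi>))\<^sup>2 * gauss (d *\<^sub>R \<xi>))"
proof -
  note [measurable] = FT_measurable[OF f]
  have "integrable lborel (\<lambda>\<xi>. complex_of_real ((cmod (FT s f \<xi>))\<^sup>2) * of_real (gauss (d *\<^sub>R \<xi>)))"
    using d by (intro integrable_gauss_mult[where C="(\<integral>x. cmod (f x) \<partial>lborel)\<^sup>2"])
       (auto simp: norm_power intro!: power_mono FT_bound[OF f])
  from integrable_Re[OF this] show ?thesis by simp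
qed

text \<open>Integrability can be left out since the integral of a non-integrable function is 0 by
  convention.\<close>

lemma norm_integral_le_nn_integral:
  fixes f :: "'a \<Rightarrow> 'b::{banach, second_countable_topology}"
  shows "ennreal (norm (integral\<^sup>L M f)) \<le> (\<integral>\<^sup>+x. ennreal (norm (f x)) \<partial>M)"
  by (cases "integrable M f") (auto intro: integral_norm_bound_ennreal simp: not_integrable_integral_eq)

text \<open>In the energy identity the product of \<open>f x\<close> and
  \<open>f (x + d *\<^sub>R z)\<close> is bounded by half the sum of their squares. By translation
  invariance both squares integrate to the same value, so the bound is uniform in \<open>d\<close>.
  Nonnegative integrals are used throughout, so the right-hand side may be infinite.\<close>

lemma FT_gauss_energy_le:
  fixes f :: "'a::euclidean_space \<Rightarrow> complex"
  assumes f: "integrable lborel f" and s: "s = 1 \<or> s = -1" and d: "d > 0"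
  shows "(\<integral>\<^sup>+\<xi>. ennreal ((cmod (FT s f \<xi>))\<^sup>2 * gauss (d *\<^sub>R \<xi>)) \<partial>lborel)
    \<le> ennreal ((gauss_const TYPE('a))\<^sup>2) * (\<integral>\<^sup>+x. ennreal ((cmod (f x))\<^sup>2) \<partial>lborel)"
proof -
  let ?K = "gauss_const TYPE('a)"
  let ?N = "\<integral>\<^sup>+x. ennreal ((cmod (f x))\<^sup>2) \<partial>lborel"
  have [measurable]: "f \<in> borel_measurable borel" using f by auto
  define I where "I = (\<integral>\<xi>. (cmod (FT s f \<xi>))\<^sup>2 * gauss (d *\<^sub>R \<xi>) \<partial>lborel)"
  have tr: "(\<integral>\<^sup>+x. ennreal ((cmod (f (x + d *\<^sub>R z)))\<^sup>2) \<partial>lborel) = ?N" for z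
    using nn_integral_lborel_affine[of "\<lambda>x. ennreal ((cmod (f x))\<^sup>2)" 1 "d *\<^sub>R z"] by (simp add: add.commute)
  have "(\<integral>\<^sup>+\<xi>. ennreal ((cmod (FT s f \<xi>))\<^sup>2 * gauss (d *\<^sub>R \<xi>)) \<partial>lborel) = ennreal I"
    unfolding I_def by (rule nn_integral_eq_integral[OF FT_gauss_energy_integrable[OF f d]]) simp
  also have "I = cmod (of_real I)" unfolding I_def
    by (simp add: integral_nonneg_AE)
  also have "complex_of_real I = of_real ?K * (\<integral>x. f x * (\<integral>z. cnj (f (x + d *\<^sub>R z)) * of_real (gauss z) \<partial>lborel) \<partial>lborel)"
    unfolding I_def FT_energy_identity[OF f s d, symmetric] by (simp del: of_real_mult)
  also have "ennreal (cmod \<dots>) = ennreal ?K * ennreal (cmod (\<integral>x. f x * (\<integral>z. cnj (f (x + d *\<^sub>R z)) * of_real (gauss z) \<partial>lborel) \<partial>lborel))"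
    by (simp add: norm_mult ennreal_mult less_imp_le)
  also have "\<dots> \<le> ennreal ?K * (\<integral>\<^sup>+x. \<integral>\<^sup>+z. ennreal (((cmod (f x))\<^sup>2 + (cmod (f (x + d *\<^sub>R z)))\<^sup>2) / 2 * gauss z) \<partial>lborel \<partial>lborel)"
  proof (intro mult_left_mono order_trans[OF norm_integral_le_nn_integral] nn_integral_mono)
    fix x
    have "ennreal (norm (f x * (\<integral>z. cnj (f (x + d *\<^sub>R z)) * of_real (gauss z) \<partial>lborel)))
      = ennreal (norm (f x)) * ennreal (norm (\<integral>z. cnj (f (x + d *\<^sub>R z)) * of_real (gauss z) \<partial>lborel))"
      by (simp add: norm_mult ennreal_mult)
    also have "\<dots> \<le> ennreal (norm (f x)) * (\<integral>\<^sup>+z. ennreal (norm (cnj (f (x + d *\<^sub>R z)) * of_real (gauss z))) \<partial>lborel)"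
      by (intro mult_left_mono norm_integral_le_nn_integral) auto
    also have "\<dots> = (\<integral>\<^sup>+z. ennreal (norm (f x)) * ennreal (norm (cnj (f (x + d *\<^sub>R z)) * of_real (gauss z))) \<partial>lborel)"
      by (rule nn_integral_cmult[symmetric]) measurable
    also have "\<dots> \<le> (\<integral>\<^sup>+z. ennreal (((cmod (f x))\<^sup>2 + (cmod (f (x + d *\<^sub>R z)))\<^sup>2) / 2 * gauss z) \<partial>lborel)"
    proof (rule nn_integral_mono)
      fix z
      have "cmod (f x) * cmod (f (x + d *\<^sub>R z)) \<le> ((cmod (f x))\<^sup>2 + (cmod (f (x + d *\<^sub>R z)))\<^sup>2) / 2"
        using sum_squares_bound[of "cmod (f x)" "cmod (f (x + d *\<^sub>R z))"] by simp
      then show "ennreal (norm (f x)) * ennreal (norm (cnj (f (x + d *\<^sub>R z)) * of_real (gauss z)))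
         \<le> ennreal (((cmod (f x))\<^sup>2 + (cmod (f (x + d *\<^sub>R z)))\<^sup>2) / 2 * gauss z)"
        by (simp add: norm_mult mult.assoc[symmetric] mult_right_mono ennreal_leI flip: ennreal_mult)
    qed
    finally show "ennreal (norm (f x * (\<integral>z. cnj (f (x + d *\<^sub>R z)) * of_real (gauss z) \<partial>lborel)))
      \<le> (\<integral>\<^sup>+z. ennreal (((cmod (f x))\<^sup>2 + (cmod (f (x + d *\<^sub>R z)))\<^sup>2) / 2 * gauss z) \<partial>lborel)" .
  qed auto
  also have "(\<integral>\<^sup>+x. \<integral>\<^sup>+z. ennreal (((cmod (f x))\<^sup>2 + (cmod (f (x + d *\<^sub>R z)))\<^sup>2) / 2 * gauss z) \<partial>lborel \<partial>lborel)
    = (\<integral>\<^sup>+z. \<integral>\<^sup>+x. ennreal (((cmod (f x))\<^sup>2 + (cmod (f (x + d *\<^sub>R z)))\<^sup>2) / 2 * gauss z) \<partial>lborel \<partial>lborel)"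
    by (rule lborel_pair.Fubini') measurable
  also have "\<dots> = (\<integral>\<^sup>+z. ennreal (gauss z) * ?N \<partial>(lborel :: 'a measure))"
  proof (rule nn_integral_cong)
    fix z :: 'a
    have "(\<integral>\<^sup>+x. ennreal (((cmod (f x))\<^sup>2 + (cmod (f (x + d *\<^sub>R z)))\<^sup>2) / 2 * gauss z) \<partial>lborel)
      = (\<integral>\<^sup>+x. ennreal (gauss z / 2) * (ennreal ((cmod (f x))\<^sup>2) + ennreal ((cmod (f (x + d *\<^sub>R z)))\<^sup>2)) \<partial>lborel)"
      by (rule nn_integral_cong) (simp add: algebra_simps flip: ennreal_mult ennreal_plus)
    also have "\<dots> = ennreal (gauss z / 2) * (?N + ?N)"
      by (simp add: nn_integral_cmult nn_integral_add tr)
    also have "\<dots> = ennreal (gauss z) * ?N"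
      by (simp flip: mult_2 mult.assoc ennreal_numeral ennreal_mult)
    finally show "(\<integral>\<^sup>+x. ennreal (((cmod (f x))\<^sup>2 + (cmod (f (x + d *\<^sub>R z)))\<^sup>2) / 2 * gauss z) \<partial>lborel) = ennreal (gauss z) * ?N" .
  qed
  also have "\<dots> = ennreal ?K * ?N"
    by (simp add: nn_integral_multc gauss_integral(3))
  also have "ennreal ?K * (ennreal ?K * ?N) = ennreal (?K\<^sup>2) * ?N"
    by (simp add: power2_eq_square ennreal_mult less_imp_le mult.assoc)
  finally show ?thesis .
qed

text \<open>Fatou's lemma as the Gaussian damping is removed. This half of Plancherel comes first
  because it supplies the integrable majorant needed for the equality.\<close>

lemma FT_Bessel_inequality:
  fixes f :: "'a::euclidean_space \<Rightarrow> complex"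
  assumes f: "integrable lborel f" and s: "s = 1 \<or> s = -1"
  shows "(\<integral>\<^sup>+\<xi>. ennreal ((cmod (FT s f \<xi>))\<^sup>2) \<partial>lborel)
    \<le> ennreal ((gauss_const TYPE('a))\<^sup>2) * (\<integral>\<^sup>+x. ennreal ((cmod (f x))\<^sup>2) \<partial>lborel)" (is "_ \<le> ?R")
proof -
  note [measurable] = FT_measurable[OF f]
  let ?h = "\<lambda>n \<xi>. ennreal ((cmod (FT s f \<xi>))\<^sup>2 * gauss ((1 / real (Suc n)) *\<^sub>R \<xi>))"
  have "(\<lambda>n. ?h n \<xi>) \<longlonglongrightarrow> ennreal ((cmod (FT s f \<xi>))\<^sup>2)" for \<xi>
  proof -
    have "(\<lambda>n. (cmod (FT s f \<xi>))\<^sup>2 * exp (- (norm ((1 / real (Suc n)) *\<^sub>R \<xi>))\<^sup>2 / 2))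
      \<longlonglongrightarrow> (cmod (FT s f \<xi>))\<^sup>2 * exp (- (norm (0 *\<^sub>R \<xi>))\<^sup>2 / 2)"
      by (intro tendsto_intros LIMSEQ_Suc[OF lim_1_over_n]) auto
    then show ?thesis by (intro tendsto_ennrealI) (simp add: gauss_def)
  qed
  then have "ennreal ((cmod (FT s f \<xi>))\<^sup>2) = liminf (\<lambda>n. ?h n \<xi>)" for \<xi>
    by (intro lim_imp_Liminf[symmetric]) auto
  then have "(\<integral>\<^sup>+\<xi>. ennreal ((cmod (FT s f \<xi>))\<^sup>2) \<partial>lborel) = (\<integral>\<^sup>+\<xi>. liminf (\<lambda>n. ?h n \<xi>) \<partial>lborel)"
    by simp
  also have "\<dots> \<le> liminf (\<lambda>n. \<integral>\<^sup>+\<xi>. ?h n \<xi> \<partial>lborel)"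
    by (rule nn_integral_liminf) measurable
  also have "\<dots> \<le> liminf (\<lambda>n::nat. ?R)"
    by (intro Liminf_mono always_eventually allI FT_gauss_energy_le[OF f s]) auto
  also have "\<dots> = ?R" by (simp add: Liminf_const)
  finally show ?thesis .
qed

lemma borel_imp_lebesgue: "f \<in> borel_measurable borel \<Longrightarrow> f \<in> borel_measurable lebesgue"
  by (rule measurable_completion) simp

lemma square_integrable_borel_iff:
  assumes "f \<in> borel_measurable borel"
  shows "square_integrable f \<longleftrightarrow> integrable lborel (\<lambda>x. (cmod (f x))\<^sup>2)"
  unfolding square_integrable_def using assms by (simp add: borel_imp_lebesgue integrable_completion)

lemma L2_norm_sq_borel:
  assumes "f \<in> borel_measurable borel"
  shows "(L2_norm f)\<^sup>2 = (\<integral>x. (cmod (f x))\<^sup>2 \<partial>lborel)"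
  unfolding L2_norm_sq using assms by (simp add: integral_completion)

lemma FT_square_integrable:
  fixes f :: "real^'n \<Rightarrow> complex"
  assumes f: "integrable lborel f" "square_integrable f" and s: "s = 1 \<or> s = -1"
  shows "square_integrable (FT s f)" "L2_norm (FT s f) \<le> gauss_const TYPE(real^'n) * L2_norm f"
proof -
  note [measurable] = borel_imp_lebesgue[OF FT_measurable[OF f(1)]]
  have "(\<integral>\<^sup>+\<xi>. ennreal ((cmod (FT s f \<xi>))\<^sup>2) \<partial>lebesgue) \<le> ennreal ((gauss_const TYPE(real^'n) * L2_norm f)\<^sup>2)"
    using FT_Bessel_inequality[OF f(1) s] nn_integral_square[OF f(2)]
    by (simp add: nn_integral_completion power_mult_distrib ennreal_mult)
  then show "square_integrable (FT s f)" "L2_norm (FT s f) \<le> gauss_const TYPE(real^'n) * L2_norm f"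
    using square_integrable_le[of "FT s f" "gauss_const TYPE(real^'n) * L2_norm f"]
    by (auto simp: less_imp_le)
qed

lemma continuous_compact_support_integrable:
  fixes f :: "real^'n \<Rightarrow> complex"
  assumes "continuous_on UNIV f" "\<And>x. cmod (f x) \<le> M" "\<forall>x. norm x > R \<longrightarrow> f x = 0"
  shows "integrable lborel f" "square_integrable f"
proof -
  have m: "f \<in> borel_measurable borel" by (rule borel_measurable_continuous_onI[OF assms(1)])
  have i: "integrable lborel (\<lambda>x::real^'n. indicator (cball 0 R) x :: real)"
    using emeasure_lborel_cball_finite by (intro integrable_real_indicator) auto
  have M: "M \<ge> 0" using assms(2)[of 0] norm_ge_zero[of "f 0"] by linarith
  show "integrable lborel f"
    by (rule Bochner_Integration.integrable_bound[OF integrable_mult_right[OF i, of M]])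
       (use m assms(2,3) M in \<open>auto simp: indicator_def\<close>)
  have "integrable lborel (\<lambda>x. (cmod (f x))\<^sup>2)"
  proof (rule Bochner_Integration.integrable_bound[OF integrable_mult_right[OF i, of "M\<^sup>2"]])
    show "AE x in lborel. norm ((cmod (f x))\<^sup>2) \<le> norm (M\<^sup>2 * indicator (cball 0 R) x)"
      using assms(2,3) M by (auto simp: indicator_def intro!: power_mono)
  qed (use m in auto)
  then show "square_integrable f" by (simp add: square_integrable_borel_iff[OF m])
qed

text \<open>Both sides of the energy identity converge as \<open>d\<close> tends to 0: the left one
  is dominated by the undamped square, integrable by the Bessel inequality, and on the right
  continuity of \<open>f\<close> turns the Gaussian average into the value at the point.\<close>

lemma Plancherel_continuous:
  fixes f :: "real^'n \<Rightarrow> complex"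
  assumes c: "continuous_on UNIV f" and M: "\<And>x. cmod (f x) \<le> M" and R: "\<forall>x. norm x > R \<longrightarrow> f x = 0"
    and s: "s = 1 \<or> s = -1"
  shows "L2_norm (FT s f) = gauss_const TYPE(real^'n) * L2_norm f"
proof -
  let ?K = "gauss_const TYPE(real^'n)"
  note int = continuous_compact_support_integrable[OF c M R]
  note sq = FT_square_integrable(1)[OF int s]
  have [measurable]: "f \<in> borel_measurable borel" "FT s f \<in> borel_measurable borel" using int(1) by auto
  define d where "d n = 1 / real (Suc n)" for n
  have d: "d n > 0" for n by (simp add: d_def)
  have d0: "d \<longlonglongrightarrow> 0" unfolding d_def using LIMSEQ_Suc[OF lim_1_over_n] .
  have i2: "integrable lborel (\<lambda>\<xi>. (cmod (FT s f \<xi>))\<^sup>2)"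
    using sq by (simp add: square_integrable_borel_iff)
  have "(\<lambda>n. (\<integral>\<xi>. of_real ((cmod (FT s f \<xi>))\<^sup>2 * gauss (d n *\<^sub>R \<xi>)) \<partial>lborel))
    \<longlonglongrightarrow> (\<integral>\<xi>. complex_of_real ((cmod (FT s f \<xi>))\<^sup>2) \<partial>lborel)"
  proof (rule integral_dominated_convergence[where w="\<lambda>\<xi>. (cmod (FT s f \<xi>))\<^sup>2"])
    show "AE \<xi> in lborel. (\<lambda>n. complex_of_real ((cmod (FT s f \<xi>))\<^sup>2 * gauss (d n *\<^sub>R \<xi>))) \<longlonglongrightarrow> complex_of_real ((cmod (FT s f \<xi>))\<^sup>2)"
    proof (rule AE_I2)
      fix \<xi>
      have "(\<lambda>n. complex_of_real ((cmod (FT s f \<xi>))\<^sup>2 * exp (- (norm (d n *\<^sub>R \<xi>))\<^sup>2 / 2)))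
        \<longlonglongrightarrow> complex_of_real ((cmod (FT s f \<xi>))\<^sup>2 * exp (- (norm (0 *\<^sub>R \<xi>))\<^sup>2 / 2))"
        by (intro tendsto_intros d0) auto
      then show "(\<lambda>n. complex_of_real ((cmod (FT s f \<xi>))\<^sup>2 * gauss (d n *\<^sub>R \<xi>))) \<longlonglongrightarrow> complex_of_real ((cmod (FT s f \<xi>))\<^sup>2)"
        by (simp add: gauss_def)
    qed
    show "AE \<xi> in lborel. norm (complex_of_real ((cmod (FT s f \<xi>))\<^sup>2 * gauss (d n *\<^sub>R \<xi>))) \<le> (cmod (FT s f \<xi>))\<^sup>2" for n
      by (auto simp: norm_mult norm_power intro!: mult_left_le)
  qed (use i2 in auto)
  then have lim1: "(\<lambda>n. (\<integral>\<xi>. of_real ((cmod (FT s f \<xi>))\<^sup>2 * gauss (d n *\<^sub>R \<xi>)) \<partial>lborel))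
    \<longlonglongrightarrow> complex_of_real ((L2_norm (FT s f))\<^sup>2)"
    by (simp only: integral_complex_of_real L2_norm_sq_borel[OF \<open>FT s f \<in> borel_measurable borel\<close>])
  have gi: "integrable lborel (\<lambda>z. complex_of_real (gauss (z::real^'n)))"
    by (simp add: gauss_integral)
  have inner: "(\<lambda>n. \<integral>z. cnj (f (x + d n *\<^sub>R z)) * of_real (gauss z) \<partial>lborel) \<longlonglongrightarrow> cnj (f x) * of_real ?K" for x
  proof -
    have "(\<lambda>n. \<integral>z. cnj (f (x + d n *\<^sub>R z)) * of_real (gauss z) \<partial>lborel) \<longlonglongrightarrow> (\<integral>z. cnj (f x) * of_real (gauss (z::real^'n)) \<partial>lborel)"
    proof (rule integral_dominated_convergence[where w="\<lambda>z. M * gauss z"])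
      show "AE z in lborel. (\<lambda>n. cnj (f (x + d n *\<^sub>R z)) * complex_of_real (gauss z)) \<longlonglongrightarrow> cnj (f x) * complex_of_real (gauss z)"
      proof (rule AE_I2)
        fix z
        have "(\<lambda>n. x + d n *\<^sub>R z) \<longlonglongrightarrow> x + 0 *\<^sub>R z" by (intro tendsto_intros d0)
        then have "(\<lambda>n. f (x + d n *\<^sub>R z)) \<longlonglongrightarrow> f (x + 0 *\<^sub>R z)"
          by (intro continuous_on_tendsto_compose[OF c]) auto
        then show "(\<lambda>n. cnj (f (x + d n *\<^sub>R z)) * complex_of_real (gauss z)) \<longlonglongrightarrow> cnj (f x) * complex_of_real (gauss z)"
          by (intro tendsto_mult tendsto_cnj) auto
      qed
      show "AE z in lborel. norm (cnj (f (x + d n *\<^sub>R z)) * complex_of_real (gauss z)) \<le> M * gauss z" for n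
        by (auto simp: norm_mult intro!: mult_right_mono M)
      show "integrable lborel (\<lambda>z::real^'n. M * gauss z)" by (intro integrable_mult_right gauss_integral)
    qed measurable
    then show ?thesis by (simp add: gauss_integral)
  qed
  have inner_bd: "cmod (\<integral>z. cnj (f (x + d n *\<^sub>R z)) * of_real (gauss z) \<partial>lborel) \<le> M * ?K" for x n
  proof -
    have "cmod (\<integral>z. cnj (f (x + d n *\<^sub>R z)) * of_real (gauss z) \<partial>lborel) \<le> (\<integral>z. M * gauss (z::real^'n) \<partial>lborel)"
    proof (rule Bochner_Integration.integral_norm_bound_integral)
      have le: "cmod (cnj (f (x + d n *\<^sub>R z)) * of_real (gauss z)) \<le> M * gauss z" for z
        by (auto simp: norm_mult intro!: mult_right_mono M)
      then show "norm (cnj (f (x + d n *\<^sub>R z)) * complex_of_real (gauss z)) \<le> M * gauss z" for z .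
      show ig: "integrable lborel (\<lambda>z::real^'n. M * gauss z)" by (intro integrable_mult_right gauss_integral)
      show "integrable lborel (\<lambda>z. cnj (f (x + d n *\<^sub>R z)) * complex_of_real (gauss z))"
        by (rule Bochner_Integration.integrable_bound[OF ig])
           (use le in \<open>auto intro: order_trans[OF _ abs_ge_self]\<close>)
    qed
    then show ?thesis by (simp add: gauss_integral)
  qed
  have m2: "(\<lambda>x. \<integral>z. cnj (f (x + d n *\<^sub>R z)) * of_real (gauss z) \<partial>lborel) \<in> borel_measurable borel" for n
    by measurable
  have "(\<lambda>n. (\<integral>x. f x * (\<integral>z. cnj (f (x + d n *\<^sub>R z)) * of_real (gauss z) \<partial>lborel) \<partial>lborel))
     \<longlonglongrightarrow> (\<integral>x. f x * (cnj (f x) * of_real ?K) \<partial>lborel)"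
  proof (rule integral_dominated_convergence[where w="\<lambda>x. cmod (f x) * (M * ?K)"])
    show "integrable lborel (\<lambda>x. cmod (f x) * (M * ?K))" using int(1) by simp
  qed (use m2 in \<open>auto simp: norm_mult intro!: mult_left_mono inner_bd tendsto_mult inner\<close>)
  also have "(\<integral>x. f x * (cnj (f x) * of_real ?K) \<partial>lborel) = of_real (?K * (L2_norm f)\<^sup>2)"
  proof -
    have "f x * (cnj (f x) * of_real ?K) = complex_of_real (?K * (cmod (f x))\<^sup>2)" for x
      by (simp only: of_real_mult complex_norm_square) simp
    then show ?thesis by (simp only: integral_complex_of_real L2_norm_sq_borel[OF \<open>f \<in> borel_measurable borel\<close>]) simp
  qed
  finally have "(\<lambda>n. of_real ?K * (\<integral>x. f x * (\<integral>z. cnj (f (x + d n *\<^sub>R z)) * of_real (gauss z) \<partial>lborel) \<partial>lborel))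
     \<longlonglongrightarrow> of_real ?K * complex_of_real (?K * (L2_norm f)\<^sup>2)"
    by (intro tendsto_intros)
  then have "complex_of_real ((L2_norm (FT s f))\<^sup>2) = of_real ?K * complex_of_real (?K * (L2_norm f)\<^sup>2)"
    using lim1 unfolding FT_energy_identity[OF int(1) s d] by (rule LIMSEQ_unique[rotated])
  also have "\<dots> = complex_of_real ((?K * L2_norm f)\<^sup>2)"
    by (simp add: power2_eq_square)
  finally have "(L2_norm (FT s f))\<^sup>2 = (?K * L2_norm f)\<^sup>2" by (simp only: of_real_eq_iff)
  then show ?thesis by (simp add: power2_eq_iff_nonneg less_imp_le)
qed

section \<open>Density of continuous compactly supported functions in L2\<close>

definition clip :: "real \<Rightarrow> complex \<Rightarrow> complex" where
  "clip M z = (M / max M (cmod z)) *\<^sub>R z"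

lemma clip_bounds:
  assumes "M > 0"
  shows "cmod (clip M z) \<le> M" "cmod (clip M z) \<le> cmod z" "cmod z \<le> M \<Longrightarrow> clip M z = z"
  using assms by (auto simp: clip_def field_simps max_def abs_if)

lemma continuous_clip [continuous_intros]:
  "M > 0 \<Longrightarrow> continuous_on S f \<Longrightarrow> continuous_on S (\<lambda>x. clip M (f x))"
  unfolding clip_def by (intro continuous_intros) (auto simp: max_def)

text \<open>A piecewise linear cutoff in place of an indicator function, so that truncated
  continuous functions stay continuous.\<close>

definition ramp :: "real \<Rightarrow> 'a::real_normed_vector \<Rightarrow> real" where
  "ramp M x = max 0 (min 1 (M + 1 - norm x))"

lemma ramp_bounds: "0 \<le> ramp M x" "ramp M x \<le> 1" "norm x \<le> M \<Longrightarrow> ramp M x = 1" "norm x > M + 1 \<Longrightarrow> ramp M x = 0"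
  by (auto simp: ramp_def)

lemma continuous_ramp: "continuous_on S (ramp M)"
  unfolding ramp_def[abs_def] by (intro continuous_intros)

text \<open>Two approximations: \<open>f\<close> is first cut off in size and support, and then
  replaced by continuous functions converging to it almost everywhere, subjected to the same
  continuous cutoffs. The cutoffs provide the majorant for dominated convergence in the second
  step.\<close>

lemma square_integrable_approx:
  fixes f :: "real^'n \<Rightarrow> complex"
  assumes f: "square_integrable f" and e: "e > 0"
  obtains g M R where "continuous_on UNIV g" "\<And>x. cmod (g x) \<le> M" "\<forall>x. norm x > R \<longrightarrow> g x = 0"
    "L2_norm (\<lambda>x. g x - f x) < e"
proof -
  have fm[measurable]: "f \<in> borel_measurable lebesgue" using f by (rule square_integrable_measurable)
  have rm[measurable]: "ramp M \<in> borel_measurable lebesgue" for M :: real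
    by (intro borel_imp_lebesgue borel_measurable_continuous_onI continuous_ramp)
  have cm: "clip M \<in> borel_measurable borel" if "M > 0" for M
    by (intro borel_measurable_continuous_onI continuous_clip that continuous_on_id)
  define h where "h n x = of_real (ramp (Suc n) x) * clip (Suc n) (f x)" for n x
  have hm[measurable]: "h n \<in> borel_measurable lebesgue" for n
    unfolding h_def using measurable_compose[OF fm cm[of "Suc n"]] by measurable
  have hb: "cmod (h n x) \<le> cmod (f x)" for n x
  proof -
    have "cmod (h n x) \<le> 1 * cmod (f x)"
      unfolding h_def norm_mult using ramp_bounds[where M="Suc n" and x=x] clip_bounds[of "Suc n" "f x"]
      by (intro mult_mono) auto
    then show ?thesis by simp
  qed
  have "(\<lambda>n. L2_norm (\<lambda>x. h n x - f x)) \<longlonglongrightarrow> 0"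
  proof (rule L2_dominated_tendsto[where h="\<lambda>x. 2 * f x"])
    show "square_integrable (\<lambda>x. 2 * f x)" by (rule square_integrable_mult_left[OF f])
    show "AE x in lebesgue. cmod (h n x - f x) \<le> cmod (2 * f x)" for n
      using hb by (intro AE_I2) (metis norm_triangle_ineq4 add_right_mono norm_mult norm_numeral mult_2 order_trans)
    show "AE x in lebesgue. (\<lambda>n. h n x) \<longlonglongrightarrow> f x"
    proof (rule AE_I2, rule tendsto_eventually)
      fix x
      have "eventually (\<lambda>n. norm x \<le> real n) sequentially" "eventually (\<lambda>n. cmod (f x) \<le> real n) sequentially"
        by real_asymp+
      then show "eventually (\<lambda>n. h n x = f x) sequentially"
        by eventually_elim (simp add: h_def ramp_bounds clip_bounds)
    qed
  qed auto
  then obtain n where n: "L2_norm (\<lambda>x. h n x - f x) < e / 2"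
    using e LIMSEQ_D[of "\<lambda>n. L2_norm (\<lambda>x. h n x - f x)" 0 "e / 2"] by auto
  \<comment> \<open>A Lebesgue measurable function is an almost everywhere limit of continuous
    functions; nothing is known about their size or support.\<close>
  obtain N g where N: "negligible N" and gc: "\<And>k. continuous_on UNIV (g k)" and gl: "\<And>x. x \<notin> N \<Longrightarrow> (\<lambda>k. g k x) \<longlonglongrightarrow> f x"
    using lebesgue_measurable_imp_measurable_on[OF fm, of UNIV] unfolding measurable_on_def by auto
  define q where "q k x = of_real (ramp (Suc n) x) * clip (Suc n) (g k x)" for k x
  have qc: "continuous_on UNIV (q k)" for k
    unfolding q_def by (intro continuous_intros continuous_ramp gc) auto
  have qb': "cmod (q k x) \<le> Suc n * ramp (Suc n) x" for k x
    unfolding q_def norm_mult using ramp_bounds[where M="Suc n" and x=x] clip_bounds[of "Suc n" "g k x"]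
    by (auto simp: mult.commute[of "real (Suc n)"] simp del: of_nat_Suc intro!: mult_left_mono)
  have qb: "cmod (q k x) \<le> Suc n" for k x
    by (rule order_trans[OF qb' mult_left_le]) (simp_all add: ramp_bounds)
  have hb': "cmod (h n x) \<le> Suc n * ramp (Suc n) x" for x
    unfolding h_def norm_mult using ramp_bounds[where M="Suc n" and x=x] clip_bounds[of "Suc n" "f x"]
    by (auto simp: mult.commute[of "real (Suc n)"] simp del: of_nat_Suc intro!: mult_left_mono)
  have q0: "\<forall>x. norm x > real (Suc n) + 1 \<longrightarrow> q k x = 0" for k
    by (simp add: q_def ramp_bounds)
  note qi = continuous_compact_support_integrable[OF qc qb q0]
  have rs: "square_integrable (\<lambda>x::real^'n. complex_of_real (2 * Suc n * ramp (Suc n) x))"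
  proof (rule continuous_compact_support_integrable(2)[where M="2 * Suc n" and R="Suc n + 1"])
    show "cmod (complex_of_real (2 * Suc n * ramp (Suc n) x)) \<le> 2 * Suc n" for x :: "real^'n"
      using ramp_bounds[where M="Suc n" and x=x] mult_left_mono[OF ramp_bounds(2)[where M="Suc n" and x=x], of "2 * Suc n"]
      unfolding norm_of_real by (subst abs_of_nonneg) auto
  qed (auto intro!: continuous_intros continuous_ramp simp: ramp_bounds)
  have "(\<lambda>k. L2_norm (\<lambda>x. q k x - h n x)) \<longlonglongrightarrow> 0"
  proof (rule L2_dominated_tendsto[OF _ rs])
    show "q k \<in> borel_measurable lebesgue" for k
      by (intro borel_imp_lebesgue borel_measurable_continuous_onI qc)
    show "AE x in lebesgue. cmod (q k x - h n x) \<le> cmod (complex_of_real (2 * Suc n * ramp (Suc n) x))" for k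
    proof (rule AE_I2)
      fix x
      have "cmod (q k x - h n x) \<le> Suc n * ramp (Suc n) x + Suc n * ramp (Suc n) x"
        by (intro order_trans[OF norm_triangle_ineq4] add_mono qb' hb')
      also have "\<dots> \<le> cmod (complex_of_real (2 * Suc n * ramp (Suc n) x))"
        unfolding norm_of_real by (intro order_trans[OF _ abs_ge_self]) (simp add: algebra_simps)
      finally show "cmod (q k x - h n x) \<le> cmod (complex_of_real (2 * Suc n * ramp (Suc n) x))" .
    qed
    have "AE x in lebesgue. x \<notin> N"
      using N by (intro AE_not_in) (simp add: negligible_iff_null_sets)
    then show "AE x in lebesgue. (\<lambda>k. q k x) \<longlonglongrightarrow> h n x"
    proof eventually_elim
      fix x assume "x \<notin> N"
      have "continuous_on UNIV (clip (Suc n))" by (intro continuous_clip continuous_on_id) simp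
      then have "(\<lambda>k. clip (Suc n) (g k x)) \<longlonglongrightarrow> clip (Suc n) (f x)"
        by (rule continuous_on_tendsto_compose) (use gl[OF \<open>x \<notin> N\<close>] in auto)
      then show "(\<lambda>k. q k x) \<longlonglongrightarrow> h n x"
        unfolding q_def h_def by (intro tendsto_intros)
    qed
  qed auto
  then obtain k where k: "L2_norm (\<lambda>x. q k x - h n x) < e / 2"
    using e LIMSEQ_D[of "\<lambda>k. L2_norm (\<lambda>x. q k x - h n x)" 0 "e / 2"] by auto
  have "square_integrable (h n)"
    by (rule square_integrable_dominated(1)[OF _ f, of _ 1]) (use hb in auto)
  then have "L2_norm (\<lambda>x. q k x - f x) < e"
    using L2_norm_triangle[OF qi(2)[of k] _ f, of "h n"] n k by linarith
  then show thesis using that[OF qc qb q0] by blast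
qed

text \<open>The equality passes from the dense class because both sides are continuous in the L2
  norm, the left one by the Bessel inequality.\<close>

theorem Plancherel:
  fixes f :: "real^'n \<Rightarrow> complex"
  assumes f: "integrable lborel f" "square_integrable f" and s: "s = 1 \<or> s = -1"
  shows "L2_norm (FT s f) = gauss_const TYPE(real^'n) * L2_norm f"
proof (rule ccontr)
  let ?K = "gauss_const TYPE(real^'n)"
  assume "L2_norm (FT s f) \<noteq> ?K * L2_norm f"
  then have e: "\<bar>L2_norm (FT s f) - ?K * L2_norm f\<bar> > 0" by simp
  \<comment> \<open>Replacing \<open>f\<close> by an approximation moves each side by at most
    \<open>?K\<close> times the error, so the two together cannot close a gap of
    \<open>2 * ?K * e\<close>.\<close>
  define e where "e = \<bar>L2_norm (FT s f) - ?K * L2_norm f\<bar> / (2 * ?K)"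
  have "e > 0" using e unfolding e_def by (intro divide_pos_pos) auto
  from square_integrable_approx[OF f(2) this]
  obtain g M R where g: "continuous_on UNIV g" "\<And>x. cmod (g x) \<le> M" "\<forall>x. norm x > R \<longrightarrow> g x = 0"
    "L2_norm (\<lambda>x. g x - f x) < e" by blast
  note gi = continuous_compact_support_integrable[OF g(1-3)]
  have "FT s (\<lambda>x. g x - f x) = (\<lambda>\<xi>. FT s g \<xi> - FT s f \<xi>)"
    by (intro ext FT_diff gi f)
  then have "L2_norm (\<lambda>\<xi>. FT s g \<xi> - FT s f \<xi>) \<le> ?K * L2_norm (\<lambda>x. g x - f x)"
    using FT_square_integrable(2)[of "\<lambda>x. g x - f x", OF _ square_integrable_diff(1)[OF gi(2) f(2)] s] gi f by simp
  then have a: "\<bar>L2_norm (FT s g) - L2_norm (FT s f)\<bar> \<le> ?K * L2_norm (\<lambda>x. g x - f x)"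
    using L2_norm_diff_ge[OF FT_square_integrable(1)[OF gi s] FT_square_integrable(1)[OF f s]] by linarith
  have b: "\<bar>?K * L2_norm g - ?K * L2_norm f\<bar> \<le> ?K * L2_norm (\<lambda>x. g x - f x)"
    using L2_norm_diff_ge[OF gi(2) f(2)] by (simp flip: right_diff_distrib add: abs_mult less_imp_le)
  have "\<bar>L2_norm (FT s f) - ?K * L2_norm f\<bar> \<le> 2 * ?K * L2_norm (\<lambda>x. g x - f x)"
    using a b Plancherel_continuous[OF g(1-3) s] by linarith
  also have "\<dots> < 2 * ?K * e" using g(4) by simp
  also have "\<dots> = \<bar>L2_norm (FT s f) - ?K * L2_norm f\<bar>"
    unfolding e_def using less_imp_neq[OF gauss_const_pos[where 'a="real^'n"]] by simp
  finally show False by simp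
qed

section \<open>The Fourier--Plancherel transform\<close>

text \<open>The free scalar \<open>c\<close> makes polarisation possible: varying it recovers the
  full complex inner product from norms.\<close>

lemma L2_norm_add_sq:
  fixes a b :: "real^'n \<Rightarrow> complex"
  assumes "square_integrable a" "square_integrable b"
  shows "(L2_norm (\<lambda>x. a x + c * b x))\<^sup>2
    = (L2_norm a)\<^sup>2 + (cmod c)\<^sup>2 * (L2_norm b)\<^sup>2 + 2 * Re (c * (\<integral>x. cnj (a x) * b x \<partial>lebesgue))"
proof -
  note [measurable] = assms[THEN square_integrable_measurable]
  have ac: "square_integrable (\<lambda>x. cnj (a x))"
    by (rule square_integrable_dominated(1)[OF _ assms(1), of _ 1]) auto
  have i: "integrable lebesgue (\<lambda>x. (cmod (a x))\<^sup>2)" "integrable lebesgue (\<lambda>x. (cmod (b x))\<^sup>2)"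
    using assms by (auto simp: square_integrable_def)
  have p: "integrable lebesgue (\<lambda>x. cnj (a x) * b x)" by (rule square_integrable_product[OF ac assms(2)])
  have e: "(cmod (a x + c * b x))\<^sup>2 = (cmod (a x))\<^sup>2 + (cmod c)\<^sup>2 * (cmod (b x))\<^sup>2 + 2 * Re (c * (cnj (a x) * b x))" for x
    by (simp add: cmod_power2) (simp add: power2_eq_square algebra_simps)
  have "(L2_norm (\<lambda>x. a x + c * b x))\<^sup>2
    = (\<integral>x. (cmod (a x))\<^sup>2 + (cmod c)\<^sup>2 * (cmod (b x))\<^sup>2 + 2 * Re (c * (cnj (a x) * b x)) \<partial>lebesgue)"
    unfolding L2_norm_sq e ..
  also have "\<dots> = (L2_norm a)\<^sup>2 + (cmod c)\<^sup>2 * (L2_norm b)\<^sup>2 + 2 * (\<integral>x. Re (c * (cnj (a x) * b x)) \<partial>lebesgue)"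
    using i integrable_Re[OF integrable_mult_right[OF p, of c]] unfolding L2_norm_sq
    by (simp del: times_complex.sel)
  also have "(\<integral>x. Re (c * (cnj (a x) * b x)) \<partial>lebesgue) = Re (c * (\<integral>x. cnj (a x) * b x \<partial>lebesgue))"
    using p by (subst integral_Re) (auto simp del: times_complex.sel)
  finally show ?thesis .
qed

text \<open>Polarisation of Plancherel: comparing the norms of \<open>a + c b\<close> before and
  after the transform gives the identity for the real part of \<open>c\<close> times the inner
  product.\<close>

lemma Parseval:
  fixes a b :: "real^'n \<Rightarrow> complex"
  assumes a: "integrable lborel a" "square_integrable a" and b: "integrable lborel b" "square_integrable b"
    and s: "s = 1 \<or> s = -1"
  shows "(\<integral>\<xi>. cnj (FT s a \<xi>) * FT s b \<xi> \<partial>lebesgue)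
    = of_real ((gauss_const TYPE(real^'n))\<^sup>2) * (\<integral>x. cnj (a x) * b x \<partial>lebesgue)" (is "?P = of_real (?K\<^sup>2) * ?Q")
proof -
  have *: "Re (c * ?P) = ?K\<^sup>2 * Re (c * ?Q)" for c
  proof -
    have "(L2_norm (FT s (\<lambda>x. a x + c * b x)))\<^sup>2 = ?K\<^sup>2 * (L2_norm (\<lambda>x. a x + c * b x))\<^sup>2"
      using Plancherel[of "\<lambda>x. a x + c * b x" s] a b s
      by (simp add: square_integrable_add square_integrable_mult_left power_mult_distrib)
    moreover have "FT s (\<lambda>x. a x + c * b x) = (\<lambda>\<xi>. FT s a \<xi> + c * FT s b \<xi>)"
      using FT_integrable[OF a(1)] FT_integrable[OF b(1)]
      by (intro ext) (simp add: FT_def distrib_left mult.left_commute[of _ c])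
    ultimately have "(L2_norm (\<lambda>\<xi>. FT s a \<xi> + c * FT s b \<xi>))\<^sup>2 = ?K\<^sup>2 * (L2_norm (\<lambda>x. a x + c * b x))\<^sup>2"
      by simp
    then show ?thesis
      unfolding L2_norm_add_sq[OF a(2) b(2)] L2_norm_add_sq[OF FT_square_integrable(1)[OF a s] FT_square_integrable(1)[OF b s]]
        Plancherel[OF a s] Plancherel[OF b s]
      by (simp add: algebra_simps power_mult_distrib)
  qed
  show ?thesis
    \<comment> \<open>The scalar 1 reads off the real part, and \<open>- \<i>\<close> the imaginary
      part.\<close>
    using *[of 1] *[of "- \<i>"] by (simp add: complex_eq_iff)
qed

section \<open>Truncation to balls and the L2 limit defining \<open>fourier\<close>\<close>

lemma square_integrable_indicator_cball:
  "square_integrable (\<lambda>x::real^'n. indicator (cball 0 R) x)"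
proof -
  have "integrable lborel (\<lambda>x::real^'n. (cmod (indicator (cball 0 R) x))\<^sup>2)"
  proof -
    have "(\<lambda>x::real^'n. (cmod (indicator (cball 0 R) x))\<^sup>2) = indicator (cball 0 R)"
      by (auto simp: indicator_def fun_eq_iff)
    then show ?thesis
      using integrable_real_indicator[of "cball 0 R" "lborel :: (real^'n) measure"] emeasure_lborel_cball_finite[of "0::real^'n" R]
      by simp
  qed
  moreover have "(\<lambda>x::real^'n. indicator (cball 0 R) x :: complex) \<in> borel_measurable borel"
    by (intro borel_measurable_indicator) simp
  ultimately show ?thesis by (subst square_integrable_borel_iff) auto
qed

definition trunc :: "real \<Rightarrow> (real^'n \<Rightarrow> complex) \<Rightarrow> real^'n \<Rightarrow> complex" where
  "trunc R f = (\<lambda>x. indicator (cball 0 R) x * f x)"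

lemma trunc_integrable:
  assumes "square_integrable f"
  shows "integrable lebesgue (trunc R f)" "square_integrable (trunc R f)"
proof -
  show "integrable lebesgue (trunc R f)"
    unfolding trunc_def by (rule square_integrable_product(1)[OF square_integrable_indicator_cball assms])
  show "square_integrable (trunc R f)"
  proof (rule square_integrable_dominated(1)[OF _ assms, of _ 1])
    show "trunc R f \<in> borel_measurable lebesgue"
      unfolding trunc_def using square_integrable_measurable[OF assms] square_integrable_measurable[OF square_integrable_indicator_cball]
      by (intro borel_measurable_times) auto
  qed (auto simp: trunc_def norm_mult indicator_def)
qed

lemma trunc_tendsto:
  fixes f :: "real^'n \<Rightarrow> complex"
  assumes "square_integrable f"
  shows "((\<lambda>R. L2_norm (\<lambda>x. trunc R f x - f x)) \<longlongrightarrow> 0) at_top"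
proof (rule tendsto_at_topI_sequentially)
  fix X :: "nat \<Rightarrow> real" assume X: "filterlim X at_top sequentially"
  show "(\<lambda>n. L2_norm (\<lambda>x. trunc (X n) f x - f x)) \<longlonglongrightarrow> 0"
  proof (rule L2_dominated_tendsto[OF _ assms])
    show "AE x in lebesgue. (\<lambda>n. trunc (X n) f x) \<longlonglongrightarrow> f x"
    proof (rule AE_I2, rule tendsto_eventually)
      fix x :: "real^'n"
      have "eventually (\<lambda>n. norm x \<le> X n) sequentially"
        using X unfolding filterlim_at_top by auto
      then show "eventually (\<lambda>n. trunc (X n) f x = f x) sequentially"
        by eventually_elim (simp add: trunc_def)
    qed
  qed (use square_integrable_measurable[OF assms] square_integrable_measurable[OF trunc_integrable(2)[OF assms]]
       in \<open>auto simp: trunc_def indicator_def\<close>)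
qed

text \<open>Transfers the integral over \<open>lebesgue\<close> in the definition to the Borel
  setting of \<open>FT\<close>; the value at each frequency does not see the change of
  representative.\<close>

lemma fourier_integral_eq_FT:
  fixes f :: "real^'n \<Rightarrow> complex"
  assumes "AE x in lborel. f x = g x" "f \<in> borel_measurable lebesgue" "g \<in> borel_measurable borel"
  shows "fourier_integral f = FT (- 1) g"
proof
  fix \<xi> :: "real^'n"
  note [measurable] = assms(2,3) borel_imp_lebesgue[OF assms(3)]
  have [measurable]: "(\<lambda>x. cis (- (x \<bullet> \<xi>))) \<in> borel_measurable lebesgue"
    by (rule borel_imp_lebesgue) measurable
  have "fourier_integral f \<xi> = integral\<^sup>L lebesgue (\<lambda>x. cis (- (x \<bullet> \<xi>)) * g x)"
    unfolding fourier_integral_def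
    by (rule integral_cong_AE) (use AE_completion[OF assms(1)] in \<open>auto elim!: eventually_mono\<close>)
  also have "\<dots> = FT (- 1) g \<xi>"
    unfolding FT_def by (subst integral_completion) auto
  finally show "fourier_integral f \<xi> = FT (- 1) g \<xi>" .
qed

lemma integrable_cong_AE_lborel:
  fixes f :: "'a::euclidean_space \<Rightarrow> complex"
  assumes "AE x in lborel. f x = g x" "g \<in> borel_measurable borel" "integrable lebesgue f"
  shows "integrable lborel g"
proof -
  have "integrable lebesgue g"
    by (rule integrable_cong_AE_imp[OF assms(3) borel_imp_lebesgue[OF assms(2)] AE_completion[OF assms(1)]])
  then show ?thesis using assms(2) by (simp add: integrable_completion)
qed

lemma fourier_integral_Plancherel:
  fixes f :: "real^'n \<Rightarrow> complex"
  assumes "integrable lebesgue f" "square_integrable f"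
  shows "square_integrable (fourier_integral f)"
    and "L2_norm (fourier_integral f) = gauss_const TYPE(real^'n) * L2_norm f"
proof -
  obtain g where g: "g \<in> borel_measurable borel" "AE x in lborel. f x = g x"
    using ex_borel_AE_eq[of f] assms(2) by (auto simp: square_integrable_def)
  have gi: "integrable lborel g" using integrable_cong_AE_lborel[OF g(2,1) assms(1)] .
  have gs: "square_integrable g" "L2_norm g = L2_norm f"
    using square_integrable_cong_AE[OF AE_completion[OF g(2)] assms(2) borel_imp_lebesgue[OF g(1)]] by auto
  have e: "fourier_integral f = FT (- 1) g"
    by (rule fourier_integral_eq_FT[OF g(2) _ g(1)]) (use assms in \<open>auto simp: square_integrable_def\<close>)
  show "square_integrable (fourier_integral f)" unfolding e by (rule FT_square_integrable[OF gi gs(1)]) auto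
  show "L2_norm (fourier_integral f) = gauss_const TYPE(real^'n) * L2_norm f"
    unfolding e using Plancherel[OF gi gs(1), of "- 1"] gs(2) by simp
qed

lemma fourier_integral_diff:
  fixes f g :: "real^'n \<Rightarrow> complex"
  assumes "integrable lebesgue f" "integrable lebesgue g"
  shows "fourier_integral (\<lambda>x. f x - g x) = (\<lambda>\<xi>. fourier_integral f \<xi> - fourier_integral g \<xi>)"
proof
  fix \<xi> :: "real^'n"
  have "(\<lambda>x. - (x \<bullet> \<xi>)) \<in> borel_measurable (borel :: (real^'n) measure)" by measurable
  then have m: "(\<lambda>x. - (x \<bullet> \<xi>)) \<in> borel_measurable lebesgue" by (rule borel_imp_lebesgue)
  show "fourier_integral (\<lambda>x. f x - g x) \<xi> = fourier_integral f \<xi> - fourier_integral g \<xi>"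
    unfolding fourier_integral_def using integrable_cis_mult[OF assms(1) m] integrable_cis_mult[OF assms(2) m]
    by (simp add: right_diff_distrib)
qed

lemma fourier_trunc_diff:
  fixes f :: "real^'n \<Rightarrow> complex"
  assumes f: "square_integrable f"
  shows "L2_norm (\<lambda>\<xi>. fourier_integral (trunc R f) \<xi> - fourier_integral (trunc R' f) \<xi>)
    \<le> gauss_const TYPE(real^'n) * (L2_norm (\<lambda>x. trunc R f x - f x) + L2_norm (\<lambda>x. trunc R' f x - f x))"
proof -
  note t = trunc_integrable[OF f]
  have "L2_norm (\<lambda>\<xi>. fourier_integral (trunc R f) \<xi> - fourier_integral (trunc R' f) \<xi>)
     = gauss_const TYPE(real^'n) * L2_norm (\<lambda>x. trunc R f x - trunc R' f x)"
    using fourier_integral_Plancherel(2)[of "\<lambda>x. trunc R f x - trunc R' f x"] t fourier_integral_diff[OF t(1)[of R] t(1)[of R']]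
    by (simp add: square_integrable_diff)
  also have "\<dots> \<le> gauss_const TYPE(real^'n) * (L2_norm (\<lambda>x. trunc R f x - f x) + L2_norm (\<lambda>x. trunc R' f x - f x))"
    using L2_norm_triangle[OF t(2)[of R] f t(2)[of R']] L2_norm_minus_commute[of f "trunc R' f"]
    by (intro mult_left_mono) (auto simp: less_imp_le)
  finally show ?thesis .
qed

text \<open>The choice in the definition of \<open>fourier\<close> is not vacuous: by Plancherel the
  transforms of the truncations are Cauchy as the radius grows, and L2 is complete.\<close>

lemma fourier_spec:
  fixes f :: "real^'n \<Rightarrow> complex"
  assumes f: "square_integrable f"
  shows "square_integrable (fourier f)"
    and "((\<lambda>R. L2_norm (\<lambda>\<xi>. fourier_integral (trunc R f) \<xi> - fourier f \<xi>)) \<longlongrightarrow> 0) at_top"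
proof -
  let ?K = "gauss_const TYPE(real^'n)"
  let ?F = "\<lambda>R. fourier_integral (trunc R f)"
  let ?e = "\<lambda>R. L2_norm (\<lambda>x. trunc R f x - f x)"
  note t = trunc_integrable[OF f]
  note Fs = fourier_integral_Plancherel(1)[OF t]
  note e0 = trunc_tendsto[OF f]
  have ev: "eventually (\<lambda>R. ?K * ?e R < e) at_top" if "e > 0" for e
    using order_tendstoD(2)[OF tendsto_mult_left[OF e0, of ?K], of e] that by simp
  obtain g where g: "square_integrable g" "(\<lambda>n. L2_norm (\<lambda>\<xi>. ?F (real n) \<xi> - g \<xi>)) \<longlonglongrightarrow> 0"
  proof (rule L2_complete[of "\<lambda>n. ?F (real n)"])
    fix e :: real assume "e > 0"
    then obtain R0 where R0: "\<And>R. R \<ge> R0 \<Longrightarrow> ?K * ?e R < e / 2"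
      using ev[of "e / 2"] by (auto simp: eventually_at_top_linorder)
    show "\<exists>N. \<forall>m\<ge>N. \<forall>n\<ge>N. L2_norm (\<lambda>x. ?F (real m) x - ?F (real n) x) < e"
    proof (intro exI[of _ "nat \<lceil>R0\<rceil>"] allI impI)
      fix m n assume "m \<ge> nat \<lceil>R0\<rceil>" "n \<ge> nat \<lceil>R0\<rceil>"
      then have "?K * ?e (real m) < e / 2" "?K * ?e (real n) < e / 2" by (auto intro!: R0 simp only: nat_ceiling_le_eq)
      then show "L2_norm (\<lambda>x. ?F (real m) x - ?F (real n) x) < e"
        using fourier_trunc_diff[OF f, of "real m" "real n"] by (simp add: distrib_left)
    qed
  qed (use Fs in auto)
  \<comment> \<open>Completeness gave the limit along integer radii; the Cauchy estimate extends it
    to all real radii.\<close>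
  have "((\<lambda>R. L2_norm (\<lambda>\<xi>. ?F R \<xi> - g \<xi>)) \<longlongrightarrow> 0) at_top"
  proof (rule order_tendstoI)
    fix e :: real assume "0 < e"
    then obtain R0 where R0: "\<And>R. R \<ge> R0 \<Longrightarrow> ?K * ?e R < e / 3"
      using ev[of "e / 3"] by (auto simp: eventually_at_top_linorder)
    have "eventually (\<lambda>n. L2_norm (\<lambda>\<xi>. ?F (real n) \<xi> - g \<xi>) < e / 3) sequentially"
      using order_tendstoD(2)[OF g(2), of "e / 3"] \<open>0 < e\<close> by simp
    moreover have "eventually (\<lambda>n. real n \<ge> R0) sequentially" by real_asymp
    ultimately have "eventually (\<lambda>n. L2_norm (\<lambda>\<xi>. ?F (real n) \<xi> - g \<xi>) < e / 3 \<and> real n \<ge> R0) sequentially"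
      by (rule eventually_conj)
    then obtain n where n: "L2_norm (\<lambda>\<xi>. ?F (real n) \<xi> - g \<xi>) < e / 3" "real n \<ge> R0"
      by (auto simp: eventually_sequentially)
    show "eventually (\<lambda>R. L2_norm (\<lambda>\<xi>. ?F R \<xi> - g \<xi>) < e) at_top"
    proof (rule eventually_at_top_linorderI[of R0])
      fix R assume "R \<ge> R0"
      then show "L2_norm (\<lambda>\<xi>. ?F R \<xi> - g \<xi>) < e"
        using L2_norm_triangle[OF Fs[of R] Fs[of "real n"] g(1)] fourier_trunc_diff[OF f, of R "real n"] n R0[of R] R0[of "real n"]
        by (simp add: distrib_left)
    qed
  qed (auto intro!: always_eventually intro: less_le_trans[OF _ L2_norm_nonneg])
  then have "\<exists>g. square_integrable g \<and> ((\<lambda>R. L2_norm (\<lambda>\<xi>. ?F R \<xi> - g \<xi>)) \<longlongrightarrow> 0) at_top"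
    using g(1) by blast
  from someI_ex[OF this] show "square_integrable (fourier f)"
    "((\<lambda>R. L2_norm (\<lambda>\<xi>. ?F R \<xi> - fourier f \<xi>)) \<longlongrightarrow> 0) at_top"
    unfolding fourier_def trunc_def by auto
qed

lemma fourier_unique:
  assumes f: "square_integrable f" and g: "square_integrable g"
    and lim: "((\<lambda>R. L2_norm (\<lambda>\<xi>. fourier_integral (trunc R f) \<xi> - g \<xi>)) \<longlongrightarrow> 0) at_top"
  shows "AE \<xi> in lebesgue. fourier f \<xi> = g \<xi>"
proof -
  note Fs = fourier_integral_Plancherel(1)[OF trunc_integrable[OF f]]
  have "L2_norm (\<lambda>\<xi>. fourier f \<xi> - g \<xi>) \<le> 0"
  proof (rule tendsto_le[OF _ tendsto_add[OF fourier_spec(2)[OF f] lim, simplified] tendsto_const])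
    show "eventually (\<lambda>R. L2_norm (\<lambda>\<xi>. fourier f \<xi> - g \<xi>) \<le> L2_norm (\<lambda>\<xi>. fourier_integral (trunc R f) \<xi> - fourier f \<xi>)
       + L2_norm (\<lambda>\<xi>. fourier_integral (trunc R f) \<xi> - g \<xi>)) at_top"
      using L2_norm_triangle[OF fourier_spec(1)[OF f] Fs g] L2_norm_minus_commute[of "fourier f"]
      by (intro always_eventually) auto
  qed simp
  then have "L2_norm (\<lambda>\<xi>. fourier f \<xi> - g \<xi>) = 0" using L2_norm_nonneg[of "\<lambda>\<xi>. fourier f \<xi> - g \<xi>"] by linarith
  from L2_norm_zero_AE[OF square_integrable_diff(1)[OF fourier_spec(1)[OF f] g] this]
  show ?thesis by eventually_elim simp
qed

text \<open>Linearity can be stated only almost everywhere, since the three transforms are separate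
  choices of representatives.\<close>

lemma fourier_diff:
  assumes f: "square_integrable f" and g: "square_integrable g"
  shows "AE \<xi> in lebesgue. fourier (\<lambda>x. f x - g x) \<xi> = fourier f \<xi> - fourier g \<xi>"
proof (rule fourier_unique)
  note tf = trunc_integrable[OF f] and tg = trunc_integrable[OF g]
  note F = fourier_integral_Plancherel(1)[OF tf] and G = fourier_integral_Plancherel(1)[OF tg]
  show "((\<lambda>R. L2_norm (\<lambda>\<xi>. fourier_integral (trunc R (\<lambda>x. f x - g x)) \<xi> - (fourier f \<xi> - fourier g \<xi>))) \<longlongrightarrow> 0) at_top"
  proof (rule tendsto_sandwich[OF _ _ tendsto_const tendsto_add[OF fourier_spec(2)[OF f] fourier_spec(2)[OF g], simplified]])
    have e: "fourier_integral (trunc R (\<lambda>x. f x - g x)) = (\<lambda>\<xi>. fourier_integral (trunc R f) \<xi> - fourier_integral (trunc R g) \<xi>)" for R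
      using fourier_integral_diff[OF tf(1)[of R] tg(1)[of R]] by (simp add: trunc_def right_diff_distrib)
    show "\<forall>\<^sub>F R in at_top. L2_norm (\<lambda>\<xi>. fourier_integral (trunc R (\<lambda>x. f x - g x)) \<xi> - (fourier f \<xi> - fourier g \<xi>))
       \<le> L2_norm (\<lambda>\<xi>. fourier_integral (trunc R f) \<xi> - fourier f \<xi>) + L2_norm (\<lambda>\<xi>. fourier_integral (trunc R g) \<xi> - fourier g \<xi>)"
    proof (rule always_eventually, rule allI)
      fix R
      have "L2_norm (\<lambda>\<xi>. (fourier_integral (trunc R f) \<xi> - fourier f \<xi>) - (fourier_integral (trunc R g) \<xi> - fourier g \<xi>))
       \<le> L2_norm (\<lambda>\<xi>. fourier_integral (trunc R f) \<xi> - fourier f \<xi>) + L2_norm (\<lambda>\<xi>. fourier_integral (trunc R g) \<xi> - fourier g \<xi>)"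
        by (intro square_integrable_diff F G fourier_spec f g)
      then show "L2_norm (\<lambda>\<xi>. fourier_integral (trunc R (\<lambda>x. f x - g x)) \<xi> - (fourier f \<xi> - fourier g \<xi>))
       \<le> L2_norm (\<lambda>\<xi>. fourier_integral (trunc R f) \<xi> - fourier f \<xi>) + L2_norm (\<lambda>\<xi>. fourier_integral (trunc R g) \<xi> - fourier g \<xi>)"
        unfolding e by (simp add: algebra_simps)
    qed
  qed auto
qed (intro square_integrable_diff fourier_spec f g)+

lemma fourier_norm:
  fixes f :: "real^'n \<Rightarrow> complex"
  assumes f: "square_integrable f"
  shows "L2_norm (fourier f) = gauss_const TYPE(real^'n) * L2_norm f"
proof -
  note t = trunc_integrable[OF f]
  note Fs = fourier_integral_Plancherel[OF t]
  have lim: "((\<lambda>R. L2_norm (h R)) \<longlongrightarrow> L2_norm g) at_top"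
    if "\<And>R::real. square_integrable (h R)" "square_integrable g" "((\<lambda>R. L2_norm (\<lambda>x. h R x - g x)) \<longlongrightarrow> 0) at_top"
    for h and g :: "real^'n \<Rightarrow> complex"
  proof (rule LIM_zero_cancel, rule Lim_null_comparison[OF _ that(3)])
    show "\<forall>\<^sub>F R in at_top. norm (L2_norm (h R) - L2_norm g) \<le> L2_norm (\<lambda>x. h R x - g x)"
      using L2_norm_diff_ge[OF that(1,2)] by (intro always_eventually) auto
  qed
  have "((\<lambda>R. gauss_const TYPE(real^'n) * L2_norm (trunc R f)) \<longlongrightarrow> L2_norm (fourier f)) at_top"
    using lim[OF Fs(1) fourier_spec[OF f]] unfolding Fs(2) .
  moreover have "((\<lambda>R. gauss_const TYPE(real^'n) * L2_norm (trunc R f)) \<longlongrightarrow> gauss_const TYPE(real^'n) * L2_norm f) at_top"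
    by (intro tendsto_mult_left lim t f trunc_tendsto)
  ultimately show ?thesis by (rule tendsto_unique[rotated]) simp
qed

lemma AE_lborel_uminus:
  fixes P :: "'a::euclidean_space \<Rightarrow> bool"
  assumes "AE x in lborel. P x"
  shows "AE x in lborel. P (- x)"
proof -
  obtain N where "{x \<in> space lborel. \<not> P x} \<subseteq> N" "emeasure lborel N = 0" "N \<in> sets lborel"
    using AE_E[OF assms] by blast
  then have N: "N \<in> null_sets lborel" "{x. \<not> P x} \<subseteq> N" by auto
  then have [measurable]: "N \<in> sets borel" by auto
  have "(\<integral>\<^sup>+x. indicator N (- x) \<partial>lborel) = (0::ennreal)"
    using N by (subst nn_integral_lborel_uminus) auto
  then have "AE x in lborel. indicator N (- x :: 'a) = (0::ennreal)"
    by (subst (asm) nn_integral_0_iff_AE) auto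
  then show ?thesis
  proof eventually_elim
    fix x assume "indicator N (- x) = (0::ennreal)"
    then show "P (- x)" using N(2) by (auto simp: indicator_def split: if_splits)
  qed
qed

lemma L2_norm_uminus:
  fixes f :: "real^'n \<Rightarrow> complex"
  assumes "square_integrable f"
  shows "L2_norm (\<lambda>x. f (- x)) = L2_norm f"
proof -
  obtain g where g[measurable]: "g \<in> borel_measurable borel" and e: "AE x in lborel. f x = g x"
    using ex_borel_AE_eq[of f] assms by (auto simp: square_integrable_def)
  have m: "(\<lambda>x. f (- x)) \<in> borel_measurable lebesgue"
    using borel_measurable_affine[OF square_integrable_measurable[OF assms], of "- 1" 0] by simp
  have g': "(\<lambda>x. g (- x)) \<in> borel_measurable borel" by measurable
  have "L2_norm (\<lambda>x. f (- x)) = L2_norm (\<lambda>x. g (- x))"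
    by (rule L2_norm_cong_AE[OF _ borel_imp_lebesgue[OF g'] m])
       (rule AE_completion, use AE_lborel_uminus[OF e] in eventually_elim, simp)
  also have "\<dots> = L2_norm g"
    using integral_lborel_uminus[of "\<lambda>x. (cmod (g x))\<^sup>2"] L2_norm_sq_borel[OF g] L2_norm_sq_borel[OF g']
    by (subst power2_eq_iff_nonneg[symmetric]) auto
  also have "\<dots> = L2_norm f"
    by (rule L2_norm_cong_AE[OF AE_completion[OF e] square_integrable_measurable[OF assms] borel_imp_lebesgue[OF g]])
  finally show ?thesis .
qed

section \<open>Fourier inversion and Sobolev functions\<close>

lemma square_integrable_cnj:
  assumes "square_integrable f"
  shows "square_integrable (\<lambda>x. cnj (f x))"
  by (rule square_integrable_dominated(1)[OF _ assms, of _ 1])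
     (use square_integrable_measurable[OF assms] in auto)

lemma L2_inner_tendsto:
  assumes "square_integrable h" "\<And>n. square_integrable (f n)" "square_integrable g"
    and "(\<lambda>n. L2_norm (\<lambda>x. f n x - g x)) \<longlonglongrightarrow> 0"
  shows "(\<lambda>n. \<integral>x. h x * f n x \<partial>lebesgue) \<longlonglongrightarrow> (\<integral>x. h x * g x \<partial>lebesgue)"
proof (rule LIM_zero_cancel, rule Lim_null_comparison)
  show "(\<lambda>n. L2_norm h * L2_norm (\<lambda>x. f n x - g x)) \<longlonglongrightarrow> 0"
    using tendsto_mult_left[OF assms(4), of "L2_norm h"] by simp
  show "\<forall>\<^sub>F n in sequentially. norm ((\<integral>x. h x * f n x \<partial>lebesgue) - (\<integral>x. h x * g x \<partial>lebesgue))
    \<le> L2_norm h * L2_norm (\<lambda>x. f n x - g x)"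
  proof (rule always_eventually, rule allI)
    fix n
    have "(\<integral>x. h x * f n x \<partial>lebesgue) - (\<integral>x. h x * g x \<partial>lebesgue) = (\<integral>x. h x * (f n x - g x) \<partial>lebesgue)"
      using square_integrable_product(1)[OF assms(1,2), of n] square_integrable_product(1)[OF assms(1,3)]
      by (simp add: right_diff_distrib)
    then show "norm ((\<integral>x. h x * f n x \<partial>lebesgue) - (\<integral>x. h x * g x \<partial>lebesgue))
      \<le> L2_norm h * L2_norm (\<lambda>x. f n x - g x)"
      using square_integrable_product(3)[OF assms(1) square_integrable_diff(1)[OF assms(2,3)], of n] by simp
  qed
qed

text \<open>Were the norm of \<open>w\<close> positive, some admissible \<open>p\<close> would lie
  closer to \<open>w\<close> than that norm. Orthogonality to \<open>p\<close> turns the squared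
  norm of \<open>w\<close> into the product of \<open>w - p\<close> with \<open>w\<close>, which
  Cauchy-Schwarz makes strictly smaller.\<close>

lemma L2_zero_if_orthogonal:
  fixes w :: "real^'n \<Rightarrow> complex"
  assumes w: "square_integrable w"
    and orth: "\<And>p. continuous_on UNIV p \<Longrightarrow> integrable lborel p \<Longrightarrow> square_integrable p \<Longrightarrow> (\<integral>x. cnj (p x) * w x \<partial>lebesgue) = 0"
  shows "L2_norm w = 0"
proof (rule ccontr)
  assume "L2_norm w \<noteq> 0"
  then have pos: "L2_norm w > 0" using L2_norm_nonneg[of w] by linarith
  obtain p M R where p: "continuous_on UNIV p" "\<And>x. cmod (p x) \<le> M" "\<forall>x. norm x > R \<longrightarrow> p x = 0"
    "L2_norm (\<lambda>x. p x - w x) < L2_norm w"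
    using square_integrable_approx[OF w pos] by blast
  note pi = continuous_compact_support_integrable[OF p(1-3)]
  have d: "square_integrable (\<lambda>x. cnj (w x - p x))" by (intro square_integrable_cnj square_integrable_diff w pi)
  have "complex_of_real ((L2_norm w)\<^sup>2) = (\<integral>x. cnj (w x) * w x \<partial>lebesgue)"
    unfolding L2_norm_sq by (subst integral_complex_of_real[symmetric]) (simp only: complex_norm_square mult.commute)
  also have "\<dots> = (\<integral>x. cnj (w x - p x) * w x + cnj (p x) * w x \<partial>lebesgue)"
    by (simp add: algebra_simps)
  also have "\<dots> = (\<integral>x. cnj (w x - p x) * w x \<partial>lebesgue) + (\<integral>x. cnj (p x) * w x \<partial>lebesgue)"
    by (intro Bochner_Integration.integral_add square_integrable_product(1) d w square_integrable_cnj pi)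
  also have "(\<integral>x. cnj (p x) * w x \<partial>lebesgue) = 0" by (rule orth[OF p(1) pi])
  finally have "(L2_norm w)\<^sup>2 = cmod (\<integral>x. cnj (w x - p x) * w x \<partial>lebesgue)"
    by (metis add.right_neutral norm_of_real abs_of_nonneg zero_le_power2)
  also have "\<dots> \<le> L2_norm (\<lambda>x. cnj (w x - p x)) * L2_norm w" by (rule square_integrable_product(3)[OF d w])
  also have "L2_norm (\<lambda>x. cnj (w x - p x)) = L2_norm (\<lambda>x. p x - w x)"
    unfolding L2_norm_def by (simp add: norm_minus_commute flip: complex_cnj_diff)
  also have "\<dots> * L2_norm w < L2_norm w * L2_norm w" using p(4) pos by simp
  finally show False by (simp add: power2_eq_square)
qed

lemma continuous_AE_zero:
  fixes w :: "'a::euclidean_space \<Rightarrow> 'b::real_normed_vector"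
  assumes "continuous_on UNIV w" "AE x in lebesgue. w x = 0"
  shows "w x = 0"
proof (rule ccontr)
  assume x: "w x \<noteq> 0"
  have "open (w -` (- {0}))" by (rule open_vimage[OF open_Compl[OF closed_singleton] assms(1)])
  moreover have "negligible (w -` (- {0}))"
    using assms(2) unfolding negligible_iff_null_sets completion.AE_iff_null_sets by (simp add: vimage_def Compl_eq)
  ultimately have "w -` (- {0}) = {}" using open_not_negligible by blast
  then show False using x by auto
qed

text \<open>Proved weakly. Against each test function \<open>p\<close>, Parseval for the truncations
  of \<open>u\<close> and duality for the integrable transform \<open>g\<close> give the same
  number, so the two sides agree in L2. Both are continuous, hence they agree at every point, which
  the pointwise equation later requires.\<close>

theorem fourier_inversion:
  fixes u :: "real^'n \<Rightarrow> complex"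
  assumes u: "square_integrable u" "continuous_on UNIV u"
    and g: "integrable lborel g" "AE \<xi> in lborel. fourier u \<xi> = g \<xi>"
  shows "of_real ((gauss_const TYPE(real^'n))\<^sup>2) * u x = FT 1 g x"
proof -
  let ?k = "complex_of_real ((gauss_const TYPE(real^'n))\<^sup>2)"
  have gm[measurable]: "g \<in> borel_measurable borel" using g(1) by auto
  have um: "u \<in> borel_measurable borel" by (rule borel_measurable_continuous_onI[OF u(2)])
  have gs: "square_integrable g"
    by (rule square_integrable_cong_AE[OF AE_completion[OF g(2)] fourier_spec(1)[OF u(1)] borel_imp_lebesgue[OF gm]])
  define v where "v = FT 1 g"
  have vs: "square_integrable v" unfolding v_def by (rule FT_square_integrable[OF g(1) gs]) simp
  have vc: "continuous_on UNIV v" unfolding v_def by (rule FT_continuous[OF g(1)])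
  note t = trunc_integrable[OF u(1)]
  have tm: "trunc n u \<in> borel_measurable borel" for n
    unfolding trunc_def by (intro borel_measurable_times um borel_measurable_indicator) simp
  have ti: "integrable lborel (trunc n u)" for n using t(1)[of n] tm[of n] by (simp add: integrable_completion)
  have F: "fourier_integral (trunc n u) = FT (- 1) (trunc n u)" for n
    by (rule fourier_integral_eq_FT) (auto simp: tm borel_imp_lebesgue)
  have conv: "(\<lambda>n. L2_norm (\<lambda>\<xi>. FT (- 1) (trunc (real n) u) \<xi> - g \<xi>)) \<longlonglongrightarrow> 0"
  proof -
    have "(\<lambda>n. L2_norm (\<lambda>\<xi>. FT (- 1) (trunc (real n) u) \<xi> - fourier u \<xi>)) \<longlonglongrightarrow> 0"
      using filterlim_compose[OF fourier_spec(2)[OF u(1)] filterlim_real_sequentially] unfolding F .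
    moreover have "L2_norm (\<lambda>\<xi>. FT (- 1) (trunc (real n) u) \<xi> - fourier u \<xi>) = L2_norm (\<lambda>\<xi>. FT (- 1) (trunc (real n) u) \<xi> - g \<xi>)" for n
    proof (rule L2_norm_cong_AE)
      show "AE \<xi> in lebesgue. FT (- 1) (trunc (real n) u) \<xi> - g \<xi> = FT (- 1) (trunc (real n) u) \<xi> - fourier u \<xi>"
        by (rule AE_completion) (use g(2) in eventually_elim, simp)
    qed (intro borel_measurable_diff borel_imp_lebesgue FT_measurable ti gm square_integrable_measurable[OF fourier_spec(1)[OF u(1)]])+
    ultimately show ?thesis by simp
  qed
  have ws: "square_integrable (\<lambda>x. ?k * u x - v x)"
    by (intro square_integrable_diff square_integrable_mult_left u vs)
  have "L2_norm (\<lambda>x. ?k * u x - v x) = 0"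
  proof (rule L2_zero_if_orthogonal[OF ws])
    fix p :: "real^'n \<Rightarrow> complex"
    assume p: "continuous_on UNIV p" "integrable lborel p" "square_integrable p"
    have [measurable]: "p \<in> borel_measurable borel" using p(2) by auto
    have pc: "square_integrable (\<lambda>x. cnj (p x))" by (rule square_integrable_cnj[OF p(3)])
    have Fp: "square_integrable (FT (- 1) p)" by (rule FT_square_integrable[OF p(2,3)]) simp
    have lim1: "(\<lambda>n. \<integral>\<xi>. cnj (FT (- 1) p \<xi>) * FT (- 1) (trunc (real n) u) \<xi> \<partial>lebesgue)
       \<longlonglongrightarrow> (\<integral>\<xi>. cnj (FT (- 1) p \<xi>) * g \<xi> \<partial>lebesgue)"
      by (intro L2_inner_tendsto conv gs square_integrable_cnj[OF Fp] FT_square_integrable ti t) simp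
    have lim2: "(\<lambda>n. \<integral>x. cnj (p x) * trunc (real n) u x \<partial>lebesgue) \<longlonglongrightarrow> (\<integral>x. cnj (p x) * u x \<partial>lebesgue)"
      by (intro L2_inner_tendsto pc t u filterlim_compose[OF trunc_tendsto[OF u(1)] filterlim_real_sequentially])
    have "(\<lambda>n. \<integral>\<xi>. cnj (FT (- 1) p \<xi>) * FT (- 1) (trunc (real n) u) \<xi> \<partial>lebesgue)
       = (\<lambda>n. ?k * (\<integral>x. cnj (p x) * trunc (real n) u x \<partial>lebesgue))"
      by (intro ext Parseval p ti t) simp
    then have "(\<integral>\<xi>. cnj (FT (- 1) p \<xi>) * g \<xi> \<partial>lebesgue) = ?k * (\<integral>x. cnj (p x) * u x \<partial>lebesgue)"
      using LIMSEQ_unique[OF lim1] tendsto_mult_left[OF lim2, of ?k] by simp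
    \<comment> \<open>Conjugation flips the sign of the transform of \<open>p\<close>, and duality
      then places \<open>FT 1\<close> on \<open>g\<close>, producing \<open>v\<close>.\<close>
    moreover have "(\<integral>\<xi>. cnj (FT (- 1) p \<xi>) * g \<xi> \<partial>lebesgue) = (\<integral>x. cnj (p x) * v x \<partial>lebesgue)"
    proof -
      have [measurable]: "FT (- 1) p \<in> borel_measurable borel" "v \<in> borel_measurable borel"
        unfolding v_def by (intro FT_measurable p g)+
      have "(\<integral>\<xi>. cnj (FT (- 1) p \<xi>) * g \<xi> \<partial>lebesgue) = (\<integral>\<xi>. cnj (FT (- 1) p \<xi>) * g \<xi> \<partial>lborel)"
        by (rule integral_completion) simp
      also have "\<dots> = (\<integral>\<xi>. FT 1 (\<lambda>x. cnj (p x)) \<xi> * g \<xi> \<partial>lborel)"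
        by (simp add: FT_cnj)
      also have "\<dots> = (\<integral>x. cnj (p x) * FT 1 g x \<partial>lborel)"
        by (rule FT_duality) (use p g in auto)
      also have "\<dots> = (\<integral>x. cnj (p x) * v x \<partial>lebesgue)"
        unfolding v_def[symmetric] by (rule integral_completion[symmetric]) simp
      finally show ?thesis .
    qed
    moreover have "(\<integral>x. cnj (p x) * (?k * u x - v x) \<partial>lebesgue) = ?k * (\<integral>x. cnj (p x) * u x \<partial>lebesgue) - (\<integral>x. cnj (p x) * v x \<partial>lebesgue)"
      using square_integrable_product(1)[OF pc u(1)] square_integrable_product(1)[OF pc vs]
      by (simp add: right_diff_distrib mult.left_commute[of _ ?k] del: of_real_power)
    ultimately show "(\<integral>x. cnj (p x) * (?k * u x - v x) \<partial>lebesgue) = 0" by simp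
  qed
  from L2_norm_zero_AE[OF ws this] have "?k * u x - v x = 0"
    by (intro continuous_AE_zero[of "\<lambda>x. ?k * u x - v x"] continuous_intros u vc)
  then show ?thesis by (simp add: v_def)
qed

text \<open>The Japanese bracket of the frequency to the power \<open>m\<close>; for
  \<open>m = s\<close> it is the weight in \<open>bessel_multiplier\<close>.\<close>

definition japanese :: "real \<Rightarrow> 'a::real_normed_vector \<Rightarrow> real" where
  "japanese m \<xi> = (1 + (norm \<xi>)\<^sup>2) powr (m / 2)"

lemma one_plus_norm_sq_pos: "0 < 1 + (norm x)\<^sup>2"
  by (simp add: add_pos_nonneg)

lemma japanese_pos [simp]: "0 < japanese m \<xi>"
  using one_plus_norm_sq_pos[of \<xi>] by (simp add: japanese_def)

lemma japanese_nonneg [simp]: "0 \<le> japanese m \<xi>"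
  using japanese_pos[of m \<xi>] by linarith

lemma japanese_add: "japanese (m + m') \<xi> = japanese m \<xi> * japanese m' \<xi>"
  by (simp only: japanese_def add_divide_distrib powr_add)

lemma japanese_mono: "m \<le> m' \<Longrightarrow> japanese m \<xi> \<le> japanese m' \<xi>"
  by (auto simp: japanese_def intro!: powr_mono)

lemma japanese_0 [simp]: "japanese 0 \<xi> = 1"
  using one_plus_norm_sq_pos[of \<xi>] by (simp add: japanese_def)

lemma norm_powr_le_japanese:
  assumes "m \<ge> 0"
  shows "norm \<xi> powr m \<le> japanese m \<xi>"
proof -
  have "norm \<xi> powr m = ((norm \<xi>)\<^sup>2) powr (m / 2)"
  proof (cases "\<xi> = 0")
    case False
    then have "(norm \<xi>)\<^sup>2 = norm \<xi> powr 2" by (simp add: powr_numeral)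
    then show ?thesis by (simp only: powr_powr) simp
  qed simp
  also have "\<dots> \<le> japanese m \<xi>"
    unfolding japanese_def using assms by (intro powr_mono2) auto
  finally show ?thesis .
qed

lemma japanese_measurable [measurable]: "japanese m \<in> borel_measurable borel"
  unfolding japanese_def[abs_def] by measurable

text \<open>Dyadic decomposition: on the shell of radius about 2^k the squared weight is of order
  2^(-2qk), while the ball has volume of order 2^(kN). The resulting geometric series converges
  because 2q exceeds the dimension N.\<close>

lemma japanese_square_integrable:
  assumes "q > real CARD('n::finite) / 2"
  shows "square_integrable (\<lambda>\<xi>::real^'n. of_real (japanese (- q) \<xi>))"
proof -
  let ?N = "CARD('n)" and ?V = "unit_ball_vol (real CARD('n))"
  let ?r = "2 powr (real ?N - 2 * q)"
  have q: "q > 0" using assms by (meson divide_nonneg_pos le_less_trans of_nat_0_le_iff zero_less_numeral)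
  \<comment> \<open>The factor \<open>4 powr q\<close> pays for evaluating the weight at the outer
    radius 2^k of a shell whose inner radius is 2^(k-1).\<close>
  define h where "h k \<xi> = ennreal (4 powr q * 2 powr (- 2 * q * real k)) * indicator (cball (0::real^'n) (2 ^ k)) \<xi>" for k \<xi>
  have [measurable]: "h k \<in> borel_measurable borel" for k
    unfolding h_def by (rule borel_measurable_times_ennreal[OF borel_measurable_const borel_measurable_indicator]) simp
  have le: "ennreal ((cmod (of_real (japanese (- q) \<xi>)))\<^sup>2) \<le> (\<Sum>k. h k \<xi>)" for \<xi> :: "real^'n"
  proof -
    have sq: "(cmod (of_real (japanese (- q) \<xi>)))\<^sup>2 = (1 + (norm \<xi>)\<^sup>2) powr (- q)"
    proof -
      have "(cmod (of_real (japanese (- q) \<xi>)))\<^sup>2 = japanese (- q) \<xi> * japanese (- q) \<xi>"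
        by (simp add: power2_eq_square)
      then show ?thesis unfolding japanese_add[symmetric] by (simp add: japanese_def)
    qed
    define k where "k = (LEAST k. norm \<xi> \<le> 2 ^ k)"
    obtain k0 where "norm \<xi> < 2 ^ k0" using real_arch_pow[of 2 "norm \<xi>"] by auto
    then have k: "norm \<xi> \<le> 2 ^ k" unfolding k_def by (intro LeastI[of "\<lambda>k. norm \<xi> \<le> 2 ^ k" k0]) simp
    have "(1 + (norm \<xi>)\<^sup>2) powr (- q) \<le> 4 powr q * 2 powr (- 2 * q * real k)"
    proof (cases k)
      case 0
      have "(1 + (norm \<xi>)\<^sup>2) powr (- q) \<le> 1 powr (- q)"
        using q by (intro powr_mono2') auto
      also have "\<dots> \<le> 4 powr q" using q by (simp add: ge_one_powr_ge_zero)
      finally show ?thesis using 0 by simp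
    next
      case (Suc j)
      then have "\<not> norm \<xi> \<le> 2 ^ j" using not_less_Least[of j "\<lambda>k. norm \<xi> \<le> 2 ^ k"] by (simp add: k_def)
      then have "(2 ^ j)\<^sup>2 \<le> (norm \<xi>)\<^sup>2" by (intro power_mono) auto
      then have le: "(2 ^ j)\<^sup>2 \<le> 1 + (norm \<xi>)\<^sup>2" by linarith
      have "(1 + (norm \<xi>)\<^sup>2) powr (- q) \<le> ((2 ^ j)\<^sup>2) powr (- q)"
        by (rule powr_mono2'[OF _ _ le]) (use q in simp_all)
      also have "((2::real) ^ j)\<^sup>2 = 2 powr (2 * real j)"
        using powr_realpow[of 2 "2 * j"] by (simp add: power_even_eq)
      also have "(2 powr (2 * real j)) powr (- q) = 4 powr q * 2 powr (- 2 * q * real k)"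
      proof -
        have "(4::real) powr q = 2 powr (2 * q)" using powr_powr[of 2 2 q] by simp
        then show ?thesis unfolding powr_powr Suc by (simp only: powr_add[symmetric]) (simp add: algebra_simps)
      qed
      finally show ?thesis .
    qed
    then have "ennreal ((cmod (of_real (japanese (- q) \<xi>)))\<^sup>2) \<le> h k \<xi>"
      unfolding sq using k by (simp add: h_def ennreal_leI)
    also have "\<dots> \<le> (\<Sum>k. h k \<xi>)"
      using sum_le_suminf[OF summableI, of "{k}" "\<lambda>k. h k \<xi>"] by simp
    finally show ?thesis .
  qed
  have "(\<integral>\<^sup>+\<xi>. ennreal ((cmod (of_real (japanese (- q) (\<xi>::real^'n))))\<^sup>2) \<partial>lebesgue) \<le> (\<integral>\<^sup>+\<xi>. (\<Sum>k. h k \<xi>) \<partial>lborel)"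
    by (subst nn_integral_completion) (rule nn_integral_mono[OF le])
  also have "\<dots> = (\<Sum>k. \<integral>\<^sup>+\<xi>. h k \<xi> \<partial>lborel)"
    by (rule nn_integral_suminf) simp
  also have "\<dots> = (\<Sum>k. ennreal (4 powr q * ?V * ?r ^ k))"
  proof (intro suminf_cong)
    fix k
    have "(\<integral>\<^sup>+\<xi>. h k \<xi> \<partial>lborel) = ennreal (4 powr q * 2 powr (- 2 * q * real k)) * ennreal (?V * (2 ^ k) ^ ?N)"
      unfolding h_def by (subst nn_integral_cmult) (auto intro!: borel_measurable_indicator simp: emeasure_cball)
    also have "\<dots> = ennreal (4 powr q * 2 powr (- 2 * q * real k) * (?V * (2 ^ k) ^ ?N))"
      by (rule ennreal_mult[symmetric]) auto
    also have "4 powr q * 2 powr (- 2 * q * real k) * (?V * (2 ^ k) ^ ?N) = 4 powr q * ?V * ?r ^ k"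
    proof -
      have "((2::real) ^ k) ^ ?N = 2 powr (real k * real ?N)"
        unfolding powr_powr[symmetric] by (simp add: powr_realpow)
      moreover have "?r ^ k = 2 powr ((real ?N - 2 * q) * real k)"
        unfolding powr_powr[symmetric] by (simp add: powr_realpow)
      moreover have "2 powr ((real ?N - 2 * q) * real k) = 2 powr (- 2 * q * real k) * 2 powr (real k * real ?N)"
        unfolding powr_add[symmetric] by (simp add: algebra_simps)
      ultimately show ?thesis by simp
    qed
    finally show "(\<integral>\<^sup>+\<xi>. h k \<xi> \<partial>lborel) = ennreal (4 powr q * ?V * ?r ^ k)" .
  qed
  also have "\<dots> < \<infinity>"
  proof -
    have "?r < 2 powr 0" using assms by (intro powr_less_mono) auto
    then have "summable (\<lambda>k. 4 powr q * ?V * ?r ^ k)" by (intro summable_mult summable_geometric) simp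
    then show ?thesis by (subst suminf_ennreal2) auto
  qed
  finally show ?thesis
    unfolding square_integrable_iff_nn
    using borel_imp_lebesgue[of "\<lambda>\<xi>::real^'n. complex_of_real (japanese (- q) \<xi>)"] by auto
qed

text \<open>Cauchy-Schwarz against the weight of order \<open>m - s\<close>, which is square
  integrable exactly when s - m exceeds N/2. This is the Sobolev embedding loss in the regularity
  threshold.\<close>

lemma weighted_L1_le_L2:
  fixes g :: "real^'n \<Rightarrow> complex"
  assumes "m < s - real CARD('n) / 2" and g: "g \<in> borel_measurable borel"
    and sq: "square_integrable (\<lambda>\<xi>. of_real (japanese s \<xi>) * g \<xi>)"
  shows "integrable lborel (\<lambda>\<xi>. of_real (japanese m \<xi>) * g \<xi>)"
    and "(\<integral>\<xi>. japanese m \<xi> * cmod (g \<xi>) \<partial>lborel)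
      \<le> L2_norm (\<lambda>\<xi>::real^'n. of_real (japanese (m - s) \<xi>)) * L2_norm (\<lambda>\<xi>. of_real (japanese s \<xi>) * g \<xi>)"
proof -
  note [measurable] = g
  have w: "square_integrable (\<lambda>\<xi>::real^'n. of_real (japanese (m - s) \<xi>))"
    using japanese_square_integrable[of "s - m", where 'n='n] assms(1) by simp
  have e: "of_real (japanese (m - s) \<xi>) * (of_real (japanese s \<xi>) * g \<xi>) = of_real (japanese m \<xi>) * g \<xi>" for \<xi>
    using japanese_add[of "m - s" s \<xi>] by (simp flip: mult.assoc of_real_mult)
  have e': "cmod (of_real (japanese (m - s) \<xi>)) * cmod (of_real (japanese s \<xi>) * g \<xi>) = japanese m \<xi> * cmod (g \<xi>)" for \<xi>
    unfolding norm_mult[symmetric] e by (simp add: norm_mult)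
  show "integrable lborel (\<lambda>\<xi>. of_real (japanese m \<xi>) * g \<xi>)"
    using square_integrable_product(1)[OF w sq] unfolding e by (simp add: integrable_completion)
  show "(\<integral>\<xi>. japanese m \<xi> * cmod (g \<xi>) \<partial>lborel)
      \<le> L2_norm (\<lambda>\<xi>::real^'n. of_real (japanese (m - s) \<xi>)) * L2_norm (\<lambda>\<xi>. of_real (japanese s \<xi>) * g \<xi>)"
    using square_integrable_product(2)[OF w sq] unfolding e' by (simp add: integral_completion)
qed

text \<open>The inverse transform in \<open>sobolev_norm\<close> only contributes a constant:
  Plancherel gives the factor (2 pi)^(N/2) and the normalisation (2 pi)^(-N).\<close>

lemma sobolev_norm_eq:
  fixes f :: "real^'n \<Rightarrow> complex"
  assumes "square_integrable (bessel_multiplier s f)"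
  shows "L2_norm (bessel_multiplier s f) = gauss_const TYPE(real^'n) * sobolev_norm s f"
proof -
  let ?b = "bessel_multiplier s f" and ?K = "gauss_const TYPE(real^'n)"
  have K: "(2 * pi) ^ CARD('n) = ?K\<^sup>2"
  proof -
    have "(sqrt (2 * pi) ^ CARD('n))\<^sup>2 = ((sqrt (2 * pi))\<^sup>2) ^ CARD('n)"
      by (simp only: power_mult[symmetric] mult.commute)
    then show ?thesis by (simp add: gauss_const_def)
  qed
  have "sobolev_norm s f = L2_norm (\<lambda>x. (1 / of_real (?K\<^sup>2)) * fourier ?b (- x))"
    unfolding sobolev_norm_def inverse_fourier_def[abs_def] K by simp
  also have "\<dots> = 1 / ?K\<^sup>2 * L2_norm (fourier ?b)"
  proof -
    have "square_integrable (\<lambda>x. fourier ?b (- x))"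
    proof (rule square_integrable_le(1)[of _ "L2_norm (fourier ?b)"])
      show m: "(\<lambda>x. fourier ?b (- x)) \<in> borel_measurable lebesgue"
        using borel_measurable_affine[OF square_integrable_measurable[OF fourier_spec(1)[OF assms]], of "- 1" 0] by simp
      obtain h where h[measurable]: "h \<in> borel_measurable borel" and e: "AE x in lborel. fourier ?b x = h x"
        using ex_borel_AE_eq[OF square_integrable_measurable[OF fourier_spec(1)[OF assms]]] by blast
      have "(\<integral>\<^sup>+x. ennreal ((cmod (fourier ?b (- x)))\<^sup>2) \<partial>lebesgue) = (\<integral>\<^sup>+x. ennreal ((cmod (h (- x)))\<^sup>2) \<partial>lborel)"
        unfolding nn_integral_completion
        by (rule nn_integral_cong_AE) (use AE_lborel_uminus[OF e] in eventually_elim, simp)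
      also have "\<dots> = (\<integral>\<^sup>+x. ennreal ((cmod (h x))\<^sup>2) \<partial>lborel)"
        using nn_integral_lborel_uminus[of "\<lambda>x. ennreal ((cmod (h x))\<^sup>2)"] by simp
      also have "\<dots> = (\<integral>\<^sup>+x. ennreal ((cmod (fourier ?b x))\<^sup>2) \<partial>lebesgue)"
        unfolding nn_integral_completion
        by (rule nn_integral_cong_AE) (use e in eventually_elim, simp)
      also have "\<dots> = ennreal ((L2_norm (fourier ?b))\<^sup>2)" by (rule nn_integral_square[OF fourier_spec(1)[OF assms]])
      finally show "(\<integral>\<^sup>+x. ennreal ((cmod (fourier ?b (- x)))\<^sup>2) \<partial>lebesgue) \<le> ennreal ((L2_norm (fourier ?b))\<^sup>2)" by simp
    qed simp
    from square_integrable_mult_left(2)[OF this, of "1 / of_real (?K\<^sup>2)"] L2_norm_uminus[OF fourier_spec(1)[OF assms]]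
    show ?thesis by (simp add: norm_divide norm_power)
  qed
  also have "\<dots> = 1 / ?K\<^sup>2 * (?K * L2_norm ?b)" unfolding fourier_norm[OF assms] ..
  finally show ?thesis
    using less_imp_neq[OF gauss_const_pos[where 'a="real^'n"]] by (simp add: power2_eq_square)
qed

text \<open>Since s exceeds N/2, the transform is integrable and inversion applies. The function
  \<open>g\<close> is a Borel representative of the transform divided by the inversion constant, so
  that the representation holds pointwise with no factor in front.\<close>

lemma sobolev_representation:
  fixes f :: "real^'n \<Rightarrow> complex"
  assumes f: "sobolev s f" "continuous_on UNIV f" and s: "s > real CARD('n) / 2"
  obtains g where "g \<in> borel_measurable borel" "square_integrable (\<lambda>\<xi>. of_real (japanese s \<xi>) * g \<xi>)"
    "f = FT 1 g" "AE \<xi> in lborel. fourier f \<xi> = of_real ((gauss_const TYPE(real^'n))\<^sup>2) * g \<xi>"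
proof -
  let ?k = "complex_of_real ((gauss_const TYPE(real^'n))\<^sup>2)"
  have k: "?k \<noteq> 0" using gauss_const_pos[where 'a="real^'n"] by (simp del: gauss_const_pos)
  have fs: "square_integrable f" and bs: "square_integrable (bessel_multiplier s f)"
    using f by (auto simp: sobolev_def)
  obtain h where h[measurable]: "h \<in> borel_measurable borel" and e: "AE \<xi> in lborel. fourier f \<xi> = h \<xi>"
    using ex_borel_AE_eq[OF square_integrable_measurable[OF fourier_spec(1)[OF fs]]] by blast
  have hs: "square_integrable (\<lambda>\<xi>. of_real (japanese s \<xi>) * h \<xi>)"
  proof (rule square_integrable_cong_AE(1)[OF _ bs])
    show "AE \<xi> in lebesgue. bessel_multiplier s f \<xi> = of_real (japanese s \<xi>) * h \<xi>"
      by (rule AE_completion) (use e in eventually_elim, simp add: bessel_multiplier_def japanese_def)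
  qed (simp add: borel_imp_lebesgue)
  have hi: "integrable lborel h"
    using weighted_L1_le_L2(1)[OF _ h hs, of 0] s by simp
  note inv = fourier_inversion[OF fs f(2) hi e]
  show thesis
  proof
    show "(\<lambda>\<xi>. inverse ?k * h \<xi>) \<in> borel_measurable borel" by measurable
    show "square_integrable (\<lambda>\<xi>. of_real (japanese s \<xi>) * (inverse ?k * h \<xi>))"
      using square_integrable_mult_left(1)[OF hs, of "inverse ?k"] by (simp add: mult_ac)
    show "f = FT 1 (\<lambda>\<xi>. inverse ?k * h \<xi>)"
    proof
      fix x
      have "f x = inverse ?k * FT 1 h x"
        using inv[of x] k by (simp add: field_simps)
      also have "\<dots> = FT 1 (\<lambda>\<xi>. inverse ?k * h \<xi>) x"
        unfolding FT_def by (subst integral_mult_right_zero[symmetric]) (simp add: mult_ac)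
      finally show "f x = FT 1 (\<lambda>\<xi>. inverse ?k * h \<xi>) x" .
    qed
    show "AE \<xi> in lborel. fourier f \<xi> = ?k * (inverse ?k * h \<xi>)"
      using e by eventually_elim (use k in \<open>simp add: field_simps\<close>)
  qed
qed

text \<open>Representatives are chosen separately for each time. Continuity of the path survives,
  because the weighted L2 distance of two of them is the Sobolev distance of the functions divided
  by \<open>?K\<close>.\<close>

lemma sobolev_path_representation:
  fixes u :: "real \<Rightarrow> real^'n \<Rightarrow> complex"
  assumes u: "sobolev_path s T u" and s: "s > real CARD('n) / 2"
  obtains G where "\<And>t. t \<in> {0..T} \<Longrightarrow> G t \<in> borel_measurable borel"
    "\<And>t. t \<in> {0..T} \<Longrightarrow> square_integrable (\<lambda>\<xi>. of_real (japanese s \<xi>) * G t \<xi>)"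
    "\<And>t. t \<in> {0..T} \<Longrightarrow> u t = FT 1 (G t)"
    "\<And>t. t \<in> {0..T} \<Longrightarrow>
      ((\<lambda>r. L2_norm (\<lambda>\<xi>. of_real (japanese s \<xi>) * (G r \<xi> - G t \<xi>))) \<longlongrightarrow> 0) (at t within {0..T})"
proof -
  let ?K = "gauss_const TYPE(real^'n)"
  let ?k = "complex_of_real (?K\<^sup>2)"
  have K0: "?K > 0" by simp
  have k: "?k \<noteq> 0" using K0 by (simp del: gauss_const_pos)
  have "\<forall>t\<in>{0..T}. \<exists>g. g \<in> borel_measurable borel \<and> square_integrable (\<lambda>\<xi>. of_real (japanese s \<xi>) * g \<xi>) \<and>
    u t = FT 1 g \<and> (AE \<xi> in lborel. fourier (u t) \<xi> = ?k * g \<xi>)"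
  proof
    fix t assume "t \<in> {0..T}"
    then have "sobolev s (u t)" "continuous_on UNIV (u t)" using u by (auto simp: sobolev_path_def)
    then obtain g where "g \<in> borel_measurable borel \<and> square_integrable (\<lambda>\<xi>. of_real (japanese s \<xi>) * g \<xi>) \<and>
      u t = FT 1 g \<and> (AE \<xi> in lborel. fourier (u t) \<xi> = ?k * g \<xi>)"
      by (rule sobolev_representation[OF _ _ s]) simp
    then show "\<exists>g. g \<in> borel_measurable borel \<and> square_integrable (\<lambda>\<xi>. of_real (japanese s \<xi>) * g \<xi>) \<and>
      u t = FT 1 g \<and> (AE \<xi> in lborel. fourier (u t) \<xi> = ?k * g \<xi>)" by blast
  qed
  from bchoice[OF this] obtain G where G: "\<And>t. t \<in> {0..T} \<Longrightarrow> G t \<in> borel_measurable borel"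
    "\<And>t. t \<in> {0..T} \<Longrightarrow> square_integrable (\<lambda>\<xi>. of_real (japanese s \<xi>) * G t \<xi>)"
    "\<And>t. t \<in> {0..T} \<Longrightarrow> u t = FT 1 (G t)"
    "\<And>t. t \<in> {0..T} \<Longrightarrow> AE \<xi> in lborel. fourier (u t) \<xi> = ?k * G t \<xi>"
    by blast
  have eq: "L2_norm (\<lambda>\<xi>. of_real (japanese s \<xi>) * (G r \<xi> - G t \<xi>)) = sobolev_norm s (\<lambda>x. u r x - u t x) / ?K"
    if r: "r \<in> {0..T}" and t: "t \<in> {0..T}" for r t
  proof -
    let ?d = "\<lambda>x. u r x - u t x"
    let ?D = "\<lambda>\<xi>. of_real (japanese s \<xi>) * (G r \<xi> - G t \<xi>)"
    have us: "square_integrable (u r)" "square_integrable (u t)"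
      using u r t by (auto simp: sobolev_path_def sobolev_def)
    note [measurable] = G(1)[OF r] G(1)[OF t]
    have Ds: "square_integrable ?D"
      using square_integrable_diff(1)[OF G(2)[OF r] G(2)[OF t]] by (simp add: right_diff_distrib)
    \<comment> \<open>The transform of the difference is yet another choice; it agrees almost
      everywhere with the difference of the chosen \<open>G\<close>.\<close>
    have ae: "AE \<xi> in lebesgue. bessel_multiplier s ?d \<xi> = ?k * ?D \<xi>"
      using fourier_diff[OF us] AE_completion[OF G(4)[OF r]] AE_completion[OF G(4)[OF t]]
      by eventually_elim (simp add: bessel_multiplier_def japanese_def right_diff_distrib mult.left_commute)
    have dm: "bessel_multiplier s ?d \<in> borel_measurable lebesgue"
      unfolding bessel_multiplier_def[abs_def] japanese_def[symmetric]
      using borel_imp_lebesgue[of "\<lambda>\<xi>. complex_of_real (japanese s \<xi>)"]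
        square_integrable_measurable[OF fourier_spec(1)[OF square_integrable_diff(1)[OF us]]]
      by (intro borel_measurable_times) auto
    note kD = square_integrable_mult_left[OF Ds, of ?k]
    have bs: "square_integrable (bessel_multiplier s ?d)"
      by (rule square_integrable_cong_AE(1)[OF _ kD(1) dm]) (use ae in eventually_elim, simp)
    have "L2_norm (bessel_multiplier s ?d) = ?K\<^sup>2 * L2_norm ?D"
      using square_integrable_cong_AE(2)[OF ae bs square_integrable_measurable[OF kD(1)]] kD(2) by (simp add: norm_power)
    then show ?thesis
      unfolding sobolev_norm_eq[OF bs] using K0 by (simp add: power2_eq_square field_simps del: gauss_const_pos)
  qed
  have "((\<lambda>r. L2_norm (\<lambda>\<xi>. of_real (japanese s \<xi>) * (G r \<xi> - G t \<xi>))) \<longlongrightarrow> 0) (at t within {0..T})"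
    if t: "t \<in> {0..T}" for t
  proof -
    have "((\<lambda>r. sobolev_norm s (\<lambda>x. u r x - u t x) / ?K) \<longlongrightarrow> 0 / ?K) (at t within {0..T})"
      using u t K0 unfolding sobolev_path_def by (intro tendsto_divide tendsto_const) (auto simp del: gauss_const_pos)
    then show ?thesis
      by (subst Lim_cong_within[OF refl refl refl, of _ _ _ "\<lambda>r. sobolev_norm s (\<lambda>x. u r x - u t x) / ?K"])
         (auto simp: eq[OF _ t])
  qed
  with G(1-3) show thesis by (rule that)
qed

section \<open>Weighted integrability of the transform and regularity\<close>

lemma cis_approx1: "cmod (cis t - 1) \<le> \<bar>t\<bar>"
  using iexp_approx1[of t 0] by (simp add: cis_conv_exp)

lemma cis_approx2: "cmod (cis t - 1 - \<i> * of_real t) \<le> t\<^sup>2"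
proof -
  have "cmod (cis t - 1 - \<i> * of_real t) \<le> \<bar>t\<bar>\<^sup>2 / 2"
    using iexp_approx1[of t 1] by (simp add: cis_conv_exp numeral_2_eq_2 diff_diff_eq)
  also have "\<dots> \<le> t\<^sup>2" by simp
  finally show ?thesis .
qed

text \<open>Interpolates between the bound |t| for small arguments and the trivial bound 2, which
  makes fractional exponents \<open>p\<close> available.\<close>

lemma cis_diff_sq_le:
  assumes "0 \<le> p" "p \<le> 2"
  shows "(cmod (cis t - 1))\<^sup>2 \<le> 4 * \<bar>t\<bar> powr p"
proof (cases "\<bar>t\<bar> \<le> 1")
  case True
  show ?thesis
  proof (cases "t = 0")
    case False
    have "(cmod (cis t - 1))\<^sup>2 \<le> \<bar>t\<bar>\<^sup>2" by (intro power_mono cis_approx1) simp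
    also have "\<bar>t\<bar>\<^sup>2 = \<bar>t\<bar> powr 2" using False by (simp add: powr_numeral)
    also have "\<dots> \<le> \<bar>t\<bar> powr p" using assms True by (intro powr_mono') auto
    also have "\<dots> \<le> 4 * \<bar>t\<bar> powr p" by simp
    finally show ?thesis .
  qed simp
next
  case False
  have "cmod (cis t - 1) \<le> 2" using norm_triangle_ineq4[of "cis t" 1] by simp
  then have "(cmod (cis t - 1))\<^sup>2 \<le> 2\<^sup>2" by (intro power_mono) auto
  also have "\<dots> \<le> 4 * \<bar>t\<bar> powr p" using ge_one_powr_ge_zero[of "\<bar>t\<bar>" p] False assms by simp
  finally show ?thesis .
qed

lemma japanese_ge_1: "m \<ge> 0 \<Longrightarrow> 1 \<le> japanese m \<xi>"
  using japanese_mono[of 0 m \<xi>] by simp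

lemma norm_power_le_japanese: "norm \<xi> ^ k \<le> japanese (real k) \<xi>"
\<comment> \<open>At the origin \<open>0 ^ 0\<close> is 1 whereas \<open>0 powr 0\<close> is 0, so
  the bound for real powers does not cover this case.\<close>
proof (cases "\<xi> = 0")
  case True
  then show ?thesis using japanese_ge_1[of "real k" \<xi>] by (cases k) (auto intro: order_trans[of _ 1])
next
  case False
  then show ?thesis using norm_powr_le_japanese[of "real k" \<xi>] by (simp add: powr_realpow)
qed

text \<open>The norm of \<open>FT 1 g\<close> in the Wiener algebra with weight \<open>m\<close>.\<close>

definition wiener :: "real \<Rightarrow> ('a::euclidean_space \<Rightarrow> complex) \<Rightarrow> bool" where
  "wiener m g \<longleftrightarrow> g \<in> borel_measurable borel \<and> integrable lborel (\<lambda>\<xi>. of_real (japanese m \<xi>) * g \<xi>)"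

definition wiener_norm :: "real \<Rightarrow> ('a::euclidean_space \<Rightarrow> complex) \<Rightarrow> real" where
  "wiener_norm m g = (\<integral>\<xi>. japanese m \<xi> * cmod (g \<xi>) \<partial>lborel)"

lemma wiener_integrable_norm:
  assumes "wiener m g"
  shows "integrable lborel (\<lambda>\<xi>. japanese m \<xi> * cmod (g \<xi>))"
proof -
  have "integrable lborel (\<lambda>\<xi>. cmod (of_real (japanese m \<xi>) * g \<xi>))"
    using assms by (intro integrable_norm) (simp add: wiener_def)
  then show ?thesis by (simp add: norm_mult)
qed

lemma wiener_dominated:
  assumes "wiener m g" "h \<in> borel_measurable borel" "\<And>\<xi>. cmod (h \<xi>) \<le> C * (japanese m \<xi> * cmod (g \<xi>))"
  shows "integrable lborel h" "(\<integral>\<xi>. cmod (h \<xi>) \<partial>lborel) \<le> C * wiener_norm m g"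
proof -
  note i = integrable_mult_right[OF wiener_integrable_norm[OF assms(1)], of C]
  show h: "integrable lborel h"
    by (rule Bochner_Integration.integrable_bound[OF i])
       (use assms(2,3) in \<open>auto intro: order_trans[OF _ abs_ge_self]\<close>)
  have "(\<integral>\<xi>. cmod (h \<xi>) \<partial>lborel) \<le> (\<integral>\<xi>. C * (japanese m \<xi> * cmod (g \<xi>)) \<partial>lborel)"
    by (intro integral_mono integrable_norm h i assms(3))
  then show "(\<integral>\<xi>. cmod (h \<xi>) \<partial>lborel) \<le> C * wiener_norm m g"
    by (simp add: wiener_norm_def)
qed

lemma wiener_mono:
  assumes "wiener m g" "m' \<le> m"
  shows "wiener m' g" "wiener_norm m' g \<le> wiener_norm m g"
proof -
  have [measurable]: "g \<in> borel_measurable borel" using assms by (simp add: wiener_def)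
  have le: "cmod (of_real (japanese m' \<xi>) * g \<xi>) \<le> 1 * (japanese m \<xi> * cmod (g \<xi>))" for \<xi>
    using japanese_mono[OF assms(2), of \<xi>] by (auto simp: norm_mult intro!: mult_right_mono)
  note d = wiener_dominated[OF assms(1) _ le]
  show "wiener m' g" using d(1) by (simp add: wiener_def)
  show "wiener_norm m' g \<le> wiener_norm m g" using d(2) by (simp add: wiener_norm_def norm_mult)
qed

lemma wiener_integrable:
  assumes "wiener m g" "0 \<le> m"
  shows "integrable lborel g"
  using wiener_mono(1)[OF assms] by (simp add: wiener_def)

lemma FT_wiener_bound:
  assumes "wiener m g" "0 \<le> m"
  shows "cmod (FT s g x) \<le> wiener_norm m g"
  using FT_bound[OF wiener_integrable[OF assms], of s x] wiener_mono(2)[OF assms]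
  by (simp add: wiener_norm_def)

lemma cmod_integral_le_wiener:
  assumes "wiener m g" "h \<in> borel_measurable borel" "\<And>\<xi>. cmod (h \<xi>) \<le> C * (japanese m \<xi> * cmod (g \<xi>))"
  shows "cmod (\<integral>\<xi>. h \<xi> \<partial>lborel) \<le> C * wiener_norm m g"
  using integral_norm_bound[of lborel h] wiener_dominated(2)[OF assms] by linarith

lemma FT_first_difference:
  assumes g: "wiener m g" "1 \<le> m"
  shows "cmod (FT 1 g x - FT 1 g 0) \<le> norm x * wiener_norm m g"
proof -
  have i: "integrable lborel g" using g by (intro wiener_integrable) auto
  have [measurable]: "g \<in> borel_measurable borel" using g by (simp add: wiener_def)
  have "FT 1 g x - FT 1 g 0 = (\<integral>\<xi>. (cis (\<xi> \<bullet> x) - 1) * g \<xi> \<partial>lborel)"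
    using FT_integrable[OF i, of 1 x] i by (simp add: FT_def left_diff_distrib)
  also have "cmod \<dots> \<le> norm x * wiener_norm m g"
  proof (rule cmod_integral_le_wiener[OF g(1)])
    fix \<xi>
    have "cmod (cis (\<xi> \<bullet> x) - 1) \<le> norm \<xi> * norm x"
      using cis_approx1[of "\<xi> \<bullet> x"] Cauchy_Schwarz_ineq2[of \<xi> x] by linarith
    also have "\<dots> \<le> japanese m \<xi> * norm x"
      using norm_power_le_japanese[of \<xi> 1] japanese_mono[of 1 m \<xi>] g(2) by (intro mult_right_mono) auto
    finally have "cmod (cis (\<xi> \<bullet> x) - 1) * cmod (g \<xi>) \<le> japanese m \<xi> * norm x * cmod (g \<xi>)"
      by (rule mult_right_mono) simp
    then show "cmod ((cis (\<xi> \<bullet> x) - 1) * g \<xi>) \<le> norm x * (japanese m \<xi> * cmod (g \<xi>))"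
      by (simp add: norm_mult mult_ac)
  qed measurable
  finally show ?thesis .
qed

text \<open>On the Fourier side this difference, taken from its endpoint 0, multiplies by the
  perfect square \<open>(cis (\<xi> \<bullet> x) - 1)\<^sup>2\<close>, so the fractional bound for
  that square applies directly.\<close>

lemma FT_second_difference:
  assumes g: "wiener m g" "0 \<le> p" "p \<le> 2" "p \<le> m"
  shows "cmod (FT 1 g (2 *\<^sub>R x) - 2 * FT 1 g x + FT 1 g 0) \<le> 4 * norm x powr p * wiener_norm m g"
proof -
  have i: "integrable lborel g" using wiener_integrable[OF g(1)] g(2,4) by simp
  have [measurable]: "g \<in> borel_measurable borel" using g by (simp add: wiener_def)
  have "(cis (\<xi> \<bullet> x) - 1)\<^sup>2 = cis (\<xi> \<bullet> (2 *\<^sub>R x)) - 2 * cis (\<xi> \<bullet> x) + 1" for \<xi>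
    by (simp add: power2_diff) (simp add: power2_eq_square cis_mult)
  then have "FT 1 g (2 *\<^sub>R x) - 2 * FT 1 g x + FT 1 g 0 = (\<integral>\<xi>. (cis (\<xi> \<bullet> x) - 1)\<^sup>2 * g \<xi> \<partial>lborel)"
    using FT_integrable[OF i, of 1 x] FT_integrable[OF i, of 1 "2 *\<^sub>R x"] i
    by (simp add: FT_def left_diff_distrib distrib_right mult.assoc)
  also have "cmod \<dots> \<le> (4 * norm x powr p) * wiener_norm m g"
  proof (rule cmod_integral_le_wiener[OF g(1)])
    fix \<xi>
    have "(cmod (cis (\<xi> \<bullet> x) - 1))\<^sup>2 \<le> 4 * \<bar>\<xi> \<bullet> x\<bar> powr p"
      by (rule cis_diff_sq_le) (use g in auto)
    also have "\<dots> \<le> 4 * (norm \<xi> * norm x) powr p"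
      using g(2) by (intro mult_left_mono powr_mono2 Cauchy_Schwarz_ineq2) auto
    also have "\<dots> = 4 * (norm \<xi> powr p * norm x powr p)" by (simp add: powr_mult)
    also have "\<dots> \<le> 4 * (japanese m \<xi> * norm x powr p)"
      using order_trans[OF norm_powr_le_japanese[OF g(2), of \<xi>] japanese_mono[OF g(4), of \<xi>]]
      by (intro mult_left_mono mult_right_mono) auto
    finally have "(cmod (cis (\<xi> \<bullet> x) - 1))\<^sup>2 * cmod (g \<xi>) \<le> 4 * (japanese m \<xi> * norm x powr p) * cmod (g \<xi>)"
      by (rule mult_right_mono) simp
    then show "cmod ((cis (\<xi> \<bullet> x) - 1)\<^sup>2 * g \<xi>) \<le> (4 * norm x powr p) * (japanese m \<xi> * cmod (g \<xi>))"
      by (simp add: norm_mult norm_power mult_ac)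
  qed measurable
  finally show ?thesis .
qed

lemma has_derivative_quadratic:
  fixes f :: "'a::real_normed_vector \<Rightarrow> 'b::real_normed_vector"
  assumes "bounded_linear D" "\<And>h. norm (f (x + h) - f x - D h) \<le> C * (norm h)\<^sup>2"
  shows "(f has_derivative D) (at x)"
  unfolding has_derivative_at
proof
  show "(\<lambda>h. norm (f (x + h) - f x - D h) / norm h) \<midarrow>0\<rightarrow> 0"
  proof (rule Lim_null_comparison)
    show "\<forall>\<^sub>F h in at 0. norm (norm (f (x + h) - f x - D h) / norm h) \<le> C * norm h"
    proof (rule always_eventually, rule allI)
      fix h
      show "norm (norm (f (x + h) - f x - D h) / norm h) \<le> C * norm h"
        using assms(2)[of h] by (cases "h = 0") (auto simp: divide_le_eq power2_eq_square mult.assoc)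
    qed
    show "(\<lambda>h. C * norm h) \<midarrow>0\<rightarrow> 0" by (auto intro!: tendsto_eq_intros)
  qed
qed fact

text \<open>Weight 2 makes the Taylor remainder quadratic in \<open>h\<close>, from which
  differentiability is immediate. The price is one weight more than a first derivative itself
  consumes.\<close>

lemma FT_has_derivative:
  fixes g :: "real^'n \<Rightarrow> complex"
  assumes g: "wiener 2 g"
  shows "(FT 1 g has_derivative (\<lambda>h. \<Sum>i\<in>UNIV. (h $ i) *\<^sub>R FT 1 (\<lambda>\<xi>. \<i> * of_real (\<xi> $ i) * g \<xi>) x)) (at x)"
proof (rule has_derivative_quadratic)
  let ?P = "\<lambda>i. FT 1 (\<lambda>\<xi>. \<i> * of_real (\<xi> $ i) * g \<xi>) x"
  show "bounded_linear (\<lambda>h. \<Sum>i\<in>UNIV. (h $ i) *\<^sub>R ?P i)"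
    by (intro bounded_linear_sum bounded_linear_scaleR_const bounded_linear_vec_nth)
  have i: "integrable lborel g" using g by (rule wiener_integrable) simp
  have [measurable]: "g \<in> borel_measurable borel" using g by (simp add: wiener_def)
  have nth[measurable]: "(\<lambda>\<xi>::real^'n. \<xi> $ i) \<in> borel_measurable borel" for i
    by (intro borel_measurable_continuous_onI continuous_intros)
  have gi: "integrable lborel (\<lambda>\<xi>. \<i> * of_real (\<xi> $ i) * g \<xi>)" for i
  proof (rule wiener_dominated(1)[OF g, where C=1])
    fix \<xi> :: "real^'n"
    have "\<bar>\<xi> $ i\<bar> \<le> japanese 2 \<xi>"
      using component_le_norm_cart[of \<xi> i] norm_power_le_japanese[of \<xi> 1] japanese_mono[of 1 2 \<xi>] by simp
    then show "cmod (\<i> * of_real (\<xi> $ i) * g \<xi>) \<le> 1 * (japanese 2 \<xi> * cmod (g \<xi>))"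
      by (auto simp: norm_mult intro!: mult_right_mono)
  qed measurable
  show "norm (FT 1 g (x + h) - FT 1 g x - (\<Sum>i\<in>UNIV. (h $ i) *\<^sub>R ?P i)) \<le> wiener_norm 2 g * (norm h)\<^sup>2" for h
  proof -
    let ?q = "\<lambda>\<xi>. cis (\<xi> \<bullet> x) * (cis (\<xi> \<bullet> h) - 1 - \<i> * of_real (\<xi> \<bullet> h)) * g \<xi>"
    have "(\<Sum>i\<in>UNIV. (h $ i) *\<^sub>R ?P i)
      = (\<integral>\<xi>. (\<Sum>i\<in>UNIV. (h $ i) *\<^sub>R (cis (1 * (\<xi> \<bullet> x)) * (\<i> * of_real (\<xi> $ i) * g \<xi>))) \<partial>lborel)"
      unfolding FT_def using FT_integrable[OF gi, of 1 x] by (subst Bochner_Integration.integral_sum) auto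
    also have "\<dots> = (\<integral>\<xi>. cis (\<xi> \<bullet> x) * (\<i> * of_real (\<xi> \<bullet> h) * g \<xi>) \<partial>lborel)"
    proof (rule Bochner_Integration.integral_cong[OF refl])
      fix \<xi> :: "real^'n"
      have "complex_of_real (\<xi> \<bullet> h) = (\<Sum>i\<in>UNIV. of_real (h $ i) * of_real (\<xi> $ i))"
        by (simp add: inner_vec_def mult.commute)
      then show "(\<Sum>i\<in>UNIV. (h $ i) *\<^sub>R (cis (1 * (\<xi> \<bullet> x)) * (\<i> * of_real (\<xi> $ i) * g \<xi>))) = cis (\<xi> \<bullet> x) * (\<i> * of_real (\<xi> \<bullet> h) * g \<xi>)"
        by (simp add: scaleR_conv_of_real sum_distrib_left sum_distrib_right mult_ac)
    qed
    finally have S: "(\<Sum>i\<in>UNIV. (h $ i) *\<^sub>R ?P i) = (\<integral>\<xi>. cis (\<xi> \<bullet> x) * (\<i> * of_real (\<xi> \<bullet> h) * g \<xi>) \<partial>lborel)" .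
    have Si: "integrable lborel (\<lambda>\<xi>. cis (\<xi> \<bullet> x) * (\<i> * of_real (\<xi> \<bullet> h) * g \<xi>))"
    proof (rule wiener_dominated(1)[OF g, where C="norm h"])
      fix \<xi> :: "real^'n"
      have "\<bar>\<xi> \<bullet> h\<bar> \<le> japanese 2 \<xi> * norm h"
        using norm_power_le_japanese[of \<xi> 1] japanese_mono[of 1 2 \<xi>]
        by (intro order_trans[OF Cauchy_Schwarz_ineq2] mult_right_mono) auto
      from mult_right_mono[OF this, of "cmod (g \<xi>)"]
      show "cmod (cis (\<xi> \<bullet> x) * (\<i> * of_real (\<xi> \<bullet> h) * g \<xi>)) \<le> norm h * (japanese 2 \<xi> * cmod (g \<xi>))"
        by (simp add: norm_mult mult_ac)
    qed measurable
    have "FT 1 g (x + h) - FT 1 g x - (\<Sum>i\<in>UNIV. (h $ i) *\<^sub>R ?P i) = (\<integral>\<xi>. ?q \<xi> \<partial>lborel)"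
    proof -
      have "FT 1 g (x + h) - FT 1 g x - (\<Sum>i\<in>UNIV. (h $ i) *\<^sub>R ?P i)
        = (\<integral>\<xi>. cis (1 * (\<xi> \<bullet> (x + h))) * g \<xi> - cis (1 * (\<xi> \<bullet> x)) * g \<xi> - cis (\<xi> \<bullet> x) * (\<i> * of_real (\<xi> \<bullet> h) * g \<xi>) \<partial>lborel)"
        unfolding S using FT_integrable[OF i, of 1 x] FT_integrable[OF i, of 1 "x + h"] Si by (simp add: FT_def)
      also have "\<dots> = (\<integral>\<xi>. ?q \<xi> \<partial>lborel)"
        by (intro Bochner_Integration.integral_cong refl) (simp add: inner_add_right cis_mult[symmetric] algebra_simps)
      finally show ?thesis .
    qed
    also have "cmod \<dots> \<le> (norm h)\<^sup>2 * wiener_norm 2 g"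
    proof (rule cmod_integral_le_wiener[OF g])
      fix \<xi> :: "real^'n"
      have "cmod (cis (\<xi> \<bullet> h) - 1 - \<i> * of_real (\<xi> \<bullet> h)) \<le> \<bar>\<xi> \<bullet> h\<bar>\<^sup>2" using cis_approx2[of "\<xi> \<bullet> h"] by simp
      also have "\<dots> \<le> (norm \<xi> * norm h)\<^sup>2" by (intro power_mono Cauchy_Schwarz_ineq2) simp
      also have "\<dots> \<le> japanese 2 \<xi> * (norm h)\<^sup>2"
        using norm_power_le_japanese[of \<xi> 2] by (auto simp: power_mult_distrib intro!: mult_right_mono)
      finally have "cmod (cis (\<xi> \<bullet> h) - 1 - \<i> * of_real (\<xi> \<bullet> h)) * cmod (g \<xi>) \<le> japanese 2 \<xi> * (norm h)\<^sup>2 * cmod (g \<xi>)"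
        by (rule mult_right_mono) simp
      then show "cmod (?q \<xi>) \<le> (norm h)\<^sup>2 * (japanese 2 \<xi> * cmod (g \<xi>))"
        by (simp add: norm_mult mult_ac)
    qed measurable
    finally show ?thesis by (simp add: mult.commute)
  qed
qed

lemma partial_derivative_eq:
  assumes "(f has_derivative D) (at x)"
  shows "partial_derivative i f x = D (axis i 1)"
  using frechet_derivative_at[OF assms] by (simp add: partial_derivative_def)

lemma partial_derivative_FT:
  fixes g :: "real^'n \<Rightarrow> complex"
  assumes g: "wiener 2 g"
  shows "partial_derivative i (FT 1 g) = FT 1 (\<lambda>\<xi>. \<i> * of_real (\<xi> $ i) * g \<xi>)"
proof
  fix x
  show "partial_derivative i (FT 1 g) x = FT 1 (\<lambda>\<xi>. \<i> * of_real (\<xi> $ i) * g \<xi>) x"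
    unfolding partial_derivative_eq[OF FT_has_derivative[OF g]] by (simp add: axis_def if_distrib[of "\<lambda>c. c *\<^sub>R _"] cong: if_cong)
qed

lemma wiener_neg_sq:
  fixes g :: "'a::euclidean_space \<Rightarrow> complex"
  assumes g: "wiener (m + 2) g"
  shows "wiener m (\<lambda>\<xi>. - of_real ((norm \<xi>)\<^sup>2) * g \<xi>)"
    and "wiener_norm m (\<lambda>\<xi>. - of_real ((norm \<xi>)\<^sup>2) * g \<xi>) \<le> wiener_norm (m + 2) g"
proof -
  have [measurable]: "g \<in> borel_measurable borel" using g by (simp add: wiener_def)
  have le: "cmod (of_real (japanese m \<xi>) * (- of_real ((norm \<xi>)\<^sup>2) * g \<xi>)) \<le> 1 * (japanese (m + 2) \<xi> * cmod (g \<xi>))" for \<xi> :: 'a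
  proof -
    have "japanese m \<xi> * (norm \<xi>)\<^sup>2 \<le> japanese m \<xi> * japanese 2 \<xi>"
      using norm_power_le_japanese[of \<xi> 2] by (intro mult_left_mono) auto
    from mult_right_mono[OF this, of "cmod (g \<xi>)"] show ?thesis
      by (simp add: norm_mult norm_power japanese_add mult_ac)
  qed
  note d = wiener_dominated[OF g _ le]
  show "wiener m (\<lambda>\<xi>. - of_real ((norm \<xi>)\<^sup>2) * g \<xi>)" using d(1) by (simp add: wiener_def)
  show "wiener_norm m (\<lambda>\<xi>. - of_real ((norm \<xi>)\<^sup>2) * g \<xi>) \<le> wiener_norm (m + 2) g"
    using d(2) by (simp add: wiener_norm_def norm_mult norm_power)
qed

text \<open>Weight 3 is asked for because the first partial derivatives must again have weight 2
  before they can be differentiated. The weight \<open>3 + b\<close> of the solution covers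
  this.\<close>

lemma laplacian_FT:
  fixes g :: "real^'n \<Rightarrow> complex"
  assumes g: "wiener 3 g"
  shows "laplacian (FT 1 g) = FT 1 (\<lambda>\<xi>. - of_real ((norm \<xi>)\<^sup>2) * g \<xi>)"
proof
  fix x
  have g2: "wiener 2 g" using g by (rule wiener_mono) simp
  have [measurable]: "g \<in> borel_measurable borel" using g by (simp add: wiener_def)
  have nth[measurable]: "(\<lambda>\<xi>::real^'n. \<xi> $ i) \<in> borel_measurable borel" for i
    by (intro borel_measurable_continuous_onI continuous_intros)
  have p: "wiener 2 (\<lambda>\<xi>. \<i> * of_real (\<xi> $ i) * g \<xi>)" for i
    unfolding wiener_def
  proof
    show "integrable lborel (\<lambda>\<xi>. of_real (japanese 2 \<xi>) * (\<i> * of_real (\<xi> $ i) * g \<xi>))"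
    proof (rule wiener_dominated(1)[OF g, where C=1])
      fix \<xi> :: "real^'n"
      have "\<bar>\<xi> $ i\<bar> \<le> japanese 1 \<xi>"
        using component_le_norm_cart[of \<xi> i] norm_power_le_japanese[of \<xi> 1] by simp
      then have "japanese 2 \<xi> * \<bar>\<xi> $ i\<bar> \<le> japanese 2 \<xi> * japanese 1 \<xi>" by (intro mult_left_mono) auto
      also have "\<dots> = japanese 3 \<xi>" using japanese_add[of 2 1 \<xi>] by simp
      finally have "japanese 2 \<xi> * \<bar>\<xi> $ i\<bar> * cmod (g \<xi>) \<le> japanese 3 \<xi> * cmod (g \<xi>)"
        by (rule mult_right_mono) simp
      then show "cmod (of_real (japanese 2 \<xi>) * (\<i> * of_real (\<xi> $ i) * g \<xi>)) \<le> 1 * (japanese 3 \<xi> * cmod (g \<xi>))"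
        by (simp add: norm_mult mult_ac)
    qed measurable
  qed measurable
  have pp: "partial_derivative i (partial_derivative i (FT 1 g)) = FT 1 (\<lambda>\<xi>. - of_real ((\<xi> $ i)\<^sup>2) * g \<xi>)" for i
    unfolding partial_derivative_FT[OF g2] partial_derivative_FT[OF p]
    by (rule arg_cong[where f="FT 1"]) (auto simp: fun_eq_iff power2_eq_square complex_eq_iff)
  have pi: "integrable lborel (\<lambda>\<xi>. - of_real ((\<xi> $ i)\<^sup>2) * g \<xi>)" for i
  proof (rule wiener_dominated(1)[OF g, where C=1])
    fix \<xi> :: "real^'n"
    have "(\<xi> $ i)\<^sup>2 \<le> (norm \<xi>)\<^sup>2" using power_mono[OF component_le_norm_cart[of \<xi> i], of 2] by simp
    also have "\<dots> \<le> japanese 3 \<xi>" using norm_power_le_japanese[of \<xi> 2] japanese_mono[of 2 3 \<xi>] by simp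
    finally show "cmod (- of_real ((\<xi> $ i)\<^sup>2) * g \<xi>) \<le> 1 * (japanese 3 \<xi> * cmod (g \<xi>))"
      by (auto simp: norm_mult norm_power intro!: mult_right_mono)
  qed measurable
  have "laplacian (FT 1 g) x = (\<integral>\<xi>. (\<Sum>i\<in>UNIV. cis (1 * (\<xi> \<bullet> x)) * (- of_real ((\<xi> $ i)\<^sup>2) * g \<xi>)) \<partial>lborel)"
    unfolding laplacian_def pp FT_def using FT_integrable[OF pi, of 1 x] by (subst Bochner_Integration.integral_sum) auto
  also have "\<dots> = FT 1 (\<lambda>\<xi>. - of_real ((norm \<xi>)\<^sup>2) * g \<xi>) x"
    unfolding FT_def
  proof (rule Bochner_Integration.integral_cong[OF refl])
    fix \<xi> :: "real^'n"
    have "(norm \<xi>)\<^sup>2 = (\<Sum>i\<in>UNIV. (\<xi> $ i)\<^sup>2)"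
      unfolding power2_norm_eq_inner inner_vec_def by (simp add: power2_eq_square)
    then show "(\<Sum>i\<in>UNIV. cis (1 * (\<xi> \<bullet> x)) * (- of_real ((\<xi> $ i)\<^sup>2) * g \<xi>)) = cis (1 * (\<xi> \<bullet> x)) * (- of_real ((norm \<xi>)\<^sup>2) * g \<xi>)"
      by (simp add: sum_distrib_left sum_distrib_right sum_negf)
  qed
  finally show "laplacian (FT 1 g) x = FT 1 (\<lambda>\<xi>. - of_real ((norm \<xi>)\<^sup>2) * g \<xi>) x" .
qed

section \<open>An odd test function with a simple zero\<close>

text \<open>The smooth function exp(-1/r) extended by 0, together with its multiples by powers of
  1/r: the powers produced by differentiation stay in the span of the family.\<close>

definition flat :: "nat \<Rightarrow> real \<Rightarrow> real" where
  "flat m r = (if r > 0 then (1 / r) ^ m * exp (- 1 / r) else 0)"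

text \<open>A single term of the exponential series at t = 1/r beats the power t^m, with one factor
  of r to spare.\<close>

lemma flat_bound: "\<bar>flat m r\<bar> \<le> fact (Suc m) * \<bar>r\<bar>"
proof (cases "r > 0")
  case True
  define t where "t = 1 / r"
  have t: "t > 0" using True by (simp add: t_def)
  have "t ^ Suc m / fact (Suc m) \<le> exp t"
    unfolding exp_def
    using sum_le_suminf[OF summable_exp_generic[of t], of "{Suc m}"] t by (simp add: field_simps del: fact_Suc)
  then have "t ^ m * exp (- t) \<le> fact (Suc m) / t"
    using t by (simp add: exp_minus field_simps del: fact_Suc)
  then show ?thesis using True by (simp add: flat_def t_def abs_mult del: fact_Suc)
next
  case False
  have "(0::real) \<le> fact (Suc m) * \<bar>r\<bar>" by (intro mult_nonneg_nonneg) auto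
  then show ?thesis using False by (simp add: flat_def del: fact_Suc)
qed

lemma flat_deriv: "(flat m has_real_derivative flat (m + 2) r - real m * flat (m + 1) r) (at r)"
proof (cases r "0::real" rule: linorder_cases)
  case less
  have "((\<lambda>_. 0) has_real_derivative 0) (at r)" by simp
  moreover have "eventually (\<lambda>x. flat m x = 0) (nhds r)"
    using eventually_nhds_in_open[of "{..<0}" r] less by (auto elim!: eventually_mono simp: flat_def)
  ultimately have "(flat m has_real_derivative 0) (at r)"
    by (subst DERIV_cong_ev[OF refl _ refl]) auto
  then show ?thesis using less by (simp add: flat_def)
next
  case equal
  have "(\<lambda>y. (flat m y - flat m 0) / (y - 0)) \<midarrow>0\<rightarrow> 0"
  proof (rule Lim_null_comparison)
    show "\<forall>\<^sub>F y in at 0. norm ((flat m y - flat m 0) / (y - 0)) \<le> fact (Suc (Suc m)) * \<bar>y\<bar>"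
    proof (rule always_eventually, rule allI)
      fix y
      \<comment> \<open>The difference quotient at 0 is the next member of the family, which
        \<open>flat_bound\<close> sends to 0. At y = 0 both sides are 0.\<close>
      have "(flat m y - flat m 0) / (y - 0) = flat (Suc m) y" by (simp add: flat_def)
      then show "norm ((flat m y - flat m 0) / (y - 0)) \<le> fact (Suc (Suc m)) * \<bar>y\<bar>"
        using flat_bound[of "Suc m" y] by simp
    qed
    show "(\<lambda>y::real. fact (Suc (Suc m)) * \<bar>y\<bar>) \<midarrow>0\<rightarrow> 0" by (auto intro!: tendsto_eq_intros)
  qed
  then show ?thesis using equal by (simp add: has_field_derivative_iff flat_def)
next
  case greater
  have "((\<lambda>r. (1 / r) ^ m * exp (- 1 / r)) has_real_derivative flat (m + 2) r - real m * flat (m + 1) r) (at r)"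
    using greater
    by (auto intro!: derivative_eq_intros simp: flat_def)
       (cases m; auto simp: field_simps power2_eq_square)
  moreover have "eventually (\<lambda>x. flat m x = (1 / x) ^ m * exp (- 1 / x)) (nhds r)"
    using eventually_nhds_in_open[of "{0<..}" r] greater by (auto elim!: eventually_mono simp: flat_def)
  ultimately show ?thesis by (subst DERIV_cong_ev[OF refl _ refl]) auto
qed

text \<open>A class built to be stable under partial differentiation: the derivative of a flat
  profile of 1 - |x|^2 is a coordinate times a combination of such profiles. Differentiability of
  every order then follows by induction, with no formula for higher derivatives.\<close>

inductive bumpy :: "(real^'n \<Rightarrow> complex) \<Rightarrow> bool" where
  bumpy_flat: "bumpy (\<lambda>x. of_real (flat m (1 - (norm x)\<^sup>2)))"
| bumpy_coord: "bumpy f \<Longrightarrow> bumpy (\<lambda>x. of_real (x $ i) * f x)"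
| bumpy_scale: "bumpy f \<Longrightarrow> bumpy (\<lambda>x. c * f x)"
| bumpy_add: "bumpy f \<Longrightarrow> bumpy g \<Longrightarrow> bumpy (\<lambda>x. f x + g x)"

lemma bumpy_derivative:
  "bumpy f \<Longrightarrow> \<exists>D. (\<forall>x. (f has_derivative D x) (at x)) \<and> (\<forall>i. bumpy (\<lambda>x. D x (axis i 1)))"
proof (induction rule: bumpy.induct)
  case (bumpy_flat m)
  let ?r = "\<lambda>x::real^'n. 1 - (norm x)\<^sup>2"
  let ?c = "\<lambda>x. flat (m + 2) (?r x) - real m * flat (m + 1) (?r x)"
  have "((\<lambda>x. complex_of_real (flat m (?r x))) has_derivative (\<lambda>h. of_real (?c x * (- 2 * (x \<bullet> h))))) (at x)" for x
  proof -
    have "(?r has_derivative (\<lambda>h. - 2 * (x \<bullet> h))) (at x)"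
      unfolding power2_norm_eq_inner by (auto intro!: derivative_eq_intros simp: inner_commute)
    from has_derivative_compose[OF this flat_deriv[THEN has_field_derivative_imp_has_derivative]]
    show ?thesis by (intro has_derivative_of_real) 
  qed
  moreover have "bumpy (\<lambda>x. of_real (?c x * (- 2 * (x \<bullet> axis i 1))))" for i
  proof -
    have eq: "(\<lambda>x. complex_of_real (?c x * (- 2 * (x \<bullet> axis i 1))))
      = (\<lambda>x. of_real (x $ i) * (- 2 * of_real (flat (m + 2) (?r x)) + 2 * of_real (real m) * of_real (flat (m + 1) (?r x))))"
      by (simp add: fun_eq_iff inner_axis algebra_simps)
    show ?thesis unfolding eq by (intro bumpy.intros)
  qed
  ultimately show ?case by (intro exI[of _ "\<lambda>x h. of_real (?c x * (- 2 * (x \<bullet> h)))"]) auto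
next
  case (bumpy_coord f i)
  then obtain D where D: "\<And>x. (f has_derivative D x) (at x)" "\<And>j. bumpy (\<lambda>x. D x (axis j 1))" by blast
  have "((\<lambda>x. of_real (x $ i) * f x) has_derivative (\<lambda>h. of_real (x $ i) * D x h + of_real (h $ i) * f x)) (at x)" for x
    by (intro has_derivative_mult D has_derivative_of_real bounded_linear_imp_has_derivative bounded_linear_vec_nth)
  moreover have "bumpy (\<lambda>x. of_real (x $ i) * D x (axis j 1) + of_real (axis j 1 $ i) * f x)" for j
    by (intro bumpy.intros D bumpy_coord.hyps)
  ultimately show ?case by (intro exI[of _ "\<lambda>x h. of_real (x $ i) * D x h + of_real (h $ i) * f x"]) auto
next
  case (bumpy_scale f c)
  then obtain D where D: "\<And>x. (f has_derivative D x) (at x)" "\<And>j. bumpy (\<lambda>x. D x (axis j 1))" by blast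
  have "((\<lambda>x. c * f x) has_derivative (\<lambda>h. c * D x h)) (at x)" for x
    by (intro has_derivative_mult_right D)
  moreover have "bumpy (\<lambda>x. c * D x (axis j 1))" for j by (intro bumpy.intros D)
  ultimately show ?case by (intro exI[of _ "\<lambda>x h. c * D x h"]) auto
next
  case (bumpy_add f g)
  then obtain D E where D: "\<And>x. (f has_derivative D x) (at x)" "\<And>j. bumpy (\<lambda>x. D x (axis j 1))"
    and E: "\<And>x. (g has_derivative E x) (at x)" "\<And>j. bumpy (\<lambda>x. E x (axis j 1))" by blast
  have "((\<lambda>x. f x + g x) has_derivative (\<lambda>h. D x h + E x h)) (at x)" for x
    by (intro has_derivative_add D E)
  moreover have "bumpy (\<lambda>x. D x (axis j 1) + E x (axis j 1))" for j by (intro bumpy.intros D E)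
  ultimately show ?case by (intro exI[of _ "\<lambda>x h. D x h + E x h"]) auto
qed

lemma bumpy_C_diff: "bumpy f \<Longrightarrow> C_diff k f"
proof (induction k arbitrary: f)
  case 0
  then obtain D where "\<And>x. (f has_derivative D x) (at x)" using bumpy_derivative by blast
  then show ?case by (auto intro!: continuous_at_imp_continuous_on has_derivative_continuous)
next
  case (Suc k)
  then obtain D where D: "\<And>x. (f has_derivative D x) (at x)" "\<And>i. bumpy (\<lambda>x. D x (axis i 1))"
    using bumpy_derivative by blast
  have "partial_derivative i f = (\<lambda>x. D x (axis i 1))" for i
    by (intro ext partial_derivative_eq D)
  then show ?case using D Suc.IH by (auto simp: differentiable_on_def differentiable_def intro: has_derivative_at_withinI)
qed

lemma bumpy_support: "bumpy f \<Longrightarrow> norm x > 1 \<Longrightarrow> f x = 0"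
proof (induction rule: bumpy.induct)
  case (bumpy_flat m)
  then have "1 < (norm x)\<^sup>2" by (simp add: one_less_power)
  then show ?case by (simp add: flat_def)
qed auto

lemma bumpy_test_function:
  assumes "bumpy f"
  shows "test_function f"
proof -
  have "{x. f x \<noteq> 0} \<subseteq> cball 0 1" using bumpy_support[OF assms] by (auto simp: not_less[symmetric])
  then have "bounded {x. f x \<noteq> 0}" by (rule bounded_subset[OF bounded_cball])
  then show ?thesis using bumpy_C_diff[OF assms] by (simp add: test_function_def compact_closure)
qed

definition odd_bump :: "'n \<Rightarrow> real^'n \<Rightarrow> complex" where
  "odd_bump i x = of_real (x $ i) * of_real (flat 0 (1 - (norm x)\<^sup>2))"

lemma odd_bump_test_function: "test_function (odd_bump i)"
  unfolding odd_bump_def[abs_def] by (intro bumpy_test_function bumpy.intros)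

lemma odd_bump_minus: "odd_bump i (- x) = - odd_bump i x"
  by (simp add: odd_bump_def)

lemma odd_bump_lower_bound:
  fixes i :: "'n::finite"
  assumes "0 < h" "h \<le> 1 / 2"
  shows "Re (odd_bump i (axis i h)) \<ge> exp (- 2) * h"
proof -
  have h: "h\<^sup>2 \<le> (1 / 2)\<^sup>2" using assms by (intro power_mono) auto
  \<comment> \<open>The crude bound 1/2 is the origin of the constant
    \<open>exp (- 2)\<close>.\<close>
  then have h2: "1 - h\<^sup>2 \<ge> 1 / 2" by (simp add: power2_eq_square)
  have "1 / (1 - h\<^sup>2) \<le> 1 / (1 / 2)" by (rule divide_left_mono) (use h2 in auto)
  then have "exp (- 2) \<le> exp (- 1 / (1 - h\<^sup>2))" by simp
  moreover have "Re (odd_bump i (axis i h)) = h * exp (- 1 / (1 - h\<^sup>2))"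
  proof -
    have "(norm (axis i h :: real^'n))\<^sup>2 = h\<^sup>2"
      unfolding power2_norm_eq_inner by (simp add: inner_axis_axis power2_eq_square)
    then show ?thesis using h2 by (simp add: odd_bump_def flat_def)
  qed
  ultimately show ?thesis using assms by (simp add: mult.commute)
qed

section \<open>Solutions on the Fourier side\<close>

definition power_nl :: "real \<Rightarrow> complex \<Rightarrow> complex" where
  "power_nl \<alpha> z = of_real (cmod z powr \<alpha>) * z"

lemma power_nl_minus: "power_nl \<alpha> (- z) = - power_nl \<alpha> z"
  by (simp add: power_nl_def)

lemma power_nl_0 [simp]: "power_nl \<alpha> 0 = 0"
  by (simp add: power_nl_def)

lemma power_nl_scale:
  assumes "c > 0"
  shows "power_nl \<alpha> (of_real c * z) = of_real (c powr (1 + \<alpha>)) * power_nl \<alpha> z"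
  using assms by (simp add: power_nl_def norm_mult powr_mult powr_add)

text \<open>For |b| at most |a|, split the difference as |a|^alpha (a - b) plus (|a|^alpha -
  |b|^alpha) b. The exponent below 1 bounds the second term by the same quantity as the first, hence
  the factor 2.\<close>

lemma power_nl_Lipschitz:
  assumes \<alpha>: "0 < \<alpha>" "\<alpha> < 1" and "cmod a \<le> M" "cmod b \<le> M"
  shows "cmod (power_nl \<alpha> a - power_nl \<alpha> b) \<le> 2 * M powr \<alpha> * cmod (a - b)"
proof -
  have main: "cmod (power_nl \<alpha> a - power_nl \<alpha> b) \<le> 2 * M powr \<alpha> * cmod (a - b)"
    if le: "cmod b \<le> cmod a" and a: "cmod a \<le> M" for a b
  proof (cases "a = 0")
    case False
    define x where "x = cmod a"
    define y where "y = cmod b"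
    have xy: "0 < x" "0 \<le> y" "y \<le> x" using False le by (auto simp: x_def y_def)
    \<comment> \<open>A number in [0,1] is at most its power with exponent below 1; after rescaling
      this bounds y^alpha from below by x^(alpha - 1) y.\<close>
    have "y / x \<le> (y / x) powr \<alpha>"
    proof (cases "y = 0")
      case False
      then have "(y / x) powr 1 \<le> (y / x) powr \<alpha>" using xy \<alpha> by (intro powr_mono') auto
      then show ?thesis using False xy by simp
    qed simp
    then have "x powr \<alpha> * (y / x) \<le> x powr \<alpha> * (y powr \<alpha> / x powr \<alpha>)"
      using xy by (intro mult_left_mono) (auto simp: powr_divide)
    then have r: "x powr \<alpha> * (y / x) \<le> y powr \<alpha>" using xy by simp
    have "(x powr \<alpha> - y powr \<alpha>) * y \<le> (x powr \<alpha> - x powr \<alpha> * (y / x)) * y"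
      using r xy by (intro mult_right_mono) auto
    also have "\<dots> = x powr \<alpha> * (x - y) * (y / x)" using xy by (simp add: field_simps)
    also have "\<dots> \<le> x powr \<alpha> * (x - y)" using xy by (intro mult_left_le) auto
    also have "\<dots> \<le> x powr \<alpha> * cmod (a - b)"
      unfolding x_def y_def by (intro mult_left_mono norm_triangle_ineq2) auto
    finally have d: "(x powr \<alpha> - y powr \<alpha>) * y \<le> x powr \<alpha> * cmod (a - b)" .
    have "power_nl \<alpha> a - power_nl \<alpha> b = of_real (x powr \<alpha>) * (a - b) + of_real (x powr \<alpha> - y powr \<alpha>) * b"
      by (simp add: power_nl_def x_def y_def algebra_simps)
    also have "cmod \<dots> \<le> x powr \<alpha> * cmod (a - b) + (x powr \<alpha> - y powr \<alpha>) * y"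
    proof -
      have "y powr \<alpha> \<le> x powr \<alpha>" using xy \<alpha> by (intro powr_mono2) auto
      then show ?thesis
        by (intro order_trans[OF norm_triangle_ineq]) (simp add: norm_mult y_def del: of_real_diff)
    qed
    also have "\<dots> \<le> 2 * (x powr \<alpha> * cmod (a - b))" using d by linarith
    also have "\<dots> \<le> 2 * (M powr \<alpha> * cmod (a - b))"
      using a xy \<alpha> by (intro mult_left_mono mult_right_mono powr_mono2) (auto simp: x_def)
    finally show ?thesis by simp
  qed (use le in simp)
  show ?thesis
  proof (cases "cmod b \<le> cmod a")
    case True
    then show ?thesis using main assms by blast
  next
    case False
    then show ?thesis using main[of a b] main[of b a] assms by (simp add: norm_minus_commute)
  qed
qed

lemma continuous_power_nl:
  assumes "0 < \<alpha>" "continuous_on S f"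
  shows "continuous_on S (\<lambda>x. power_nl \<alpha> (f x))"
  unfolding power_nl_def using assms
  by (intro continuous_on_mult continuous_on_of_real continuous_on_powr' continuous_on_norm continuous_on_const) auto

lemma wiener_diff:
  assumes "wiener m f" "wiener m g"
  shows "wiener m (\<lambda>\<xi>. f \<xi> - g \<xi>)"
  using assms unfolding wiener_def by (auto simp: right_diff_distrib)

lemma wiener_add:
  assumes "wiener m f" "wiener m g"
  shows "wiener m (\<lambda>\<xi>. f \<xi> + g \<xi>)"
  using assms unfolding wiener_def by (auto simp: distrib_left)

lemma wiener_norm_nonneg [simp]: "0 \<le> wiener_norm m g"
  by (simp add: wiener_norm_def integral_nonneg_AE)

text \<open>The L1 distance of the transforms controls the change in time uniformly in space, so
  only spatial continuity at the fixed time remains to be added.\<close>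

lemma continuous_FT_path:
  fixes K :: "real \<Rightarrow> 'a::euclidean_space \<Rightarrow> complex"
  assumes K: "\<And>t. t \<in> S \<Longrightarrow> wiener 0 (K t)"
    and lim: "\<And>t. t \<in> S \<Longrightarrow> ((\<lambda>r. wiener_norm 0 (\<lambda>\<xi>. K r \<xi> - K t \<xi>)) \<longlongrightarrow> 0) (at t within S)"
  shows "continuous_on (S \<times> UNIV) (\<lambda>p. FT 1 (K (fst p)) (snd p))"
  unfolding continuous_on_def
proof
  fix p :: "real \<times> 'a" assume "p \<in> S \<times> UNIV"
  then obtain t x where p: "p = (t, x)" "t \<in> S" by auto
  let ?F = "at p within S \<times> UNIV"
  have i: "integrable lborel (K t)" if "t \<in> S" for t using K[OF that] by (rule wiener_integrable) simp
  have 1: "((\<lambda>q. wiener_norm 0 (\<lambda>\<xi>. K (fst q) \<xi> - K t \<xi>)) \<longlongrightarrow> 0) ?F"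
  proof -
    have "continuous (at t within S) (\<lambda>r. wiener_norm 0 (\<lambda>\<xi>. K r \<xi> - K t \<xi>))"
      unfolding continuous_within using lim[OF p(2)] by (simp add: wiener_norm_def)
    moreover have "\<forall>\<^sub>F q in ?F. fst q \<in> S" by (auto simp: eventually_at_filter intro!: always_eventually)
    moreover have "(fst \<longlongrightarrow> t) ?F" using p by (auto intro!: tendsto_eq_intros)
    ultimately have "((\<lambda>q. wiener_norm 0 (\<lambda>\<xi>. K (fst q) \<xi> - K t \<xi>)) \<longlongrightarrow> wiener_norm 0 (\<lambda>\<xi>. K t \<xi> - K t \<xi>)) ?F"
      by (rule continuous_within_tendsto_compose)
    then show ?thesis by (simp add: wiener_norm_def)
  qed
  have "((\<lambda>q. FT 1 (K t) (snd q)) \<longlongrightarrow> FT 1 (K t) x) ?F"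
    by (rule continuous_on_tendsto_compose[OF FT_continuous[OF i[OF p(2)]]])
       (use p in \<open>auto intro!: tendsto_eq_intros\<close>)
  then have 2: "((\<lambda>q. cmod (FT 1 (K t) (snd q) - FT 1 (K t) x)) \<longlongrightarrow> 0) ?F"
    by (simp add: tendsto_norm_zero LIM_zero)
  have "((\<lambda>q. FT 1 (K (fst q)) (snd q) - FT 1 (K t) x) \<longlongrightarrow> 0) ?F"
  proof (rule Lim_null_comparison[OF _ tendsto_add[OF 1 2, simplified]])
    have "\<forall>\<^sub>F q in ?F. q \<in> S \<times> UNIV" by (auto simp: eventually_at_filter)
    then show "\<forall>\<^sub>F q in ?F. norm (FT 1 (K (fst q)) (snd q) - FT 1 (K t) x)
      \<le> wiener_norm 0 (\<lambda>\<xi>. K (fst q) \<xi> - K t \<xi>) + cmod (FT 1 (K t) (snd q) - FT 1 (K t) x)"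
    proof eventually_elim
      fix q assume "q \<in> S \<times> (UNIV :: 'a set)"
      then have q: "fst q \<in> S" by auto
      have "cmod (FT 1 (K (fst q)) (snd q) - FT 1 (K t) (snd q)) \<le> wiener_norm 0 (\<lambda>\<xi>. K (fst q) \<xi> - K t \<xi>)"
        unfolding FT_diff[OF i[OF q] i[OF p(2)], symmetric]
        by (rule FT_wiener_bound[OF wiener_diff[OF K[OF q] K[OF p(2)]]]) simp
      then show "norm (FT 1 (K (fst q)) (snd q) - FT 1 (K t) x)
        \<le> wiener_norm 0 (\<lambda>\<xi>. K (fst q) \<xi> - K t \<xi>) + cmod (FT 1 (K t) (snd q) - FT 1 (K t) x)"
        using norm_triangle_ineq[of "FT 1 (K (fst q)) (snd q) - FT 1 (K t) (snd q)" "FT 1 (K t) (snd q) - FT 1 (K t) x"]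
        by simp
    qed
  qed
  then show "((\<lambda>q. FT 1 (K (fst q)) (snd q)) \<longlongrightarrow> FT 1 (K (fst p)) (snd p)) ?F"
    using p by (simp add: LIM_zero_cancel)
qed

text \<open>The hypothetical solution together with its Fourier side \<open>G\<close> and a spare
  exponent \<open>b\<close> strictly between \<open>\<alpha>\<close> and the smaller of 1 and s - 3
  - N/2. The equation is solved for the time derivative.\<close>

locale nls_path =
  fixes \<alpha> s b T :: real and lam :: complex
    and u :: "real \<Rightarrow> real^'n \<Rightarrow> complex" and G :: "real \<Rightarrow> real^'n \<Rightarrow> complex"
  assumes \<alpha>: "0 < \<alpha>" "\<alpha> < 1" and b: "\<alpha> < b" "b < 1" "3 + b < s - real CARD('n) / 2"
    and T: "0 < T" and lam: "lam \<noteq> 0"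
    and Gm: "t \<in> {0..T} \<Longrightarrow> G t \<in> borel_measurable borel"
    and Gs: "t \<in> {0..T} \<Longrightarrow> square_integrable (\<lambda>\<xi>. of_real (japanese s \<xi>) * G t \<xi>)"
    and uG: "t \<in> {0..T} \<Longrightarrow> u t = FT 1 (G t)"
    and Gc: "t \<in> {0..T} \<Longrightarrow>
      ((\<lambda>r. L2_norm (\<lambda>\<xi>. of_real (japanese s \<xi>) * (G r \<xi> - G t \<xi>))) \<longlongrightarrow> 0) (at t within {0..T})"
    and deriv: "t \<in> {0..T} \<Longrightarrow> ((\<lambda>r. u r x) has_vector_derivative
      - \<i> * (laplacian (u t) x + lam * power_nl \<alpha> (u t x))) (at t within {0..T})"
begin

lemma G_wiener:
  assumes t: "t \<in> {0..T}"
  shows "wiener (3 + b) (G t)"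
  using weighted_L1_le_L2(1)[OF b(3) Gm[OF t] Gs[OF t]] Gm[OF t] by (simp add: wiener_def)

lemma wiener_norm_tendsto:
  assumes t: "t \<in> {0..T}"
  shows "((\<lambda>r. wiener_norm (3 + b) (\<lambda>\<xi>. G r \<xi> - G t \<xi>)) \<longlongrightarrow> 0) (at t within {0..T})"
proof (rule Lim_null_comparison)
  let ?C = "L2_norm (\<lambda>\<xi>::real^'n. of_real (japanese (3 + b - s) \<xi>))"
  show "((\<lambda>r. ?C * L2_norm (\<lambda>\<xi>. of_real (japanese s \<xi>) * (G r \<xi> - G t \<xi>))) \<longlongrightarrow> 0) (at t within {0..T})"
    using tendsto_mult_left[OF Gc[OF t], of ?C] by simp
  have "\<forall>\<^sub>F r in at t within {0..T}. r \<in> {0..T}" by (auto simp: eventually_at_filter)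
  then show "\<forall>\<^sub>F r in at t within {0..T}. norm (wiener_norm (3 + b) (\<lambda>\<xi>. G r \<xi> - G t \<xi>))
      \<le> ?C * L2_norm (\<lambda>\<xi>. of_real (japanese s \<xi>) * (G r \<xi> - G t \<xi>))"
  proof eventually_elim
    fix r assume r: "r \<in> {0..T}"
    have "square_integrable (\<lambda>\<xi>. of_real (japanese s \<xi>) * (G r \<xi> - G t \<xi>))"
      using square_integrable_diff(1)[OF Gs[OF r] Gs[OF t]] by (simp add: right_diff_distrib)
    from weighted_L1_le_L2(2)[OF b(3) _ this] Gm[OF r] Gm[OF t]
    show "norm (wiener_norm (3 + b) (\<lambda>\<xi>. G r \<xi> - G t \<xi>))
      \<le> ?C * L2_norm (\<lambda>\<xi>. of_real (japanese s \<xi>) * (G r \<xi> - G t \<xi>))"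
      by (simp add: wiener_norm_def[symmetric])
  qed
qed

text \<open>Continuity of the path on a compact time interval. A common bound \<open>M\<close> for
  both norms keeps the later constants simple.\<close>

lemma sobolev_bounded:
  obtains M where "M > 0" "\<And>t. t \<in> {0..T} \<Longrightarrow> L2_norm (\<lambda>\<xi>. of_real (japanese s \<xi>) * G t \<xi>) \<le> M"
    "\<And>t. t \<in> {0..T} \<Longrightarrow> wiener_norm (3 + b) (G t) \<le> M"
proof -
  let ?H = "\<lambda>t. L2_norm (\<lambda>\<xi>. of_real (japanese s \<xi>) * G t \<xi>)"
  let ?C = "L2_norm (\<lambda>\<xi>::real^'n. of_real (japanese (3 + b - s) \<xi>))"
  have "continuous_on {0..T} ?H"
    unfolding continuous_on_def
  proof
    fix t assume t: "t \<in> {0..T}"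
    show "(?H \<longlongrightarrow> ?H t) (at t within {0..T})"
    proof (rule LIM_zero_cancel, rule Lim_null_comparison[OF _ Gc[OF t]])
      have "\<forall>\<^sub>F r in at t within {0..T}. r \<in> {0..T}" by (auto simp: eventually_at_filter)
      then show "\<forall>\<^sub>F r in at t within {0..T}. norm (?H r - ?H t) \<le> L2_norm (\<lambda>\<xi>. of_real (japanese s \<xi>) * (G r \<xi> - G t \<xi>))"
      proof eventually_elim
        fix r assume r: "r \<in> {0..T}"
        show "norm (?H r - ?H t) \<le> L2_norm (\<lambda>\<xi>. of_real (japanese s \<xi>) * (G r \<xi> - G t \<xi>))"
          using L2_norm_diff_ge[OF Gs[OF r] Gs[OF t]] by (simp add: right_diff_distrib)
      qed
    qed
  qed
  then have "bounded (?H ` {0..T})" by (intro compact_imp_bounded compact_continuous_image) auto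
  then obtain B where B: "\<forall>t\<in>{0..T}. ?H t \<le> B" by (auto simp: bounded_iff)
  have "wiener_norm (3 + b) (G t) \<le> ?C * B" if t: "t \<in> {0..T}" for t
  proof -
    have "wiener_norm (3 + b) (G t) \<le> ?C * ?H t"
      using weighted_L1_le_L2(2)[OF b(3) Gm[OF t] Gs[OF t]] by (simp add: wiener_norm_def)
    also have "\<dots> \<le> ?C * B" using B t by (intro mult_left_mono) auto
    finally show ?thesis .
  qed
  with B show thesis
    by (intro that[of "max 1 (max B (?C * B))"]) (auto simp: le_max_iff_disj)
qed

definition lap :: "real \<Rightarrow> real^'n \<Rightarrow> complex" where
  "lap t = FT 1 (\<lambda>\<xi>. - of_real ((norm \<xi>)\<^sup>2) * G t \<xi>)"

lemma laplacian_u: "t \<in> {0..T} \<Longrightarrow> laplacian (u t) = lap t"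
  unfolding lap_def uG using b \<alpha> by (intro laplacian_FT wiener_mono(1)[OF G_wiener]) auto

lemma lap_wiener:
  assumes "t \<in> {0..T}"
  shows "wiener (1 + b) (\<lambda>\<xi>. - of_real ((norm \<xi>)\<^sup>2) * G t \<xi>)"
    "wiener_norm (1 + b) (\<lambda>\<xi>. - of_real ((norm \<xi>)\<^sup>2) * G t \<xi>) \<le> wiener_norm (3 + b) (G t)"
  using wiener_neg_sq[of "1 + b" "G t"] G_wiener[OF assms] by (simp_all add: add_ac)

text \<open>Joint continuity, and not just continuity in each variable, gives the measurability on
  the product space that Fubini requires in the energy estimate.\<close>

lemma u_continuous: "continuous_on ({0..T} \<times> UNIV) (\<lambda>p. u (fst p) (snd p))"
proof -
  have "continuous_on ({0..T} \<times> UNIV) (\<lambda>p. FT 1 (G (fst p)) (snd p))"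
  proof (rule continuous_FT_path)
    fix t assume t: "t \<in> {0..T}"
    show "wiener 0 (G t)" using b \<alpha> by (intro wiener_mono(1)[OF G_wiener[OF t]]) auto
    show "((\<lambda>r. wiener_norm 0 (\<lambda>\<xi>. G r \<xi> - G t \<xi>)) \<longlongrightarrow> 0) (at t within {0..T})"
    proof (rule Lim_null_comparison[OF _ wiener_norm_tendsto[OF t]])
      have "\<forall>\<^sub>F r in at t within {0..T}. r \<in> {0..T}" by (auto simp: eventually_at_filter)
      then show "\<forall>\<^sub>F r in at t within {0..T}. norm (wiener_norm 0 (\<lambda>\<xi>. G r \<xi> - G t \<xi>)) \<le> wiener_norm (3 + b) (\<lambda>\<xi>. G r \<xi> - G t \<xi>)"
        by eventually_elim (use b \<alpha> wiener_mono(2)[OF wiener_diff[OF G_wiener G_wiener[OF t]], of _ 0] in auto)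
    qed
  qed
  then show ?thesis by (rule continuous_on_eq) (auto simp: uG)
qed

lemma lap_continuous: "continuous_on ({0..T} \<times> UNIV) (\<lambda>p. lap (fst p) (snd p))"
  unfolding lap_def
proof (rule continuous_FT_path)
  fix t assume t: "t \<in> {0..T}"
  show "wiener 0 (\<lambda>\<xi>. - of_real ((norm \<xi>)\<^sup>2) * G t \<xi>)" using b \<alpha> by (intro wiener_mono(1)[OF lap_wiener(1)[OF t]]) auto
  show "((\<lambda>r. wiener_norm 0 (\<lambda>\<xi>. - of_real ((norm \<xi>)\<^sup>2) * G r \<xi> - - of_real ((norm \<xi>)\<^sup>2) * G t \<xi>)) \<longlongrightarrow> 0) (at t within {0..T})"
  proof (rule Lim_null_comparison[OF _ wiener_norm_tendsto[OF t]])
    have "\<forall>\<^sub>F r in at t within {0..T}. r \<in> {0..T}" by (auto simp: eventually_at_filter)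
    then show "\<forall>\<^sub>F r in at t within {0..T}. norm (wiener_norm 0 (\<lambda>\<xi>. - of_real ((norm \<xi>)\<^sup>2) * G r \<xi> - - of_real ((norm \<xi>)\<^sup>2) * G t \<xi>))
      \<le> wiener_norm (3 + b) (\<lambda>\<xi>. G r \<xi> - G t \<xi>)"
    proof eventually_elim
      fix r assume r: "r \<in> {0..T}"
      have d: "wiener (3 + b) (\<lambda>\<xi>. G r \<xi> - G t \<xi>)" by (intro wiener_diff G_wiener r t)
      have d2: "wiener (0 + 2) (\<lambda>\<xi>. G r \<xi> - G t \<xi>)" using b \<alpha> by (intro wiener_mono(1)[OF d]) auto
      have "wiener_norm 0 (\<lambda>\<xi>. - of_real ((norm \<xi>)\<^sup>2) * (G r \<xi> - G t \<xi>)) \<le> wiener_norm (0 + 2) (\<lambda>\<xi>. G r \<xi> - G t \<xi>)"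
        by (rule wiener_neg_sq(2)[OF d2])
      also have "\<dots> \<le> wiener_norm (3 + b) (\<lambda>\<xi>. G r \<xi> - G t \<xi>)"
        using b \<alpha> by (intro wiener_mono(2)[OF d]) auto
      finally show "norm (wiener_norm 0 (\<lambda>\<xi>. - of_real ((norm \<xi>)\<^sup>2) * G r \<xi> - - of_real ((norm \<xi>)\<^sup>2) * G t \<xi>))
        \<le> wiener_norm (3 + b) (\<lambda>\<xi>. G r \<xi> - G t \<xi>)"
        by (simp add: right_diff_distrib)
    qed
  qed
qed

lemma u_continuous_t: "continuous_on {0..T} (\<lambda>t. u t x)"
proof -
  have "continuous_on {0..T} (\<lambda>t. (t, x))" by (intro continuous_intros)
  from continuous_on_compose2[OF u_continuous this] show ?thesis by auto
qed

lemma lap_continuous_t: "continuous_on {0..T} (\<lambda>t. lap t x)"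
proof -
  have "continuous_on {0..T} (\<lambda>t. (t, x))" by (intro continuous_intros)
  from continuous_on_compose2[OF lap_continuous this] show ?thesis by auto
qed

end

section \<open>Persistence of oddness\<close>

lemma FT_uminus:
  fixes g :: "'a::euclidean_space \<Rightarrow> complex"
  assumes "g \<in> borel_measurable borel"
  shows "FT s g (- x) = FT s (\<lambda>\<xi>. g (- \<xi>)) x"
proof -
  have "(\<lambda>\<xi>. cis (s * (\<xi> \<bullet> (- x))) * g \<xi>) \<in> borel_measurable borel" using assms by measurable
  from integral_lborel_uminus[OF this] show ?thesis by (simp add: FT_def)
qed

lemma FT_add:
  assumes "integrable lborel f" "integrable lborel g"
  shows "FT s (\<lambda>x. f x + g x) \<xi> = FT s f \<xi> + FT s g \<xi>"
  unfolding FT_def using FT_integrable[OF assms(1)] FT_integrable[OF assms(2)]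
  by (simp add: distrib_left)

lemma japanese_minus [simp]: "japanese m (- \<xi>) = japanese m \<xi>"
  by (simp add: japanese_def)

lemma wiener_uminus:
  assumes "wiener m g"
  shows "wiener m (\<lambda>\<xi>. g (- \<xi>))"
proof -
  have [measurable]: "g \<in> borel_measurable borel" using assms by (simp add: wiener_def)
  then have "(\<lambda>\<xi>. g (- \<xi>)) \<in> borel_measurable borel" by measurable
  then show ?thesis
    using integrable_lborel_affine[of "\<lambda>\<xi>. of_real (japanese m \<xi>) * g \<xi>" "-1" 0] assms by (simp add: wiener_def)
qed

lemma square_integrable_uminus:
  fixes g :: "real^'n \<Rightarrow> complex"
  assumes "square_integrable g" "g \<in> borel_measurable borel"
  shows "square_integrable (\<lambda>x. g (- x))"
proof -
  note [measurable] = assms(2)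
  have "(\<lambda>x. g (- x)) \<in> borel_measurable borel" by measurable
  then show ?thesis
    using integrable_lborel_affine[of "\<lambda>x. (cmod (g x))\<^sup>2" "-1" 0] assms by (simp add: square_integrable_borel_iff)
qed

context nls_path
begin

definition even_part :: "real \<Rightarrow> real^'n \<Rightarrow> complex" where
  "even_part t x = u t x + u t (- x)"

definition even_lap :: "real \<Rightarrow> real^'n \<Rightarrow> complex" where
  "even_lap t x = lap t x + lap t (- x)"

definition even_nl :: "real \<Rightarrow> real^'n \<Rightarrow> complex" where
  "even_nl t x = power_nl \<alpha> (u t x) + power_nl \<alpha> (u t (- x))"

definition even_G :: "real \<Rightarrow> real^'n \<Rightarrow> complex" where
  "even_G t \<xi> = G t \<xi> + G t (- \<xi>)"

definition even_LG :: "real \<Rightarrow> real^'n \<Rightarrow> complex" where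
  "even_LG t \<xi> = - of_real ((norm \<xi>)\<^sup>2) * even_G t \<xi>"

lemma even_G_wiener:
  assumes t: "t \<in> {0..T}"
  shows "wiener (3 + b) (even_G t)" "integrable lborel (even_G t)" "integrable lborel (even_LG t)"
proof -
  show w: "wiener (3 + b) (even_G t)"
    unfolding even_G_def[abs_def] by (intro wiener_add wiener_uminus G_wiener t)
  show "integrable lborel (even_G t)" using b \<alpha> by (intro wiener_integrable[OF w]) auto
  have "wiener (1 + b + 2) (even_G t)" using w by (simp add: add_ac)
  from wiener_neg_sq(1)[OF this] show "integrable lborel (even_LG t)"
    unfolding even_LG_def[abs_def] by (rule wiener_integrable) (use b \<alpha> in auto)
qed

lemma even_part_FT: "t \<in> {0..T} \<Longrightarrow> even_part t = FT 1 (even_G t)"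
proof
  fix x assume t: "t \<in> {0..T}"
  have i: "integrable lborel (G t)" "integrable lborel (\<lambda>\<xi>. G t (- \<xi>))"
    using b \<alpha> wiener_integrable[OF G_wiener[OF t]] wiener_integrable[OF wiener_uminus[OF G_wiener[OF t]]] by auto
  show "even_part t x = FT 1 (even_G t) x"
    unfolding even_part_def even_G_def[abs_def] FT_add[OF i] by (simp add: uG[OF t] FT_uminus[OF Gm[OF t]])
qed

lemma even_lap_FT: "t \<in> {0..T} \<Longrightarrow> even_lap t = FT 1 (even_LG t)"
proof
  fix x assume t: "t \<in> {0..T}"
  let ?g = "\<lambda>\<xi>. - of_real ((norm \<xi>)\<^sup>2) * G t \<xi>"
  note w = lap_wiener(1)[OF t]
  have i: "integrable lborel ?g" "integrable lborel (\<lambda>\<xi>. ?g (- \<xi>))"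
    using b \<alpha> wiener_integrable[OF w] wiener_integrable[OF wiener_uminus[OF w]] by auto
  have e: "even_LG t = (\<lambda>\<xi>. ?g \<xi> + ?g (- \<xi>))"
    by (simp add: fun_eq_iff even_LG_def even_G_def distrib_left)
  have m: "?g \<in> borel_measurable borel" using w by (simp add: wiener_def)
  show "even_lap t x = FT 1 (even_LG t) x"
    unfolding even_lap_def e FT_add[OF i] by (simp only: lap_def FT_uminus[OF m])
qed

text \<open>As s is at least 2, the Sobolev weight dominates both 1 and the symbol of the Laplacian;
  reflection preserves the norm, whence the factor 2.\<close>

lemma even_G_square_integrable:
  assumes t: "t \<in> {0..T}" and M: "L2_norm (\<lambda>\<xi>. of_real (japanese s \<xi>) * G t \<xi>) \<le> M"
  shows "square_integrable (even_G t)" "L2_norm (even_G t) \<le> 2 * M"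
    "square_integrable (even_LG t)" "L2_norm (even_LG t) \<le> 2 * M"
proof -
  let ?h = "\<lambda>\<xi>. of_real (japanese s \<xi>) * G t \<xi>"
  have m: "?h \<in> borel_measurable borel" using Gm[OF t] by measurable
  have e: "(\<lambda>\<xi>. of_real (japanese s \<xi>) * even_G t \<xi>) = (\<lambda>\<xi>. ?h \<xi> + ?h (- \<xi>))"
    by (simp add: fun_eq_iff even_G_def distrib_left)
  note r = square_integrable_uminus[OF Gs[OF t] m]
  have sq: "square_integrable (\<lambda>\<xi>. of_real (japanese s \<xi>) * even_G t \<xi>)"
    unfolding e by (rule square_integrable_add[OF Gs[OF t] r])
  have le: "L2_norm (\<lambda>\<xi>. of_real (japanese s \<xi>) * even_G t \<xi>) \<le> 2 * M"
    unfolding e using square_integrable_add(2)[OF Gs[OF t] r] L2_norm_uminus[OF Gs[OF t]] M by simp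
  have s: "0 \<le> s" "2 \<le> s" using b \<alpha> by (auto intro: order_trans[rotated, OF less_imp_le] simp: add_nonneg_nonneg)
  have mG: "even_G t \<in> borel_measurable borel" "even_LG t \<in> borel_measurable borel"
    using even_G_wiener[OF t] by auto
  have d1: "cmod (even_G t \<xi>) \<le> 1 * cmod (of_real (japanese s \<xi>) * even_G t \<xi>)" for \<xi>
    using mult_right_mono[OF japanese_ge_1[OF s(1), of \<xi>], of "cmod (even_G t \<xi>)"] by (simp add: norm_mult)
  have d2: "cmod (even_LG t \<xi>) \<le> 1 * cmod (of_real (japanese s \<xi>) * even_G t \<xi>)" for \<xi>
  proof -
    have "(norm \<xi>)\<^sup>2 \<le> japanese s \<xi>"
      using norm_power_le_japanese[of \<xi> 2] japanese_mono[OF s(2), of \<xi>] by simp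
    from mult_right_mono[OF this, of "cmod (even_G t \<xi>)"] show ?thesis
      by (simp add: norm_mult norm_power even_LG_def)
  qed
  note D1 = square_integrable_dominated[OF borel_imp_lebesgue[OF mG(1)] sq AE_I2[OF d1]]
  note D2 = square_integrable_dominated[OF borel_imp_lebesgue[OF mG(2)] sq AE_I2[OF d2]]
  show "square_integrable (even_G t)" "square_integrable (even_LG t)" using D1(1) D2(1) by auto
  show "L2_norm (even_G t) \<le> 2 * M" using D1(2) le by simp
  show "L2_norm (even_LG t) \<le> 2 * M" using D2(2) le by simp
qed

lemma even_square_integrable:
  assumes t: "t \<in> {0..T}"
  shows "square_integrable (even_part t)" "square_integrable (even_lap t)"
  unfolding even_part_FT[OF t] even_lap_FT[OF t]
  using even_G_wiener[OF t] even_G_square_integrable[OF t order_refl] FT_square_integrable(1) by blast+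

text \<open>Symmetry of the Laplacian, seen through Parseval: its Fourier multiplier is real, so the
  pairing is the integral of a real function up to a real factor.\<close>

lemma even_lap_symmetric:
  assumes t: "t \<in> {0..T}"
  shows "Im (\<integral>x. cnj (even_part t x) * even_lap t x \<partial>lebesgue) = 0"
proof -
  note i = even_G_wiener[OF t] and sq = even_G_square_integrable[OF t order_refl]
  have "cnj (even_G t \<xi>) * even_LG t \<xi> = of_real (- (norm \<xi>)\<^sup>2 * (cmod (even_G t \<xi>))\<^sup>2)" for \<xi>
    by (simp add: even_LG_def complex_norm_square[symmetric] mult_ac del: of_real_power)
  then have "(\<integral>\<xi>. cnj (even_G t \<xi>) * even_LG t \<xi> \<partial>lebesgue)
    = of_real (\<integral>\<xi>. - (norm \<xi>)\<^sup>2 * (cmod (even_G t \<xi>))\<^sup>2 \<partial>lebesgue)"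
    by (simp only: integral_complex_of_real)
  then show ?thesis
    unfolding even_part_FT[OF t] even_lap_FT[OF t]
    using Parseval[OF i(2) sq(1) i(3) sq(3), of 1] by simp
qed

lemma u_bound:
  assumes "t \<in> {0..T}" "wiener_norm (3 + b) (G t) \<le> M"
  shows "cmod (u t x) \<le> M"
  using FT_wiener_bound[OF G_wiener[OF assms(1)], of 1 x] b \<alpha> assms(2) uG[OF assms(1)] by simp

text \<open>Because the nonlinearity is odd, its even part is the difference of its values at u(x)
  and -u(-x), two points whose difference is \<open>even_part\<close>.\<close>

lemma even_nl_bound:
  assumes "t \<in> {0..T}" "wiener_norm (3 + b) (G t) \<le> M"
  shows "cmod (even_nl t x) \<le> 2 * M powr \<alpha> * cmod (even_part t x)"
  using power_nl_Lipschitz[OF \<alpha>, of "u t x" M "- u t (- x)"] u_bound[OF assms]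
  by (simp add: even_nl_def even_part_def power_nl_minus)

lemma u_reflected_continuous: "continuous_on ({0..T} \<times> UNIV) (\<lambda>p. u (fst p) (- snd p))"
proof -
  have "continuous_on ({0..T} \<times> UNIV) (\<lambda>p::real \<times> (real^'n). (fst p, - snd p))" by (intro continuous_intros)
  moreover have "(\<lambda>p::real \<times> (real^'n). (fst p, - snd p)) ` ({0..T} \<times> UNIV) \<subseteq> {0..T} \<times> UNIV" by auto
  ultimately show ?thesis using continuous_on_compose2[OF u_continuous] by fastforce
qed

lemma lap_reflected_continuous: "continuous_on ({0..T} \<times> UNIV) (\<lambda>p. lap (fst p) (- snd p))"
proof -
  have "continuous_on ({0..T} \<times> UNIV) (\<lambda>p::real \<times> (real^'n). (fst p, - snd p))" by (intro continuous_intros)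
  moreover have "(\<lambda>p::real \<times> (real^'n). (fst p, - snd p)) ` ({0..T} \<times> UNIV) \<subseteq> {0..T} \<times> UNIV" by auto
  ultimately show ?thesis using continuous_on_compose2[OF lap_continuous] by fastforce
qed

text \<open>The time derivative of the squared modulus of \<open>even_part\<close> at one point,
  with the equation already inserted.\<close>

definition energy_rate :: "real \<Rightarrow> real^'n \<Rightarrow> real" where
  "energy_rate t x = 2 * Re (cnj (even_part t x) * (- \<i> * (even_lap t x + lam * even_nl t x)))"

lemma energy_rate_continuous: "continuous_on ({0..T} \<times> UNIV) (\<lambda>p. energy_rate (fst p) (snd p))"
  unfolding energy_rate_def even_part_def even_lap_def even_nl_def
  by (intro continuous_intros continuous_power_nl \<alpha> u_continuous lap_continuous u_reflected_continuous lap_reflected_continuous)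

lemma even_nl_measurable: "t \<in> {0..T} \<Longrightarrow> even_nl t \<in> borel_measurable borel"
proof (rule borel_measurable_continuous_onI)
  assume t: "t \<in> {0..T}"
  have c: "continuous_on UNIV (u t)"
    unfolding uG[OF t] using b \<alpha> by (intro FT_continuous wiener_integrable[OF G_wiener[OF t]]) auto
  then have "continuous_on UNIV (\<lambda>x. u t (- x))"
    by (rule continuous_on_compose2) (auto intro!: continuous_intros)
  with c show "continuous_on UNIV (even_nl t)"
    unfolding even_nl_def[abs_def] by (intro continuous_intros continuous_power_nl \<alpha>)
qed

text \<open>Cauchy-Schwarz and the pointwise bound on \<open>even_nl\<close> control the nonlinear
  contribution by the energy itself. The bound on the absolute integral is uniform in time and
  serves Fubini; the last bound starts the iteration in \<open>odd_preserved\<close>.\<close>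

lemma energy_rate_integral:
  assumes t: "t \<in> {0..T}" and M: "wiener_norm (3 + b) (G t) \<le> M" "L2_norm (\<lambda>\<xi>. of_real (japanese s \<xi>) * G t \<xi>) \<le> M"
  defines "K \<equiv> gauss_const TYPE(real^'n)" and "k \<equiv> 4 * cmod lam * M powr \<alpha>"
  shows "integrable lborel (energy_rate t)"
    and "(\<integral>x. energy_rate t x \<partial>lborel) \<le> k * (L2_norm (even_part t))\<^sup>2"
    and "(\<integral>x. \<bar>energy_rate t x\<bar> \<partial>lborel) \<le> 2 * (K * (2 * M))\<^sup>2 + k * (K * (2 * M))\<^sup>2"
    and "(L2_norm (even_part t))\<^sup>2 \<le> (K * (2 * M))\<^sup>2"
proof -
  have K: "K > 0" by (simp add: K_def)
  note i = even_G_wiener[OF t] and sq = even_G_square_integrable[OF t M(2)]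
  note w = even_square_integrable(1)[OF t] and l = even_square_integrable(2)[OF t]
  let ?w = "even_part t" and ?l = "even_lap t" and ?n = "even_nl t"
  have nb: "cmod (?n x) \<le> (2 * M powr \<alpha>) * cmod (?w x)" for x by (rule even_nl_bound[OF t M(1)])
  have mm: "even_part t \<in> borel_measurable borel" "even_lap t \<in> borel_measurable borel" "even_nl t \<in> borel_measurable borel"
    using even_nl_measurable[OF t] FT_measurable[OF i(2)] FT_measurable[OF i(3)]
    by (simp_all add: even_part_FT[OF t] even_lap_FT[OF t])
  note [measurable] = mm
  note n = square_integrable_dominated[OF borel_imp_lebesgue[OF mm(3)] w AE_I2[OF nb]]
  have ns: "square_integrable ?n" and nn: "L2_norm ?n \<le> 2 * M powr \<alpha> * L2_norm ?w" using n by auto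
  have wc: "square_integrable (\<lambda>x. cnj (?w x))" by (rule square_integrable_cnj[OF w])
  have wcn: "L2_norm (\<lambda>x. cnj (?w x)) = L2_norm ?w" by (simp add: L2_norm_def)
  have wK: "L2_norm ?w \<le> K * (2 * M)" "L2_norm ?l \<le> K * (2 * M)"
    unfolding even_part_FT[OF t] even_lap_FT[OF t] K_def
    using order_trans[OF FT_square_integrable(2)[OF i(2) sq(1), of 1] mult_left_mono[OF sq(2)]]
      order_trans[OF FT_square_integrable(2)[OF i(3) sq(3), of 1] mult_left_mono[OF sq(4)]] by (auto simp: less_imp_le)
  show E: "(L2_norm ?w)\<^sup>2 \<le> (K * (2 * M))\<^sup>2" using wK(1) by (intro power_mono) auto
  note pl = square_integrable_product[OF wc l] and pn = square_integrable_product[OF wc ns]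
  have il: "integrable lborel (\<lambda>x. cnj (?w x) * ?l x)" and inn: "integrable lborel (\<lambda>x. cnj (?w x) * ?n x)"
    using pl(1) pn(1) by (simp_all add: integrable_completion)
  have el: "(\<integral>x. cnj (?w x) * ?l x \<partial>lborel) = (\<integral>x. cnj (?w x) * ?l x \<partial>lebesgue)"
    and en: "(\<integral>x. cnj (?w x) * ?n x \<partial>lborel) = (\<integral>x. cnj (?w x) * ?n x \<partial>lebesgue)"
    by (rule integral_completion[symmetric], measurable)+
  have eq: "energy_rate t = (\<lambda>x. 2 * Re (- \<i> * (cnj (?w x) * ?l x) + - \<i> * lam * (cnj (?w x) * ?n x)))"
    by (simp add: fun_eq_iff energy_rate_def algebra_simps)
  have ic: "integrable lborel (\<lambda>x. - \<i> * (cnj (?w x) * ?l x) + - \<i> * lam * (cnj (?w x) * ?n x))"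
    using il inn by (intro Bochner_Integration.integrable_add integrable_mult_right) auto
  show ii: "integrable lborel (energy_rate t)"
    unfolding eq by (intro integrable_mult_right integrable_Re ic)
  have W: "L2_norm ?w * L2_norm ?n \<le> 2 * M powr \<alpha> * (L2_norm ?w)\<^sup>2"
    using mult_left_mono[OF nn, of "L2_norm ?w"] by (simp add: power2_eq_square mult_ac)
  have "(\<integral>x. energy_rate t x \<partial>lborel) = 2 * Re (\<integral>x. - \<i> * (cnj (?w x) * ?l x) + - \<i> * lam * (cnj (?w x) * ?n x) \<partial>lborel)"
    unfolding eq using ic by (simp only: integral_mult_right_zero integral_Re)
  also have "(\<integral>x. - \<i> * (cnj (?w x) * ?l x) + - \<i> * lam * (cnj (?w x) * ?n x) \<partial>lborel)
     = - \<i> * (\<integral>x. cnj (?w x) * ?l x \<partial>lborel) + - \<i> * lam * (\<integral>x. cnj (?w x) * ?n x \<partial>lborel)"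
    using il inn by (subst Bochner_Integration.integral_add) (auto intro!: integrable_mult_right simp only: integral_mult_right_zero)
  \<comment> \<open>The Laplacian drops out: its pairing is real, so multiplication by
    \<open>- \<i>\<close> leaves no real part.\<close>
  also have "2 * Re \<dots> = 2 * Re (- \<i> * lam * (\<integral>x. cnj (?w x) * ?n x \<partial>lebesgue))"
    unfolding el en using even_lap_symmetric[OF t] by simp
  also have "\<dots> \<le> 2 * cmod (- \<i> * lam * (\<integral>x. cnj (?w x) * ?n x \<partial>lebesgue))"
    by (intro mult_left_mono complex_Re_le_cmod) simp
  also have "\<dots> = 2 * (cmod lam * cmod (\<integral>x. cnj (?w x) * ?n x \<partial>lebesgue))" by (simp add: norm_mult)
  also have "\<dots> \<le> 2 * (cmod lam * (2 * M powr \<alpha> * (L2_norm ?w)\<^sup>2))"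
    using order_trans[OF pn(3)[unfolded wcn] W] by (intro mult_left_mono) auto
  finally show "(\<integral>x. energy_rate t x \<partial>lborel) \<le> k * (L2_norm ?w)\<^sup>2" by (simp add: k_def mult_ac)
  have "(\<integral>x. \<bar>energy_rate t x\<bar> \<partial>lborel) \<le> (\<integral>x. 2 * cmod (cnj (?w x) * ?l x) + 2 * cmod lam * cmod (cnj (?w x) * ?n x) \<partial>lborel)"
  proof (rule integral_mono)
    show "integrable lborel (\<lambda>x. \<bar>energy_rate t x\<bar>)" using ii by (rule integrable_abs)
    show "integrable lborel (\<lambda>x. 2 * cmod (cnj (?w x) * ?l x) + 2 * cmod lam * cmod (cnj (?w x) * ?n x))"
      by (intro Bochner_Integration.integrable_add integrable_mult_right integrable_norm il inn)
    fix x
    have "\<bar>energy_rate t x\<bar> \<le> 2 * cmod (- \<i> * (cnj (?w x) * ?l x) + - \<i> * lam * (cnj (?w x) * ?n x))"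
      unfolding eq abs_mult by (simp only: abs_numeral) (intro mult_left_mono abs_Re_le_cmod, simp)
    also have "\<dots> \<le> 2 * (cmod (- \<i> * (cnj (?w x) * ?l x)) + cmod (- \<i> * lam * (cnj (?w x) * ?n x)))"
      by (intro mult_left_mono norm_triangle_ineq) simp
    finally show "\<bar>energy_rate t x\<bar> \<le> 2 * cmod (cnj (?w x) * ?l x) + 2 * cmod lam * cmod (cnj (?w x) * ?n x)"
      by (simp add: norm_mult algebra_simps)
  qed
  also have "\<dots> = 2 * (\<integral>x. cmod (cnj (?w x) * ?l x) \<partial>lborel) + 2 * cmod lam * (\<integral>x. cmod (cnj (?w x) * ?n x) \<partial>lborel)"
    using integrable_norm[OF il] integrable_norm[OF inn] by simp
  also have "\<dots> \<le> 2 * (K * (2 * M))\<^sup>2 + 2 * cmod lam * (2 * M powr \<alpha> * (K * (2 * M))\<^sup>2)"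
  proof (intro add_mono mult_left_mono)
    have "(\<integral>x. cmod (cnj (?w x) * ?l x) \<partial>lborel) = (\<integral>x. cmod (cnj (?w x)) * cmod (?l x) \<partial>lebesgue)"
      unfolding norm_mult by (rule integral_completion[symmetric]) measurable
    also have "\<dots> \<le> L2_norm ?w * L2_norm ?l" using pl(2) unfolding wcn .
    also have "\<dots> \<le> (K * (2 * M))\<^sup>2" unfolding power2_eq_square using wK order_trans[OF L2_norm_nonneg wK(1)] by (intro mult_mono) auto
    finally show "(\<integral>x. cmod (cnj (?w x) * ?l x) \<partial>lborel) \<le> (K * (2 * M))\<^sup>2" .
    have "(\<integral>x. cmod (cnj (?w x) * ?n x) \<partial>lborel) = (\<integral>x. cmod (cnj (?w x)) * cmod (?n x) \<partial>lebesgue)"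
      unfolding norm_mult by (rule integral_completion[symmetric]) measurable
    also have "\<dots> \<le> L2_norm ?w * L2_norm ?n" using pn(2) unfolding wcn .
    also have "\<dots> \<le> 2 * M powr \<alpha> * (L2_norm ?w)\<^sup>2" by (rule W)
    also have "\<dots> \<le> 2 * M powr \<alpha> * (K * (2 * M))\<^sup>2" by (intro mult_left_mono E) auto
    finally show "(\<integral>x. cmod (cnj (?w x) * ?n x) \<partial>lborel) \<le> 2 * M powr \<alpha> * (K * (2 * M))\<^sup>2" .
  qed auto
  finally show "(\<integral>x. \<bar>energy_rate t x\<bar> \<partial>lborel) \<le> 2 * (K * (2 * M))\<^sup>2 + k * (K * (2 * M))\<^sup>2"
    by (simp add: k_def mult_ac)
qed

lemma even_part_deriv:
  assumes t: "t \<in> {0..T}"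
  shows "((\<lambda>r. (cmod (even_part r x))\<^sup>2) has_vector_derivative energy_rate t x) (at t within {0..T})"
proof -
  let ?w' = "- \<i> * (even_lap t x + lam * even_nl t x)"
  have "((\<lambda>r. u r x + u r (- x)) has_vector_derivative
     - \<i> * (laplacian (u t) x + lam * power_nl \<alpha> (u t x)) + - \<i> * (laplacian (u t) (- x) + lam * power_nl \<alpha> (u t (- x)))) (at t within {0..T})"
    by (intro has_vector_derivative_add deriv t)
  then have w: "((\<lambda>r. even_part r x) has_vector_derivative ?w') (at t within {0..T})"
    by (simp add: even_part_def even_lap_def even_nl_def laplacian_u[OF t] algebra_simps)
  have "((\<lambda>r. even_part r x \<bullet> even_part r x) has_vector_derivative even_part t x \<bullet> ?w' + ?w' \<bullet> even_part t x) (at t within {0..T})"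
    by (rule bounded_bilinear.has_vector_derivative[OF bounded_bilinear_inner w w])
  moreover have "even_part t x \<bullet> ?w' + ?w' \<bullet> even_part t x = energy_rate t x"
    by (simp add: energy_rate_def inner_complex_def algebra_simps)
  ultimately show ?thesis by (simp add: power2_norm_eq_inner)
qed

text \<open>The fundamental theorem of calculus is applied in time at each point of space, and only
  then is the result integrated over space and the order exchanged. A bound \<open>S\<close> on the
  earlier energy thus improves to a multiple of \<open>t * S\<close>.\<close>

lemma energy_step:
  assumes t: "t \<in> {0..T}" and init: "\<And>x. u 0 (- x) = - u 0 x"
    and M: "\<And>r. r \<in> {0..T} \<Longrightarrow> wiener_norm (3 + b) (G r) \<le> M"
      "\<And>r. r \<in> {0..T} \<Longrightarrow> L2_norm (\<lambda>\<xi>. of_real (japanese s \<xi>) * G r \<xi>) \<le> M"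
    and S: "\<And>r. r \<in> {0..t} \<Longrightarrow> (L2_norm (even_part r))\<^sup>2 \<le> S"
  shows "(L2_norm (even_part t))\<^sup>2 \<le> 4 * cmod lam * M powr \<alpha> * t * S"
proof -
  let ?k = "4 * cmod lam * M powr \<alpha>" and ?K = "gauss_const TYPE(real^'n)"
  let ?Q = "2 * (?K * (2 * M))\<^sup>2 + ?k * (?K * (2 * M))\<^sup>2"
  define f where "f r x = indicator {0..t} r *\<^sub>R energy_rate r x" for r x
  have sub: "{0..t} \<subseteq> {0..T}" using t by auto
  note er = energy_rate_integral[OF _ M(1) M(2)]
  have fm[measurable]: "(\<lambda>p. f (fst p) (snd p)) \<in> borel_measurable (lborel \<Otimes>\<^sub>M lborel)"
  proof -
    have "(\<lambda>p. indicator ({0..t} \<times> UNIV) p *\<^sub>R energy_rate (fst p) (snd p)) \<in> borel_measurable borel"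
      using sub by (intro borel_measurable_continuous_on_indicator continuous_on_subset[OF energy_rate_continuous])
        (auto intro!: borel_closed closed_Times)
    moreover have "indicator ({0..t} \<times> UNIV) p *\<^sub>R energy_rate (fst p) (snd p) = f (fst p) (snd p)" for p
      by (simp add: f_def indicator_def mem_Times_iff)
    ultimately show ?thesis by (simp add: lborel_prod)
  qed
  have fx: "integrable lborel (f r)" "(\<integral>x. \<bar>f r x\<bar> \<partial>lborel) \<le> ?Q * indicator {0..t} r" for r
  proof -
    show "integrable lborel (f r)"
      using er(1)[of r] sub unfolding f_def by (cases "r \<in> {0..t}") auto
    show "(\<integral>x. \<bar>f r x\<bar> \<partial>lborel) \<le> ?Q * indicator {0..t} r"
      using er(3)[of r] sub unfolding f_def by (cases "r \<in> {0..t}") auto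
  qed
  have ind: "integrable lborel (\<lambda>r::real. indicator {0..t} r :: real)"
    by (intro integrable_real_indicator) (auto simp: emeasure_lborel_Icc_eq)
  have pair: "integrable (lborel \<Otimes>\<^sub>M lborel) (\<lambda>(r, x). f r x)"
  proof (rule lborel_pair.Fubini_integrable)
    show "(\<lambda>(r, x). f r x) \<in> borel_measurable (lborel \<Otimes>\<^sub>M lborel)" using fm by (simp add: split_beta)
    have m1: "(\<lambda>r. \<integral>x. norm (f r x) \<partial>lborel) \<in> borel_measurable lborel"
      using fm by (intro lborel.borel_measurable_lebesgue_integral) (auto simp: split_beta)
    show "integrable lborel (\<lambda>r. \<integral>x. norm ((\<lambda>(r, x). f r x) (r, x)) \<partial>lborel)"
      by (rule Bochner_Integration.integrable_bound[OF integrable_mult_right[OF ind, of ?Q]])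
         (use m1 fx(2) in \<open>auto intro!: AE_I2 order_trans[OF _ abs_ge_self] simp: integral_nonneg_AE\<close>)
  qed (use fx(1) in auto)
  have pt: "(\<integral>r. f r x \<partial>lborel) = (cmod (even_part t x))\<^sup>2" for x
  proof -
    have "(\<integral>r. f r x \<partial>lborel) = (cmod (even_part t x))\<^sup>2 - (cmod (even_part 0 x))\<^sup>2"
      unfolding f_def
    proof (rule integral_FTC_Icc)
      have "continuous_on {0..T} (\<lambda>r. (r, x))" by (intro continuous_intros)
      from continuous_on_compose2[OF energy_rate_continuous this]
      have "continuous_on {0..T} (\<lambda>r. energy_rate r x)" by auto
      then show "continuous_on {0..t} (\<lambda>r. energy_rate r x)" by (rule continuous_on_subset[OF _ sub])
      show "((\<lambda>r. (cmod (even_part r x))\<^sup>2) has_vector_derivative energy_rate r x) (at r within {0..t})" if "0 \<le> r" "r \<le> t" for r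
        using even_part_deriv[of r x] that t sub by (auto intro: has_vector_derivative_within_subset)
    qed (use t in auto)
    \<comment> \<open>The term at time 0 vanishes since the datum is odd.\<close>
    then show ?thesis by (simp add: even_part_def init)
  qed
  have "(L2_norm (even_part t))\<^sup>2 = (\<integral>x. (cmod (even_part t x))\<^sup>2 \<partial>lborel)"
    by (rule L2_norm_sq_borel) (use FT_measurable[OF even_G_wiener(2)[OF t]] in \<open>simp add: even_part_FT[OF t]\<close>)
  also have "\<dots> = (\<integral>x. (\<integral>r. f r x \<partial>lborel) \<partial>lborel)" unfolding pt ..
  also have "\<dots> = (\<integral>r. (\<integral>x. f r x \<partial>lborel) \<partial>lborel)" by (rule lborel_pair.Fubini_integral[OF pair])
  also have "\<dots> \<le> (\<integral>r. ?k * S * indicator {0..t} r \<partial>lborel)"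
  proof (rule integral_mono)
    show "integrable lborel (\<lambda>r. \<integral>x. f r x \<partial>lborel)" using lborel_pair.integrable_fst[OF pair] .
    show "integrable lborel (\<lambda>r. ?k * S * indicator {0..t} r)" by (intro integrable_mult_right ind)
    fix r
    show "(\<integral>x. f r x \<partial>lborel) \<le> ?k * S * indicator {0..t} r"
    proof (cases "r \<in> {0..t}")
      case True
      have "(\<integral>x. energy_rate r x \<partial>lborel) \<le> ?k * (L2_norm (even_part r))\<^sup>2" by (rule er(2)) (use True sub in auto)
      also have "\<dots> \<le> ?k * S" by (intro mult_left_mono S True) auto
      finally show ?thesis using True by (simp add: f_def)
    qed (simp add: f_def)
  qed
  also have "\<dots> = ?k * S * t" using t by simp
  finally show ?thesis by (simp add: mult_ac)
qed

text \<open>Replaces Gronwall's inequality: on a short interval each application of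
  \<open>energy_step\<close> halves the bound on the energy, so the energy is zero. Continuity of
  the even part turns this into a statement about the value at the origin, the only consequence of
  oddness used afterwards.\<close>

lemma odd_preserved:
  assumes init: "\<And>x. u 0 (- x) = - u 0 x"
  obtains t0 where "0 < t0" "t0 \<le> T" "\<And>t. t \<in> {0..t0} \<Longrightarrow> u t 0 = 0"
proof -
  obtain M where M: "M > 0" "\<And>t. t \<in> {0..T} \<Longrightarrow> L2_norm (\<lambda>\<xi>. of_real (japanese s \<xi>) * G t \<xi>) \<le> M"
    "\<And>t. t \<in> {0..T} \<Longrightarrow> wiener_norm (3 + b) (G t) \<le> M" using sobolev_bounded by blast
  let ?k = "4 * cmod lam * M powr \<alpha>"
  have k: "?k > 0" using lam M(1) by simp
  \<comment> \<open>The length that makes the gain factor \<open>?k * t\<close> at most 1/2.\<close>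
  define t0 where "t0 = min T (1 / (2 * ?k))"
  have t0: "0 < t0" "t0 \<le> T" "?k * t0 \<le> 1 / 2"
    using T k by (auto simp: t0_def min_def field_simps)
  let ?S = "(gauss_const TYPE(real^'n) * (2 * M))\<^sup>2"
  have decay: "\<forall>t\<in>{0..t0}. (L2_norm (even_part t))\<^sup>2 \<le> (1 / 2) ^ n * ?S" for n
  proof (induction n)
    case 0
    then show ?case using energy_rate_integral(4)[OF _ M(3) M(2)] t0 by auto
  next
    case (Suc n)
    show ?case
    proof
      fix t assume t: "t \<in> {0..t0}"
      have "(L2_norm (even_part t))\<^sup>2 \<le> ?k * t * ((1 / 2) ^ n * ?S)"
        by (rule energy_step[OF _ init M(3) M(2)]) (use t t0 Suc in auto)
      also have "\<dots> \<le> 1 / 2 * ((1 / 2) ^ n * ?S)"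
      proof (rule mult_right_mono)
        have "?k * t \<le> ?k * t0" using t k by (intro mult_left_mono) auto
        then show "?k * t \<le> 1 / 2" using t0(3) by linarith
      qed simp
      finally show "(L2_norm (even_part t))\<^sup>2 \<le> (1 / 2) ^ Suc n * ?S" by simp
    qed
  qed
  show thesis
  proof (rule that[OF t0(1,2)])
    fix t assume t: "t \<in> {0..t0}"
    then have tT: "t \<in> {0..T}" using t0 by auto
    have "(\<lambda>n. (1 / 2) ^ n * ?S) \<longlonglongrightarrow> 0 * ?S" by (intro tendsto_mult_right LIMSEQ_power_zero) simp
    then have "(L2_norm (even_part t))\<^sup>2 \<le> 0"
      using decay t by (intro LIMSEQ_le_const[of _ 0]) auto
    then have "L2_norm (even_part t) = 0" by simp
    then have "AE x in lebesgue. even_part t x = 0" by (rule L2_norm_zero_AE[OF even_square_integrable(1)[OF tT]])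
    moreover have "continuous_on UNIV (even_part t)"
      unfolding even_part_FT[OF tT] by (rule FT_continuous[OF even_G_wiener(2)[OF tT]])
    ultimately have "even_part t 0 = 0" by (rule continuous_AE_zero[rotated])
    then show "u t 0 = 0" by (simp add: even_part_def)
  qed
qed

end

section \<open>Nonexistence\<close>

lemma norm_axis: "norm (axis i (h::real)) = \<bar>h\<bar>"
proof -
  have "(norm (axis i h))\<^sup>2 = \<bar>h\<bar>\<^sup>2"
    unfolding power2_norm_eq_inner by (simp add: inner_axis_axis power2_eq_square)
  then show ?thesis by (subst (asm) power2_eq_iff_nonneg) auto
qed

lemma axis_double: "2 *\<^sub>R axis i (h::real) = axis i (2 * h)"
  by (simp add: vec_eq_iff axis_def)

context nls_path
begin

text \<open>The solution has enough weight for the full order h^2, which is then relaxed to the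
  common order h^(1+b) using b < 1 and h at most 1.\<close>

lemma u_second_difference:
  assumes t: "t \<in> {0..T}" and M: "wiener_norm (3 + b) (G t) \<le> M" and h: "0 < h" "h \<le> 1"
  shows "cmod (u t (axis i (2 * h)) - 2 * u t (axis i h) + u t 0) \<le> 4 * M * h powr (1 + b)"
proof -
  have "cmod (u t (axis i (2 * h)) - 2 * u t (axis i h) + u t 0) \<le> 4 * norm (axis i h :: real^'n) powr 2 * wiener_norm (3 + b) (G t)"
    unfolding uG[OF t] axis_double[symmetric] using b \<alpha> by (intro FT_second_difference G_wiener t) auto
  also have "\<dots> \<le> 4 * h powr (1 + b) * M"
  proof -
    have "h powr 2 \<le> h powr (1 + b)" using h b by (intro powr_mono') auto
    then show ?thesis unfolding norm_axis using M h by (intro mult_mono) auto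
  qed
  finally show ?thesis by (simp add: mult_ac)
qed

text \<open>Here the order 1 + b is all that remains of the weight \<open>3 + b\<close> after two
  derivatives. This is where the regularity assumption is spent.\<close>

lemma lap_second_difference:
  assumes t: "t \<in> {0..T}" and M: "wiener_norm (3 + b) (G t) \<le> M" and h: "0 < h"
  shows "cmod (lap t (axis i (2 * h)) - 2 * lap t (axis i h) + lap t 0) \<le> 4 * M * h powr (1 + b)"
proof -
  let ?g = "\<lambda>\<xi>. - of_real ((norm \<xi>)\<^sup>2) * G t \<xi>"
  have "cmod (lap t (axis i (2 * h)) - 2 * lap t (axis i h) + lap t 0) \<le> 4 * norm (axis i h :: real^'n) powr (1 + b) * wiener_norm (1 + b) ?g"
    unfolding lap_def axis_double[symmetric] using b \<alpha> by (intro FT_second_difference lap_wiener t) auto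
  also have "\<dots> \<le> 4 * h powr (1 + b) * M"
    unfolding norm_axis using order_trans[OF lap_wiener(2)[OF t] M] h by (intro mult_mono) auto
  finally show ?thesis by (simp add: mult_ac)
qed

text \<open>Both functions vanish at the origin, so their difference at \<open>axis i h\<close> is a
  first difference of \<open>u t - u 0\<close>. The gain of a factor \<open>h\<close> lets the slope
  of the datum at its zero persist for short times.\<close>

lemma u_increment:
  assumes t: "t \<in> {0..T}" and u0: "u t 0 = 0" "u 0 0 = 0" and h: "0 < h"
    and c: "wiener_norm (3 + b) (\<lambda>\<xi>. G t \<xi> - G 0 \<xi>) \<le> c"
  shows "cmod (u t (axis i h) - u 0 (axis i h)) \<le> h * c"
proof -
  have 0: "0 \<in> {0..T}" using T by simp
  have w: "wiener (3 + b) (\<lambda>\<xi>. G t \<xi> - G 0 \<xi>)" by (intro wiener_diff G_wiener t 0)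
  have i: "integrable lborel (G r)" if "r \<in> {0..T}" for r
    using b \<alpha> wiener_integrable[OF G_wiener[OF that]] by auto
  have e: "FT 1 (\<lambda>\<xi>. G t \<xi> - G 0 \<xi>) x = u t x - u 0 x" for x
    unfolding FT_diff[OF i[OF t] i[OF 0]] uG[OF t] uG[OF 0] ..
  have "cmod (FT 1 (\<lambda>\<xi>. G t \<xi> - G 0 \<xi>) (axis i h) - FT 1 (\<lambda>\<xi>. G t \<xi> - G 0 \<xi>) 0)
    \<le> norm (axis i h :: real^'n) * wiener_norm (3 + b) (\<lambda>\<xi>. G t \<xi> - G 0 \<xi>)"
    using b \<alpha> by (intro FT_first_difference[OF w]) auto
  also have "\<dots> \<le> h * c" unfolding norm_axis using c h by (intro mult_mono) auto
  finally show ?thesis unfolding e u0 by simp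
qed

text \<open>With z = u(h) and u(0) = 0, the second difference of u says that u(2h) is 2z up to order
  h^(1+b). Replacing it by 2z costs a Lipschitz error, and homogeneity then leaves (2^(1+alpha) - 2)
  |z|^alpha z, whose real part is at least that factor times (c h)^(1+alpha).\<close>

lemma nonlinearity_second_difference:
  assumes t: "t \<in> {0..T}" and M: "wiener_norm (3 + b) (G t) \<le> M" and h: "0 < h" "h \<le> 1"
    and u0: "u t 0 = 0" and c: "0 < c" "c * h \<le> Re (u t (axis i h))"
  shows "(2 powr (1 + \<alpha>) - 2) * c powr (1 + \<alpha>) * h powr (1 + \<alpha>) - 2 * (2 * M) powr \<alpha> * (4 * M * h powr (1 + b))
    \<le> Re (power_nl \<alpha> (u t (axis i (2 * h))) - 2 * power_nl \<alpha> (u t (axis i h)) + power_nl \<alpha> (u t 0))"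
proof -
  let ?z = "u t (axis i h)" and ?z2 = "u t (axis i (2 * h))"
  have zb: "cmod ?z \<le> M" "cmod ?z2 \<le> M" by (rule u_bound[OF t M])+
  have M0: "0 \<le> M" using zb(1) norm_ge_zero order_trans by blast
  \<comment> \<open>The Lipschitz constant is taken on the disc of radius \<open>2 * M\<close>,
    which contains the doubled value.\<close>
  have "cmod (power_nl \<alpha> ?z2 - power_nl \<alpha> (of_real 2 * ?z)) \<le> 2 * (2 * M) powr \<alpha> * cmod (?z2 - of_real 2 * ?z)"
    using zb M0 by (intro power_nl_Lipschitz \<alpha>) (auto simp: norm_mult)
  also have "\<dots> \<le> 2 * (2 * M) powr \<alpha> * (4 * M * h powr (1 + b))"
    using u_second_difference[OF t M h, of i] u0 by (intro mult_left_mono) auto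
  finally have 1: "cmod (power_nl \<alpha> ?z2 - power_nl \<alpha> (of_real 2 * ?z)) \<le> 2 * (2 * M) powr \<alpha> * (4 * M * h powr (1 + b))" .
  have r: "0 < c * h" using c h by simp
  have "c powr (1 + \<alpha>) * h powr (1 + \<alpha>) = (c * h) powr \<alpha> * (c * h)"
    using r c h by (simp add: powr_mult powr_add)
  also have "\<dots> \<le> cmod ?z powr \<alpha> * Re ?z"
    using c r \<alpha> order_trans[OF c(2) complex_Re_le_cmod] by (intro mult_mono powr_mono2) auto
  also have "\<dots> = Re (power_nl \<alpha> ?z)" by (simp add: power_nl_def)
  finally have 2: "c powr (1 + \<alpha>) * h powr (1 + \<alpha>) \<le> Re (power_nl \<alpha> ?z)" .
  have k: "2 powr (1 + \<alpha>) - 2 \<ge> (0::real)"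
    using powr_mono[of 1 "1 + \<alpha>" "2::real"] \<alpha> by simp
  have "Re (power_nl \<alpha> ?z2 - 2 * power_nl \<alpha> ?z + power_nl \<alpha> (u t 0))
    = Re (power_nl \<alpha> ?z2 - power_nl \<alpha> (of_real 2 * ?z)) + (2 powr (1 + \<alpha>) - 2) * Re (power_nl \<alpha> ?z)"
  proof -
    have "power_nl \<alpha> (of_real 2 * ?z) = of_real (2 powr (1 + \<alpha>)) * power_nl \<alpha> ?z" by (rule power_nl_scale) simp
    from arg_cong[where f=Re, OF this] show ?thesis using u0 by (simp add: algebra_simps)
  qed
  moreover have "Re (power_nl \<alpha> ?z2 - power_nl \<alpha> (of_real 2 * ?z)) \<ge> - (2 * (2 * M) powr \<alpha> * (4 * M * h powr (1 + b)))"
    using 1 abs_Re_le_cmod[of "power_nl \<alpha> ?z2 - power_nl \<alpha> (of_real 2 * ?z)"] by linarith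
  moreover have "(2 powr (1 + \<alpha>) - 2) * (c powr (1 + \<alpha>) * h powr (1 + \<alpha>)) \<le> (2 powr (1 + \<alpha>) - 2) * Re (power_nl \<alpha> ?z)"
    by (rule mult_left_mono[OF 2 k])
  ultimately show ?thesis by (simp add: mult.assoc)
qed

text \<open>Second differences of the equation integrated in time. The derivative in time
  contributes two differences of u, the Laplacian a time integral, and all are of order h^(1+b),
  while the nonlinear integral keeps the lower bound of order h^(1+alpha).\<close>

lemma integrated_second_difference:
  assumes t: "0 < t" "t \<le> T" and M: "\<And>r. r \<in> {0..T} \<Longrightarrow> wiener_norm (3 + b) (G r) \<le> M" and h: "0 < h" "h \<le> 1"
    and u0: "\<And>r. r \<in> {0..t} \<Longrightarrow> u r 0 = 0" and c: "0 < c" "\<And>r. r \<in> {0..t} \<Longrightarrow> c * h \<le> Re (u r (axis i h))"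
  shows "cmod lam * (t * ((2 powr (1 + \<alpha>) - 2) * c powr (1 + \<alpha>) * h powr (1 + \<alpha>) - 2 * (2 * M) powr \<alpha> * (4 * M * h powr (1 + b))))
    \<le> (8 * M + 4 * M * t) * h powr (1 + b)"
proof -
  define D where "D f = f (axis i (2 * h)) - 2 * f (axis i h) + f 0" for f :: "real^'n \<Rightarrow> complex"
  let ?L = "\<lambda>r. D (lap r)" and ?P = "\<lambda>r. D (\<lambda>x. power_nl \<alpha> (u r x))"
  let ?B = "4 * M * h powr (1 + b)"
  let ?R = "(2 powr (1 + \<alpha>) - 2) * c powr (1 + \<alpha>) * h powr (1 + \<alpha>) - 2 * (2 * M) powr \<alpha> * ?B"
  have sub: "{0..t} \<subseteq> {0..T}" using t by auto
  have 0: "0 \<in> {0..T}" and tT: "t \<in> {0..T}" using t by auto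
  have M0: "0 \<le> M" using M[OF 0] wiener_norm_nonneg order_trans by blast
  have ftc: "((\<lambda>r. - \<i> * (lap r x + lam * power_nl \<alpha> (u r x))) has_integral u t x - u 0 x) {0..t}" for x
  proof (rule fundamental_theorem_of_calculus)
    fix r assume "r \<in> {0..t}"
    then have r: "r \<in> {0..T}" using sub by auto
    show "((\<lambda>r. u r x) has_vector_derivative - \<i> * (lap r x + lam * power_nl \<alpha> (u r x))) (at r within {0..t})"
      using has_vector_derivative_within_subset[OF deriv[OF r] sub] by (simp add: laplacian_u[OF r])
  qed (use t in simp)
  have total: "((\<lambda>r. - \<i> * (?L r + lam * ?P r)) has_integral D (u t) - D (u 0)) {0..t}"
  proof -
    have "((\<lambda>r. (- \<i> * (lap r (axis i (2 * h)) + lam * power_nl \<alpha> (u r (axis i (2 * h)))))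
      - 2 * (- \<i> * (lap r (axis i h) + lam * power_nl \<alpha> (u r (axis i h))))
      + (- \<i> * (lap r 0 + lam * power_nl \<alpha> (u r 0)))) has_integral
      (u t (axis i (2 * h)) - u 0 (axis i (2 * h))) - 2 * (u t (axis i h) - u 0 (axis i h)) + (u t 0 - u 0 0)) {0..t}"
      by (intro has_integral_add has_integral_diff has_integral_mult_right ftc)
    then show ?thesis by (simp add: D_def algebra_simps)
  qed
  have "continuous_on {0..t} ?L"
    unfolding D_def by (intro continuous_intros continuous_on_subset[OF lap_continuous_t sub])
  then obtain IL where IL: "(?L has_integral IL) {0..t}" using integrable_continuous_real by blast
  have "continuous_on {0..t} ?P"
    unfolding D_def by (intro continuous_intros continuous_power_nl \<alpha> continuous_on_subset[OF u_continuous_t sub])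
  then obtain IP where IP: "(?P has_integral IP) {0..t}" using integrable_continuous_real by blast
  have "((\<lambda>r. - \<i> * (?L r + lam * ?P r)) has_integral - \<i> * (IL + lam * IP)) {0..t}"
    by (intro has_integral_add has_integral_mult_right IL IP)
  from has_integral_unique[OF total this] have eq: "D (u t) - D (u 0) = - \<i> * (IL + lam * IP)" .
  have "norm IL \<le> ?B * measure lborel {0..t}"
    using lap_second_difference[OF _ M h(1)] sub M0 by (intro has_integral_bound_real[OF _ finite.emptyI IL]) (auto simp: D_def)
  then have IL_le: "cmod IL \<le> ?B * t" using t by simp
  have D_le: "cmod (D (u r)) \<le> ?B" if "r \<in> {0..T}" for r
    unfolding D_def by (rule u_second_difference[OF that M[OF that] h])
  have ReP: "((\<lambda>r. Re (?P r)) has_integral Re IP) {0..t}"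
    using has_integral_linear[OF IP bounded_linear_Re] by (simp add: o_def)
  have const: "((\<lambda>r. B) has_integral t * B) {0..t}" for B :: real
    using has_integral_const_real[of B 0 t] t by simp
  have "t * ?R \<le> Re IP"
  proof (rule has_integral_le[OF const ReP])
    fix r assume r: "r \<in> {0..t}"
    then have rT: "r \<in> {0..T}" using sub by auto
    show "?R \<le> Re (?P r)"
      unfolding D_def by (rule nonlinearity_second_difference[OF rT M[OF rT] h u0[OF r] c(1) c(2)[OF r]])
  qed
  then have "t * ?R \<le> cmod IP" by (rule order_trans[OF _ complex_Re_le_cmod])
  \<comment> \<open>The real part of the integral is bounded below before \<open>lam\<close> is
    multiplied in, so no phase of \<open>lam\<close> can cause cancellation.\<close>
  then have "cmod lam * (t * ?R) \<le> cmod (lam * IP)" unfolding norm_mult by (rule mult_left_mono) simp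
  also have "lam * IP = \<i> * (D (u t) - D (u 0)) - IL" unfolding eq by (simp add: algebra_simps)
  also have "cmod \<dots> \<le> cmod (D (u t)) + cmod (D (u 0)) + cmod IL"
    using norm_triangle_ineq4[of "\<i> * (D (u t) - D (u 0))" IL] norm_triangle_ineq4[of "D (u t)" "D (u 0)"] by (simp add: norm_mult)
  also have "\<dots> \<le> ?B + ?B + ?B * t" by (intro add_mono D_le tT 0 IL_le)
  also have "\<dots> = (8 * M + 4 * M * t) * h powr (1 + b)" by (simp add: algebra_simps)
  finally show ?thesis .
qed

text \<open>At a fixed small positive time the estimate k h^(1+alpha) <= B h^(1+b) holds for all
  small h; since b exceeds alpha this fails as h tends to 0.\<close>

lemma no_odd_bump_data:
  assumes init: "\<And>x. u 0 x = odd_bump i x"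
  shows False
proof -
  obtain M where M: "M > 0" "\<And>t. t \<in> {0..T} \<Longrightarrow> wiener_norm (3 + b) (G t) \<le> M"
    by (rule sobolev_bounded) blast
  obtain t0 where t0: "0 < t0" "t0 \<le> T" "\<And>t. t \<in> {0..t0} \<Longrightarrow> u t 0 = 0"
  proof (rule odd_preserved)
    show "u 0 (- x) = - u 0 x" for x by (simp add: init odd_bump_minus)
  qed blast
  \<comment> \<open>Half of the initial slope bound \<open>exp (- 2)\<close>: the other half is
    given up to the evolution between 0 and t.\<close>
  define c :: real where "c = exp (- 2) / 2"
  have c: "c > 0" "exp (- 2) = 2 * c" by (auto simp: c_def)
  have 0: "0 \<in> {0..T}" using T by simp
  have "\<forall>\<^sub>F r in at 0 within {0..T}. wiener_norm (3 + b) (\<lambda>\<xi>. G r \<xi> - G 0 \<xi>) < c"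
    using order_tendstoD(2)[OF wiener_norm_tendsto[OF 0] c(1)] .
  then obtain d where d: "d > 0" "\<And>r. r \<in> {0..T} \<Longrightarrow> r \<noteq> 0 \<Longrightarrow> dist r 0 < d \<Longrightarrow> wiener_norm (3 + b) (\<lambda>\<xi>. G r \<xi> - G 0 \<xi>) < c"
    unfolding eventually_at by blast
  \<comment> \<open>Below \<open>t0\<close> the zero stays at the origin, and below \<open>d\<close>
    the solution stays close to the datum; the half makes the second inequality strict.\<close>
  define t where "t = min t0 (d / 2)"
  have t: "0 < t" "t \<le> T" "t \<le> t0" "t < d" using t0 d(1) by (auto simp: t_def min_def)
  have near: "wiener_norm (3 + b) (\<lambda>\<xi>. G r \<xi> - G 0 \<xi>) \<le> c" if "r \<in> {0..t}" for r
  proof (cases "r = 0")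
    case True
    then show ?thesis using c by (simp add: wiener_norm_def)
  next
    case False
    then show ?thesis using d(2)[of r] that t by (auto simp: dist_real_def)
  qed
  have u0: "u r 0 = 0" if "r \<in> {0..t}" for r using t0(3) that t by auto
  have lower: "c * h \<le> Re (u r (axis i h))" if r: "r \<in> {0..t}" and h: "0 < h" "h \<le> 1 / 2" for r h
  proof -
    have "cmod (u r (axis i h) - u 0 (axis i h)) \<le> h * c"
      using r t h by (intro u_increment near u0) auto
    then have "Re (u 0 (axis i h)) - Re (u r (axis i h)) \<le> h * c"
      using abs_Re_le_cmod[of "u r (axis i h) - u 0 (axis i h)"] by simp
    moreover have "Re (u 0 (axis i h)) \<ge> 2 * c * h"
      using odd_bump_lower_bound[OF h, of i] init c(2) by simp
    ultimately show ?thesis by (simp add: algebra_simps)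
  qed
  define k where "k = cmod lam * t * ((2 powr (1 + \<alpha>) - 2) * c powr (1 + \<alpha>))"
  define B where "B = cmod lam * t * (2 * (2 * M) powr \<alpha> * (4 * M)) + (8 * M + 4 * M * t)"
  have "(2::real) powr 1 < 2 powr (1 + \<alpha>)" using \<alpha> by (intro powr_less_mono) auto
  then have k: "k > 0" unfolding k_def using lam t c by (intro mult_pos_pos) auto
  have B: "B > 0" unfolding B_def using M t by (intro add_nonneg_pos add_pos_pos mult_nonneg_nonneg) auto
  have key: "k * h powr (1 + \<alpha>) \<le> B * h powr (1 + b)" if h: "0 < h" "h \<le> 1 / 2" for h
    using integrated_second_difference[OF t(1,2) M(2) h(1) _ u0 c(1) lower[OF _ h]] h
    by (simp add: k_def B_def algebra_simps)
  \<comment> \<open>Chosen so that \<open>B * h powr (b - \<alpha>)\<close> is at most k/2, while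
    \<open>key\<close> forces it to be at least k.\<close>
  define h where "h = min (1 / 2) ((k / (2 * B)) powr (1 / (b - \<alpha>)))"
  have h: "0 < h" "h \<le> 1 / 2" using k B by (auto simp: h_def)
  have "h powr (b - \<alpha>) \<le> ((k / (2 * B)) powr (1 / (b - \<alpha>))) powr (b - \<alpha>)"
    using b h by (intro powr_mono2) (auto simp: h_def)
  also have "\<dots> = k / (2 * B)" using b k B by (simp add: powr_powr)
  finally have "B * h powr (b - \<alpha>) \<le> k / 2" using B by (simp add: field_simps)
  moreover have "k * h powr (1 + \<alpha>) \<le> (B * h powr (b - \<alpha>)) * h powr (1 + \<alpha>)"
    using key[OF h] by (simp add: mult.assoc add.commute flip: powr_add)
  then have "k \<le> B * h powr (b - \<alpha>)" using h by simp
  ultimately show False using k by linarith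
qed

end

theorem theorem1p5:
  fixes \<alpha> s :: real and lam :: complex
  assumes "0 < \<alpha>" and "\<alpha> < 1" and "lam \<noteq> 0"
    and "s > 3 + real CARD('n::finite) / 2 + \<alpha>"
  shows "\<exists>u0 :: real^'n \<Rightarrow> complex. test_function u0 \<and>
           \<not> (\<exists>T>0. \<exists>u. nls_solution \<alpha> lam s u0 T u)"
proof -
  \<comment> \<open>An arbitrary coordinate direction; the index type is nonempty.\<close>
  define i :: 'n where "i = undefined"
  have "\<not> nls_solution \<alpha> lam s (odd_bump i) T u" if T: "T > 0" for T u
  proof
    assume sol: "nls_solution \<alpha> lam s (odd_bump i) T u"
    then have path: "sobolev_path s T u" by (simp add: nls_solution_def)
    have s: "s > real CARD('n) / 2" using assms by linarith
    obtain G where G: "\<And>t. t \<in> {0..T} \<Longrightarrow> G t \<in> borel_measurable borel"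
      "\<And>t. t \<in> {0..T} \<Longrightarrow> square_integrable (\<lambda>\<xi>. of_real (japanese s \<xi>) * G t \<xi>)"
      "\<And>t. t \<in> {0..T} \<Longrightarrow> u t = FT 1 (G t)"
      "\<And>t. t \<in> {0..T} \<Longrightarrow>
        ((\<lambda>r. L2_norm (\<lambda>\<xi>. of_real (japanese s \<xi>) * (G r \<xi> - G t \<xi>))) \<longlongrightarrow> 0) (at t within {0..T})"
      using sobolev_path_representation[OF path s] by blast
    \<comment> \<open>The midpoint between alpha and the smaller of 1 and s - 3 - N/2. Both of these
      exceed alpha by assumption.\<close>
    define b where "b = (\<alpha> + min 1 (s - 3 - real CARD('n) / 2)) / 2"
    interpret nls_path \<alpha> s b T lam u G
    proof
      show "\<alpha> < b" "b < 1" "3 + b < s - real CARD('n) / 2"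
        using assms by (auto simp: b_def min_def field_simps)
      show "((\<lambda>r. u r x) has_vector_derivative - \<i> * (laplacian (u t) x + lam * power_nl \<alpha> (u t x))) (at t within {0..T})"
        if "t \<in> {0..T}" for t x
      proof -
        obtain ut where ut: "((\<lambda>r. u r x) has_vector_derivative ut) (at t within {0..T})"
          "\<i> * ut = laplacian (u t) x + lam * of_real (cmod (u t x) powr \<alpha>) * u t x"
          using sol \<open>t \<in> {0..T}\<close> unfolding nls_solution_def by blast
        have "ut = - \<i> * (\<i> * ut)" by simp
        also have "\<dots> = - \<i> * (laplacian (u t) x + lam * power_nl \<alpha> (u t x))"
          unfolding ut(2) power_nl_def by (simp add: mult.assoc)
        finally show ?thesis using ut(1) by simp
      qed
    qed (use assms T G in auto)
    show False
      by (rule no_odd_bump_data[of i]) (use sol in \<open>simp add: nls_solution_def\<close>)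
  qed
  then show ?thesis using odd_bump_test_function[of i] by blast
qed

end
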